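(* If $f\in\mathcal{M}$ is Liouville-like, then $f$ is moderately aperiodic and strongly aperiodic.
   Context: $\mathcal{M}$ is the class of multiplicative functions $f:\mathbb{N}\to\mathbb{C}$ ($f(mn)=f(m)f(n)$ for coprime $m,n$) with $|f|\le1$; $p$ always denotes a prime and $\mathbb{P}$ the set of primes. $f$ is Liouville-like if $f(n)=\lambda_{\mathcal{P}}(n):=(-1)^{\omega_{\mathcal{P}}(n)}$, where $\omega_{\mathcal{P}}(n)$ is the number of prime divisors of $n$ belonging to $\mathcal{P}$, and $\mathcal{P}\subset\mathbb{P}$ is a set of zero relative density in $\mathbb{P}$ with $\sum_{p\in\mathcal{P}}\frac1p=+\infty$. $f\in\mathcal{M}$ is aperiodic if its Cesàro averages along every infinite arithmetic progression tend to $0$: $\frac1N\sum_{n\le N}f(an+b)\to0$ for all $a\in\mathbb{N}$, $b\in\mathbb{N}\cup\{0\}$. $f$ is strongly aperiodic if for all $Q\ge1$, $$\lim_{X\to\infty}\inf_{|t|\le X}\min_{\chi\bmod q,\ q\le Q}\sum_{p\le X}\frac1p\big(1-\mathrm{Re}(f(p)\chi(p)p^{it})\big)=+\infty.$$ $f$ is moderately aperiodic if $f$ is aperiodic and for some $A>0$, $$\lim_{X\to\infty}\frac1{\log\log X}\inf_{|t|\le X^A}\min_{\chi\bmod q,\ q\le(\log X)^A}\sum_{p\le X}\frac1p\big(1-\mathrm{Re}(f(p)\chi(p)p^{it})\big)=0.$$ Here $\chi$ runs over Dirichlet characters of modulus $q$. *)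

theory Defs
  imports "HOL-Analysis.Analysis" "HOL-Number_Theory.Number_Theory"
begin

text \<open>
  The natural numbers of the source start at 1. Arithmetic functions are total functions on
  \<^typ>\<open>nat\<close>, and no condition below depends on their value at 0.
\<close>

definition mult_unit_disc :: "(nat \<Rightarrow> complex) set" where
  "mult_unit_disc = {f. (\<forall>m>0. \<forall>n>0. coprime m n \<longrightarrow> f (m * n) = f m * f n)
                        \<and> (\<forall>n>0. norm (f n) \<le> 1)}"

definition omega_on :: "nat set \<Rightarrow> nat \<Rightarrow> nat" where
  "omega_on P n = card {p \<in> P. prime p \<and> p dvd n}"

definition lambda_on :: "nat set \<Rightarrow> nat \<Rightarrow> complex" where
  "lambda_on P n = (-1) ^ omega_on P n"

definition zero_relative_density :: "nat set \<Rightarrow> bool" where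
  "zero_relative_density P \<longleftrightarrow>
     (\<lambda>N. real (card {p \<in> P. p \<le> N}) / real (card {p. prime p \<and> p \<le> N})) \<longlonglongrightarrow> 0"

definition liouville_like :: "(nat \<Rightarrow> complex) \<Rightarrow> bool" where
  "liouville_like f \<longleftrightarrow>
     (\<exists>P. P \<subseteq> {p. prime p} \<and> zero_relative_density P
        \<and> filterlim (\<lambda>N::nat. \<Sum>p\<in>{p \<in> P. p \<le> N}. 1 / real p) at_top sequentially
        \<and> (\<forall>n>0. f n = lambda_on P n))"

definition aperiodic :: "(nat \<Rightarrow> complex) \<Rightarrow> bool" where
  "aperiodic f \<longleftrightarrow>
     (\<forall>a>0. \<forall>b. (\<lambda>N::nat. (\<Sum>n=1..N. f (a * n + b)) / of_nat N) \<longlonglongrightarrow> 0)"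

text \<open>
  A Dirichlet character of modulus \<open>q\<close>, extended by 0 to the integers not coprime to \<open>q\<close>.
  The normalisation \<open>chi 1 = 1\<close> follows from multiplicativity and \<open>chi 1 \<noteq> 0\<close>.
\<close>

definition dirichlet_character :: "nat \<Rightarrow> (nat \<Rightarrow> complex) \<Rightarrow> bool" where
  "dirichlet_character q chi \<longleftrightarrow> q > 0
     \<and> (\<forall>m n. chi (m * n) = chi m * chi n)
     \<and> (\<forall>n. chi (n + q) = chi n)
     \<and> (\<forall>n. chi n \<noteq> 0 \<longleftrightarrow> coprime n q)"

definition characters_upto :: "real \<Rightarrow> (nat \<Rightarrow> complex) set" where
  "characters_upto Q = {chi. \<exists>q. real q \<le> Q \<and> dirichlet_character q chi}"

definition twisted_prime_sum :: "(nat \<Rightarrow> complex) \<Rightarrow> (nat \<Rightarrow> complex) \<Rightarrow> real \<Rightarrow> real \<Rightarrow> real" where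
  "twisted_prime_sum f chi t X =
     (\<Sum>p | prime p \<and> real p \<le> X.
        1 / real p * (1 - Re (f p * chi p * of_nat p powr (\<i> * of_real t))))"

text \<open>
  The minimum is over a finite set, nonempty for \<open>Q \<ge> 1\<close> (lemmas \<open>finite_characters_upto\<close> and
  \<open>characters_upto_nonempty\<close>); the infimum is over a nonempty set for \<open>T \<ge> 0\<close>, bounded below by
  0 when \<open>f \<in> mult_unit_disc\<close>.
\<close>

definition min_twisted_sum :: "(nat \<Rightarrow> complex) \<Rightarrow> real \<Rightarrow> real \<Rightarrow> real \<Rightarrow> real" where
  "min_twisted_sum f T Q X =
     (INF t\<in>{t. \<bar>t\<bar> \<le> T}. Min ((\<lambda>chi. twisted_prime_sum f chi t X) ` characters_upto Q))"

definition strongly_aperiodic :: "(nat \<Rightarrow> complex) \<Rightarrow> bool" where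
  "strongly_aperiodic f \<longleftrightarrow>
     (\<forall>Q\<ge>1. filterlim (\<lambda>X. min_twisted_sum f X Q X) at_top at_top)"

definition moderately_aperiodic :: "(nat \<Rightarrow> complex) \<Rightarrow> bool" where
  "moderately_aperiodic f \<longleftrightarrow> aperiodic f
     \<and> (\<exists>A>0. ((\<lambda>X. 1 / ln (ln X) * min_twisted_sum f (X powr A) (ln X powr A) X) \<longlongrightarrow> 0) at_top)"

lemma dirichlet_character_mod:
  assumes "dirichlet_character q chi"
  shows "chi (n mod q) = chi n"
proof -
  have "chi (m + k * q) = chi m" for m k
  proof (induction k)
    case (Suc k)
    have "chi (m + Suc k * q) = chi ((m + k * q) + q)" by (simp add: algebra_simps)
    also have "\<dots> = chi (m + k * q)" using assms unfolding dirichlet_character_def by blast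
    finally show ?case using Suc by simp
  qed simp
  from this[of "n mod q" "n div q"] show ?thesis by simp
qed

lemma dirichlet_character_1:
  assumes "dirichlet_character q chi"
  shows "chi 1 = 1"
proof -
  have "chi (1 * 1) = chi 1 * chi 1" "chi 1 \<noteq> 0"
    using assms unfolding dirichlet_character_def by (blast, simp)
  thus ?thesis by simp
qed

lemma dirichlet_character_root_of_unity:
  assumes "dirichlet_character q chi" "coprime n q"
  shows "chi n ^ totient q = 1"
proof -
  have "chi (n ^ k) = chi n ^ k" for k
  proof (induction k)
    case 0
    show ?case using dirichlet_character_1[OF assms(1)] by simp
  next
    case (Suc k)
    thus ?case using assms(1) unfolding dirichlet_character_def by simp
  qed
  hence "chi n ^ totient q = chi (n ^ totient q mod q)"
    by (simp add: dirichlet_character_mod[OF assms(1)])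
  also have "\<dots> = chi (1 mod q)"
    using euler_theorem[OF assms(2)] by (simp add: cong_def)
  also have "\<dots> = 1"
    using dirichlet_character_mod[OF assms(1), of 1] dirichlet_character_1[OF assms(1)] by simp
  finally show ?thesis .
qed

lemma finite_dirichlet_characters: "finite {chi. dirichlet_character q chi}"
proof (cases "q > 0")
  case True
  let ?Z = "insert 0 {z::complex. z ^ totient q = 1}"
  have "finite ?Z"
    using True finite_roots_unity[of "totient q"] by (simp add: Suc_le_eq)
  hence fin: "finite (PiE {..<q} (\<lambda>_. ?Z))" by (intro finite_PiE) auto
  have "{chi. dirichlet_character q chi} \<subseteq> (\<lambda>g n. g (n mod q)) ` PiE {..<q} (\<lambda>_. ?Z)"
  proof
    fix chi assume "chi \<in> {chi. dirichlet_character q chi}"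
    hence chi: "dirichlet_character q chi" by simp
    have "chi n \<in> ?Z" for n
      using chi dirichlet_character_root_of_unity[OF chi, of n]
      unfolding dirichlet_character_def by auto
    hence "restrict chi {..<q} \<in> PiE {..<q} (\<lambda>_. ?Z)" by auto
    moreover have "chi = (\<lambda>n. restrict chi {..<q} (n mod q))"
      using True dirichlet_character_mod[OF chi] by (auto simp: fun_eq_iff)
    ultimately show "chi \<in> (\<lambda>g n. g (n mod q)) ` PiE {..<q} (\<lambda>_. ?Z)" by blast
  qed
  thus ?thesis using fin finite_surj by blast
qed (simp add: dirichlet_character_def)

lemma finite_characters_upto: "finite (characters_upto Q)"
proof -
  have "characters_upto Q \<subseteq> (\<Union>q\<in>{..nat \<lfloor>Q\<rfloor>}. {chi. dirichlet_character q chi})"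
    unfolding characters_upto_def by (auto intro!: bexI le_nat_floor)
  thus ?thesis by (rule finite_subset) (auto simp: finite_dirichlet_characters)
qed

lemma characters_upto_nonempty: "Q \<ge> 1 \<Longrightarrow> characters_upto Q \<noteq> {}"
proof -
  assume "Q \<ge> 1"
  moreover have "dirichlet_character 1 (\<lambda>_. 1)" by (simp add: dirichlet_character_def)
  ultimately have "(\<lambda>_. 1) \<in> characters_upto Q"
    unfolding characters_upto_def by (intro CollectI exI[of _ 1]) simp
  thus ?thesis by blast
qed

end

theory Submission
  imports Defs "HOL-Complex_Analysis.Complex_Analysis" "HOL-Real_Asymp.Real_Asymp"
begin


text \<open>
  Write \<open>\<lambda>\<^sub>P\<close> for the function. Since \<open>P\<close> has zero relative density, the sum of \<open>1 / p\<close> over \<open>p\<close> in \<open>P\<close> up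
  to \<open>X\<close> is \<open>o(log log X)\<close>; the choice \<open>t = 0\<close>, \<open>\<chi> = 1\<close> gives the limit in moderate aperiodicity.

  Aperiodicity: \<open>\<lambda>\<^sub>P = 1 * h\<close> with \<open>h\<close> supported on squarefree \<open>d\<close> composed of primes of \<open>P\<close> and
  \<open>h(d) = (-2)^\<omega>(d)\<close>. Sparsity makes the sum of \<open>|h(d)|\<close> over \<open>d \<le> x\<close> equal to \<open>o(x)\<close>, so, once the primes
  dividing the modulus are discarded, the mean of \<open>\<lambda>\<^sub>P\<close> along a progression is \<open>D\<^sub>P(x) + o(1)\<close>, where
  \<open>D\<^sub>P(x)\<close> is the sum of \<open>h(d) / d\<close> over \<open>d \<le> x\<close>. Always \<open>|D\<^sub>P(x)| \<le> 1 + o(1)\<close>, and \<open>D\<^sub>P\<close> varies so slowly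
  that removing a prime \<open>p\<close> from \<open>P\<close> costs the factor \<open>1 - 2 / p\<close>; as the sum of \<open>1 / p\<close> diverges, \<open>D\<^sub>P\<close>
  tends to 0.

  Strong aperiodicity: for \<open>|t| \<le> 2\<close> one compares with the Euler product at \<open>1 + 1 / log X\<close>, using that
  \<open>L(s, \<chi>)\<close> is bounded there for nonprincipal \<open>\<chi>\<close>, and that zeta has size \<open>1 / |t|\<close> at height \<open>t\<close> for
  principal \<open>\<chi>\<close>; in the latter case the primes below \<open>exp (1 / |t|)\<close> are treated as for \<open>t = 0\<close>. For
  \<open>|t| > 2\<close> it is enough to use the primes in \<open>(X^(1/k), X]\<close> with \<open>k\<close> fixed but large, on which the sum of
  \<open>1 / p\<close> over \<open>P\<close> is negligible. Raising to the power \<open>\<phi>(q)\<close> removes \<open>\<chi>\<close>, and the sum of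
  \<open>cos (t log p) / p\<close> over this range is bounded independently of \<open>k\<close>: it is controlled by the integral
  of \<open>Re (-\<zeta>'/\<zeta>)\<close> just to the right of abscissa 1. There the zeros of zeta to the left only help, and
  a bound \<open>O(|t|^\<epsilon>)\<close> for zeta in a disc of fixed radius, which van der Corput's method provides, is
  enough: no zero-free region is needed.
\<close>

section \<open>Logarithmic derivatives in a disc\<close>

text \<open>The range |t| > 2 is governed by an exponent count. If zeta has size |t|^\<epsilon> in a
  disc of radius r about a point just to the right of abscissa 1, then Re (-zeta'/zeta) is at most
  about (\<epsilon> / r) log X there. The segment from 1 + 1 / log X to 1 + k / log X, which
  isolates the primes in (X^(1/k), X], has length about k / log X, so the cosine sum is O(k
  \<epsilon> / r). A convexity bound has \<epsilon> proportional to r and gives O(k), useless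
  against the main term log k. Van der Corput's method gives \<epsilon> = r / k with r depending on
  k, and the product is a constant. This is why the growth bound ties the exponent to the width of
  the strip, and why exponential sums of length N are needed for t up to every fixed power of N. As
  P takes at most half of the main term, about (log k) / 2 survives, and k is taken large in terms
  of the bound to be reached.\<close>

lemma deriv_holomorphic_log:
  assumes "open S" "l holomorphic_on S" "\<And>z. z \<in> S \<Longrightarrow> exp (l z) = g z" "s \<in> S"
  shows "deriv l s = deriv g s / g s"
proof -
  have "(l has_field_derivative deriv l s) (at s)" by (rule holomorphic_derivI[OF assms(2,1,4)])
  hence de: "((\<lambda>z. exp (l z)) has_field_derivative exp (l s) * deriv l s) (at s)"
    by (auto intro!: derivative_eq_intros)
  have ev: "\<forall>\<^sub>F z in nhds s. exp (l z) = g z"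
    using eventually_nhds_in_open[OF assms(1,4)] by eventually_elim (rule assms(3))
  have "(g has_field_derivative g s * deriv l s) (at s)"
    using iffD1[OF DERIV_cong_ev[OF refl ev refl] de] unfolding assms(3)[OF assms(4)] .
  hence "deriv g s = g s * deriv l s" by (rule DERIV_imp_deriv)
  moreover have "g s \<noteq> 0" using assms(3)[OF assms(4)] by (metis exp_not_eq_zero)
  ultimately show ?thesis by simp
qed

text \<open>A logarithm of \<open>g\<close> has values in the left half-plane. The Cayley transform
  that sends its value at 0 to the origin maps this half-plane into the unit disc, and Schwarz's
  lemma bounds the derivative at 0.\<close>

lemma norm_log_deriv_center_le:
  fixes g :: "complex \<Rightarrow> complex"
  assumes r: "r > 0" and hol: "g holomorphic_on ball 0 r"
    and nz: "\<And>z. z \<in> ball 0 r \<Longrightarrow> g z \<noteq> 0" and le: "\<And>z. z \<in> ball 0 r \<Longrightarrow> norm (g z) \<le> 1"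
    and g0: "norm (g 0) < 1"
  shows "norm (deriv g 0 / g 0) \<le> 2 / r * (- ln (norm (g 0)))"
proof -
  have 0: "0 \<in> ball (0::complex) r" using r by simp
  obtain l where l: "l holomorphic_on ball 0 r" and exl: "\<And>x. x \<in> ball 0 r \<Longrightarrow> exp (l x) = g x"
    using holomorphic_logarithm_exists[OF convex_ball open_ball hol nz 0] by metis
  have Rel: "Re (l z) = ln (norm (g z))" if "z \<in> ball 0 r" for z
    using exl[OF that] by (metis ln_exp norm_exp_eq_Re)
  have Re_le: "Re (l z) \<le> 0" if "z \<in> ball 0 r" for z
    using Rel[OF that] le[OF that] nz[OF that] by simp
  define a where "a = l 0"
  have Rea: "Re a < 0" using Rel[OF 0] g0 nz[OF 0] by (simp add: a_def)
  define \<phi> where "\<phi> = (\<lambda>w. (l (of_real r * w) - a) / (l (of_real r * w) + cnj a))"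
  have inb: "of_real r * w \<in> ball 0 r" if "norm w < 1" for w :: complex
    using that r by (simp add: norm_mult)
  have den: "l (of_real r * w) + cnj a \<noteq> 0" if "norm w < 1" for w
    using Re_le[OF inb[OF that]] Rea by (auto simp: complex_eq_iff)
  have lcomp: "(\<lambda>w. l (of_real r * w)) holomorphic_on ball 0 1"
    using holomorphic_on_compose_gen[OF _ l, of "\<lambda>w. of_real r * w" "ball 0 1"] inb
    by (force simp: o_def intro: holomorphic_intros)
  have hol\<phi>: "\<phi> holomorphic_on ball 0 1"
    unfolding \<phi>_def by (intro holomorphic_intros lcomp) (use den in auto)
  have lt: "norm (\<phi> w) < 1" if w: "norm w < 1" for w
  proof -
    let ?x = "l (of_real r * w)"
    \<comment> \<open>Equality of the two distances forces a value on the imaginary axis, where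
      \<open>g\<close> has modulus 1; the maximum modulus principle then makes \<open>g\<close>
      constant, against \<open>g0\<close>.\<close>
    have "(norm (?x - a))\<^sup>2 < (norm (?x + cnj a))\<^sup>2 \<or> (norm (?x - a))\<^sup>2 \<le> (norm (?x + cnj a))\<^sup>2 \<and> Re ?x = 0"
    proof -
      have "(norm (?x + cnj a))\<^sup>2 - (norm (?x - a))\<^sup>2 = 4 * Re ?x * Re a"
        unfolding cmod_power2 by (simp add: power2_eq_square algebra_simps)
      moreover have "Re ?x * Re a \<ge> 0" using Re_le[OF inb[OF w]] Rea by (simp add: mult_nonpos_nonpos)
      moreover have "Re ?x * Re a > 0 \<or> Re ?x = 0" using Re_le[OF inb[OF w]] Rea
        using mult_neg_neg[of "Re ?x" "Re a"] by linarith
      ultimately show ?thesis by auto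
    qed
    thus ?thesis
    proof
      assume "(norm (?x - a))\<^sup>2 < (norm (?x + cnj a))\<^sup>2"
      hence "norm (?x - a) < norm (?x + cnj a)" by (rule power2_less_imp_less) simp
      thus ?thesis using den[OF w] by (simp add: \<phi>_def norm_divide divide_simps)
    next
      assume A: "(norm (?x - a))\<^sup>2 \<le> (norm (?x + cnj a))\<^sup>2 \<and> Re ?x = 0"
      hence n1: "norm (g (of_real r * w)) = 1" using Rel[OF inb[OF w]] nz[OF inb[OF w]] by simp
      have "g constant_on ball 0 r"
        by (rule maximum_modulus_principle[OF hol _ _ _ _ inb[OF w]])
           (use le n1 in \<open>auto simp: convex_connected\<close>)
      hence "g 0 = g (of_real r * w)" using 0 inb[OF w] unfolding constant_on_def by metis
      thus ?thesis using n1 g0 by simp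
    qed
  qed
  have d1: "norm (deriv \<phi> 0) \<le> 1"
    by (rule Schwarz_Lemma(2)[OF hol\<phi> _ lt, of 0]) (auto simp: \<phi>_def a_def)
  have dl: "(l has_field_derivative deriv l 0) (at 0)"
    using holomorphic_derivI[OF l open_ball 0] by simp
  have dlr: "((\<lambda>w. l (of_real r * w)) has_field_derivative deriv l 0 * of_real r) (at 0)"
    using DERIV_chain2[of l "deriv l 0" "\<lambda>w. of_real r * w" 0 "of_real r"] dl
    by (auto intro!: derivative_eq_intros)
  have "(\<phi> has_field_derivative
          ((deriv l 0 * of_real r) * (a + cnj a) - (a - a) * (deriv l 0 * of_real r))
            / ((a + cnj a) * (a + cnj a))) (at 0)"
    unfolding \<phi>_def
    by (rule derivative_eq_intros dlr refl | use den[of 0] in \<open>simp add: a_def\<close>)+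
  hence "deriv \<phi> 0 = deriv l 0 * of_real r / (a + cnj a)"
    using den[of 0] by (simp add: DERIV_imp_deriv a_def)
  also have "a + cnj a = of_real (2 * Re a)" by (simp add: complex_add_cnj)
  finally have "norm (deriv l 0) * r / (2 * (- Re a)) \<le> 1"
    using d1 r Rea by (simp add: norm_divide norm_mult)
  hence A: "norm (deriv l 0) \<le> 2 / r * (- Re a)"
    using r Rea by (simp add: field_simps)
  have "deriv g 0 / g 0 = deriv l 0"
    by (rule deriv_holomorphic_log[OF open_ball l exl 0, symmetric])
  thus ?thesis using A Rel[OF 0] by (simp add: a_def)
qed


text \<open>The factor \<open>R * (z - \<rho>) / (R\<^sup>2 - cnj \<rho> * z)\<close> has modulus 1
  on the circle of radius \<open>R\<close>, so dividing by it keeps the bound there and, by the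
  maximum principle, inside. The identity avoids division so that it also holds at
  \<open>\<rho>\<close>; \<open>R < R'\<close> gives holomorphy across the circle.\<close>

lemma divide_Blaschke_factor:
  fixes f :: "complex \<Rightarrow> complex"
  assumes R: "R > 0" "R < R'" and hol: "f holomorphic_on ball 0 R'"
    and le: "\<And>z. norm z \<le> R \<Longrightarrow> norm (f z) \<le> B"
    and rho: "f \<rho> = 0" "norm \<rho> < R"
  obtains g where "g holomorphic_on ball 0 R'" "\<And>z. norm z \<le> R \<Longrightarrow> norm (g z) \<le> B"
    "\<And>z. norm z < R' \<Longrightarrow> of_real R * (z - \<rho>) * g z = f z * (of_real (R\<^sup>2) - cnj \<rho> * z)"
proof -
  define h where "h = (\<lambda>z. if z = \<rho> then deriv f \<rho> else (f z - f \<rho>) / (z - \<rho>))"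
  define g where "g = (\<lambda>z. h z * (of_real (R\<^sup>2) - cnj \<rho> * z) / of_real R)"
  have holh: "h holomorphic_on ball 0 R'"
    unfolding h_def by (rule pole_lemma_open[OF hol open_ball])
  have holg: "g holomorphic_on ball 0 R'"
    unfolding g_def using R by (intro holomorphic_intros holh) auto
  have eq: "of_real R * (z - \<rho>) * g z = f z * (of_real (R\<^sup>2) - cnj \<rho> * z)" for z
    using R rho by (simp add: g_def h_def)
  have sphere: "norm (g z) \<le> B" if z: "norm z = R" for z
  proof -
    have "of_real (R\<^sup>2) = z * cnj z" using z by (metis complex_norm_square)
    hence "of_real (R\<^sup>2) - cnj \<rho> * z = z * cnj (z - \<rho>)" by (simp add: algebra_simps)
    hence "norm (of_real (R\<^sup>2) - cnj \<rho> * z) = R * norm (z - \<rho>)"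
      using z by (metis complex_mod_cnj norm_mult)
    hence "R * norm (z - \<rho>) * norm (g z) = norm (f z) * (R * norm (z - \<rho>))"
      using arg_cong[OF eq[of z], of norm] R by (simp add: norm_mult)
    moreover have "R * norm (z - \<rho>) \<noteq> 0" using R z rho(2) by auto
    ultimately show ?thesis using le[of z] z by simp
  qed
  have "norm (g z) \<le> B" if z: "norm z \<le> R" for z
  proof (rule maximum_modulus_frontier[of g "cball 0 R"])
    show "g holomorphic_on interior (cball 0 R)"
      by (rule holomorphic_on_subset[OF holg]) (use R in auto)
    show "continuous_on (closure (cball 0 R)) g"
      by (rule continuous_on_subset[OF holomorphic_on_imp_continuous_on[OF holg]]) (use R in auto)
    show "bounded (cball (0::complex) R)" by simp
    show "norm (g w) \<le> B" if "w \<in> frontier (cball 0 R)" for w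
      using that R by (intro sphere) (auto simp: frontier_cball)
    show "z \<in> cball 0 R" using z by simp
  qed
  with holg eq show ?thesis by (intro that) auto
qed

text \<open>
  Zeros in the left half of the disc contribute nonnegatively to the real part of the logarithmic
  derivative at 0, so they can be divided out. Removing a zero of modulus at most \<open>R / 2\<close> at least
  doubles \<open>norm (f 0)\<close>, which stays below 1: the hypothesis \<open>f0\<close> bounds the number of removals
  without any count of multiplicities.
\<close>

lemma Re_log_deriv_center_ge_aux:
  fixes f :: "complex \<Rightarrow> complex"
  assumes R: "R > 0" "R < R'" and hol: "f holomorphic_on ball 0 R'"
    and le: "\<And>z. norm z \<le> R \<Longrightarrow> norm (f z) \<le> 1 / 2"
    and zeros: "\<And>z. norm z < R \<Longrightarrow> f z = 0 \<Longrightarrow> Re z \<le> 0"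
    and f0: "norm (f 0) \<ge> (1 / 2) ^ n"
  shows "Re (deriv f 0 / f 0) \<ge> - (4 / R * (- ln (norm (f 0))))"
  using hol le zeros f0
proof (induction n arbitrary: f)
  case 0
  \<comment> \<open>Here \<open>f0\<close> asks for modulus at least 1 at the centre, while the
    bound is 1/2.\<close>
  from 0(2)[of 0] 0(4) R show ?case by simp
next
  case (Suc n)
  note hol = Suc.prems(1) and le = Suc.prems(2) and zeros = Suc.prems(3) and f0 = Suc.prems(4)
  have f0nz: "f 0 \<noteq> 0" using f0 by (metis norm_zero not_le zero_less_divide_1_iff zero_less_numeral zero_less_power)
  show ?case
  proof (cases "\<exists>\<rho>. norm \<rho> < R / 2 \<and> f \<rho> = 0")
    case False
    \<comment> \<open>The zero-free disc has radius \<open>R / 2\<close>, which produces the factor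
      4 / R of the claim.\<close>
    have "norm (deriv f 0 / f 0) \<le> 2 / (R / 2) * (- ln (norm (f 0)))"
    proof (rule norm_log_deriv_center_le)
      show "f holomorphic_on ball 0 (R / 2)"
        by (rule holomorphic_on_subset[OF hol]) (use R in auto)
      show "norm (f 0) < 1" using le[of 0] R by simp
      show "norm (f z) \<le> 1" if "z \<in> ball 0 (R / 2)" for z using le[of z] that R by simp
    qed (use R False in auto)
    thus ?thesis using abs_Re_le_cmod[of "deriv f 0 / f 0"] by simp
  next
    case True
    then obtain \<rho> where rho: "norm \<rho> < R / 2" "f \<rho> = 0" by blast
    have rho0: "\<rho> \<noteq> 0" using rho f0nz by auto
    obtain g where g: "g holomorphic_on ball 0 R'" "\<And>z. norm z \<le> R \<Longrightarrow> norm (g z) \<le> 1 / 2"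
      and eq: "\<And>z. norm z < R' \<Longrightarrow> of_real R * (z - \<rho>) * g z = f z * (of_real (R\<^sup>2) - cnj \<rho> * z)"
      using divide_Blaschke_factor[OF R hol le rho(2)] rho R by (metis (no_types, lifting) half_gt_zero_iff less_le_trans field_sum_of_halves le_add_same_cancel1 less_imp_le)
    have eq0: "- (of_real R * \<rho> * g 0) = f 0 * of_real (R\<^sup>2)"
      using eq[of 0] R by simp
    have ng0: "norm \<rho> * norm (g 0) = norm (f 0) * R"
      using arg_cong[OF eq0, of norm] R by (simp add: norm_mult power2_eq_square)
    have ge: "norm (g 0) \<ge> 2 * norm (f 0)"
    proof -
      have "norm (f 0) * R \<le> R / 2 * norm (g 0)"
        unfolding ng0[symmetric] using rho by (intro mult_right_mono) auto
      thus ?thesis using R by simp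
    qed
    have g0nz: "g 0 \<noteq> 0" using ge f0nz by auto
    have IH: "Re (deriv g 0 / g 0) \<ge> - (4 / R * (- ln (norm (g 0))))"
    proof (rule Suc.IH[OF g])
      fix z assume z: "norm z < R" "g z = 0"
      have "norm (cnj \<rho> * z) < R * R"
        using z rho R by (auto simp: norm_mult intro!: mult_strict_mono')
      hence "of_real (R\<^sup>2) - cnj \<rho> * z \<noteq> 0"
        by (auto simp: power2_eq_square norm_mult dest: arg_cong[of _ _ norm])
      hence "f z = 0" using eq[of z] z R by simp
      thus "Re z \<le> 0" using zeros z by blast
    next
      show "(1 / 2) ^ n \<le> norm (g 0)" using ge f0 by simp
    qed
    have "norm (f 0) \<le> norm (g 0)" using ge norm_ge_zero[of "f 0"] by linarith
    hence "- ln (norm (g 0)) \<le> - ln (norm (f 0))"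
      using f0nz g0nz by simp
    hence "- (4 / R * (- ln (norm (f 0)))) \<le> - (4 / R * (- ln (norm (g 0))))"
      using R by (simp add: field_simps)
    moreover have "Re (deriv f 0 / f 0) \<ge> Re (deriv g 0 / g 0)"
    proof -
      have in0: "0 \<in> ball (0::complex) R'" using R by simp
      have df: "(f has_field_derivative deriv f 0) (at 0)"
        using holomorphic_derivI[OF hol open_ball in0] by simp
      have dg: "(g has_field_derivative deriv g 0) (at 0)"
        using holomorphic_derivI[OF g(1) open_ball in0] by simp
      have "((\<lambda>z. of_real R * (z - \<rho>) * g z) has_field_derivative
              of_real R * g 0 - of_real R * \<rho> * deriv g 0) (at 0)"
        by (rule derivative_eq_intros dg refl | simp)+
      note d1 = this
      have d2: "((\<lambda>z. f z * (of_real (R\<^sup>2) - cnj \<rho> * z)) has_field_derivative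
              deriv f 0 * of_real (R\<^sup>2) - f 0 * cnj \<rho>) (at 0)"
        by (rule derivative_eq_intros df refl | simp)+
      have ev: "\<forall>\<^sub>F z in nhds 0. of_real R * (z - \<rho>) * g z = f z * (of_real (R\<^sup>2) - cnj \<rho> * z)"
        using eventually_nhds_in_open[OF open_ball in0] by eventually_elim (use eq in auto)
      have "of_real R * g 0 - of_real R * \<rho> * deriv g 0
          = deriv f 0 * of_real (R\<^sup>2) - f 0 * cnj \<rho>"
        by (rule DERIV_unique[OF iffD1[OF DERIV_cong_ev[OF refl ev refl] d1] d2])
      hence "deriv f 0 * of_real (R\<^sup>2) = f 0 * cnj \<rho> + of_real R * g 0 - of_real R * \<rho> * deriv g 0"
        by (simp add: algebra_simps)
      hence main: "deriv f 0 * of_real (R\<^sup>2) / (f 0 * of_real (R\<^sup>2))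
          = f 0 * cnj \<rho> / (f 0 * of_real (R\<^sup>2))
            + (of_real R * g 0 - of_real R * \<rho> * deriv g 0) / (- (of_real R * \<rho> * g 0))"
        unfolding eq0 by (simp only: add_diff_eq[symmetric] add_divide_distrib)
      have t: "deriv f 0 * of_real (R\<^sup>2) / (f 0 * of_real (R\<^sup>2)) = deriv f 0 / f 0"
        "f 0 * cnj \<rho> / (f 0 * of_real (R\<^sup>2)) = cnj \<rho> / of_real (R\<^sup>2)"
        using R f0nz by simp_all
      have t3: "(of_real R * g 0 - of_real R * \<rho> * deriv g 0) / (- (of_real R * \<rho> * g 0))
          = deriv g 0 / g 0 - 1 / \<rho>"
        using R g0nz rho0 by (simp add: diff_divide_distrib)
      have "deriv f 0 / f 0 = cnj \<rho> / of_real (R\<^sup>2) - 1 / \<rho> + deriv g 0 / g 0"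
        using main unfolding t t3 by (simp add: algebra_simps)
      \<comment> \<open>The contribution of the removed zero: nonnegative, because
        \<open>\<rho>\<close> lies in the left half-plane and at distance less than \<open>R\<close>
        from 0.\<close>
      moreover have "Re (cnj \<rho> / of_real (R\<^sup>2) - 1 / \<rho>) = Re \<rho> * (1 / R\<^sup>2 - 1 / (norm \<rho>)\<^sup>2)"
      proof -
        have "Re (1 / \<rho>) = Re \<rho> / (norm \<rho>)\<^sup>2" by (simp add: Re_divide cmod_power2)
        moreover have "Re (cnj \<rho> / of_real (R\<^sup>2)) = Re \<rho> / R\<^sup>2" by (simp only: Re_divide_of_real) simp
        ultimately show ?thesis by (simp add: right_diff_distrib)
      qed
      moreover have "Re \<rho> * (1 / R\<^sup>2 - 1 / (norm \<rho>)\<^sup>2) \<ge> 0"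
      proof (rule mult_nonpos_nonpos)
        show "Re \<rho> \<le> 0" using zeros rho R by auto
        have "(norm \<rho>)\<^sup>2 \<le> R\<^sup>2" using rho R by (intro power_mono) auto
        thus "1 / R\<^sup>2 - 1 / (norm \<rho>)\<^sup>2 \<le> 0" using rho0 R by (simp add: frac_le)
      qed
      ultimately show ?thesis by simp
    qed
    ultimately show ?thesis using IH by linarith
  qed
qed

text \<open>Division by \<open>2 * B\<close> produces the bound 1/2 of the centred form. Any
  \<open>n\<close> with \<open>(1 / 2) ^ n\<close> below the central value serves there, so the
  number of zeros leaves no trace in the conclusion.\<close>

lemma Re_log_deriv_ge:
  fixes f :: "complex \<Rightarrow> complex"
  assumes R: "R > 0" "R < R'" and hol: "f holomorphic_on ball c R'" and B: "B > 0"
    and le: "\<And>z. norm (z - c) \<le> R \<Longrightarrow> norm (f z) \<le> B"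
    and zeros: "\<And>z. Re z \<ge> Re c \<Longrightarrow> norm (z - c) < R \<Longrightarrow> f z \<noteq> 0"
  shows "Re (deriv f c / f c) \<ge> - (4 / R * (ln (2 * B) - ln (norm (f c))))"
proof -
  define g where "g = (\<lambda>z. f (c + z) / of_real (2 * B))"
  have fc: "f c \<noteq> 0" using zeros[of c] R by simp
  have "(\<lambda>z. f (c + z)) holomorphic_on ball 0 R'"
    using holomorphic_on_compose_gen[OF _ hol, of "\<lambda>z. c + z" "ball 0 R'"]
    by (force simp: o_def dist_norm intro: holomorphic_intros)
  hence holg: "g holomorphic_on ball 0 R'"
    unfolding g_def using B by (intro holomorphic_intros) auto
  have g0: "norm (g 0) > 0" using fc B by (simp add: g_def)
  obtain n where n: "(1 / 2) ^ n < norm (g 0)"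
    using real_arch_pow_inv[OF g0, of "1/2"] by auto
  have "Re (deriv g 0 / g 0) \<ge> - (4 / R * (- ln (norm (g 0))))"
  proof (rule Re_log_deriv_center_ge_aux[OF R holg])
    show "norm (g z) \<le> 1 / 2" if "norm z \<le> R" for z
      using le[of "c + z"] that B by (simp add: g_def norm_divide field_simps)
    show "Re z \<le> 0" if "norm z < R" "g z = 0" for z
      using zeros[of "c + z"] that B by (force simp: g_def)
    show "(1 / 2) ^ n \<le> norm (g 0)" using n by simp
  qed
  moreover have "deriv g 0 = deriv f c / of_real (2 * B)"
  proof -
    have "c \<in> ball c R'" using R by simp
    hence "(f has_field_derivative deriv f c) (at c)"
      using holomorphic_derivI[OF hol open_ball] by simp
    hence "((\<lambda>z. f (c + z)) has_field_derivative deriv f c) (at 0)"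
      using DERIV_shift[of f "deriv f c" 0 c] by (simp add: add.commute)
    from DERIV_cdivide[OF this] show ?thesis unfolding g_def by (rule DERIV_imp_deriv)
  qed
  moreover have "- ln (norm (g 0)) = ln (2 * B) - ln (norm (f c))"
    using fc B by (simp add: g_def norm_divide ln_div norm_mult)
  moreover have "deriv f c / of_real (2 * B) / g 0 = deriv f c / f c" using B by (simp add: g_def)
  ultimately show ?thesis by metis
qed



section \<open>Exponential sums\<close>

text \<open>With e(x) = exp (2 pi i x), one has 1 / (e(d) - 1) = -1/2 - (i/2) cot (pi d). Each term
  becomes a difference of two terms times a weight that is monotone in \<open>d\<close>, ready for
  partial summation.\<close>

lemma cis_eq_diff_times_cot:
  assumes s: "sin (pi * d) \<noteq> 0"
  shows "cis (2 * pi * x) = (cis (2 * pi * (x + d)) - cis (2 * pi * x)) * (- 1 / 2 - \<i> / 2 * of_real (cot (pi * d)))"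
proof -
  define S where "S = sin (pi * d)"
  define C where "C = cos (pi * d)"
  have SC: "C * C = 1 - S * S" using sin_cos_squared_add[of "pi * d"] by (simp add: S_def C_def power2_eq_square)
  have e: "cis (2 * pi * (x + d)) = cis (2 * pi * x) * cis (2 * (pi * d))"
    by (simp add: cis_mult algebra_simps)
  have "cis (2 * (pi * d)) = Complex (1 - 2 * S * S) (2 * S * C)"
    by (simp add: complex_eq_iff sin_double cos_double_sin S_def C_def power2_eq_square)
  moreover have "- 1 / 2 - \<i> / 2 * of_real (cot (pi * d)) = Complex (- 1 / 2) (- (C / S) / 2)"
    by (simp add: complex_eq_iff cot_def S_def C_def)
  moreover have "(Complex (1 - 2 * S * S) (2 * S * C) - 1) * Complex (- 1 / 2) (- (C / S) / 2) = 1"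
    using s SC by (simp add: complex_eq_iff S_def[symmetric] C_def[symmetric] algebra_simps)
  ultimately have "(cis (2 * (pi * d)) - 1) * (- 1 / 2 - \<i> / 2 * of_real (cot (pi * d))) = 1" by metis
  hence "cis (2 * pi * x) = cis (2 * pi * x) * ((cis (2 * (pi * d)) - 1) * (- 1 / 2 - \<i> / 2 * of_real (cot (pi * d))))" by simp
  also have "x * ((E - 1) * K) = (x * E - x) * K" for x E K :: complex by (simp add: algebra_simps)
  finally show ?thesis unfolding e .
qed

text \<open>Jordan's inequality, from concavity of the sine, and its reflection in 1/2.\<close>

lemma sin_pi_ge:
  fixes x \<delta> :: real
  assumes "0 < \<delta>" "\<delta> \<le> x" "x \<le> 1 - \<delta>"
  shows "sin (pi * x) \<ge> 2 * \<delta>"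
proof -
  have *: "sin (pi * y) \<ge> 2 * y" if "0 \<le> y" "y \<le> 1 / 2" for y :: real
  proof -
    have "convex_on {0..pi} (\<lambda>x. - sin x)"
      by (rule f''_ge0_imp_convex[where f' = "\<lambda>x. - cos x" and f'' = sin])
         (auto intro!: derivative_eq_intros sin_ge_zero)
    from convex_onD[OF this, of "2 * y" 0 "pi / 2"] that show ?thesis
      by (simp add: field_simps)
  qed
  show ?thesis
  proof (cases "x \<le> 1 / 2")
    case True thus ?thesis using *[of x] assms by linarith
  next
    case False
    have "2 * \<delta> \<le> 2 * (1 - x)" using assms by simp
    also have "\<dots> \<le> sin (pi * (1 - x))" using assms False by (intro *) auto
    also have "\<dots> = sin (pi * x)" by (simp add: algebra_simps)
    finally show ?thesis .
  qed
qed

lemma cot_decreasing: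
  fixes x y :: real
  assumes "0 < x" "x \<le> y" "y < pi"
  shows "cot y \<le> cot x"
proof -
  have s: "sin x > 0" "sin y > 0" using assms by (auto intro!: sin_gt_zero)
  have "sin (y - x) \<ge> 0" using assms by (intro sin_ge_zero) auto
  hence "cot x - cot y \<ge> 0" using s
    by (simp add: cot_def field_simps sin_diff)
  thus ?thesis by simp
qed

text \<open>Partial summation with cotangent weights. They decrease, because the differences of
  \<open>u\<close> increase inside a unit interval, so their total variation telescopes to at most 1
  / \<open>\<delta>\<close>. The integer \<open>m\<close> disappears by periodicity.\<close>

lemma Kuzmin_Landau:
  fixes u :: "nat \<Rightarrow> real" and m :: int and \<delta> :: real
  assumes "\<delta> > 0" and ab: "a < b"
    and rng: "\<And>n. a \<le> n \<Longrightarrow> n < b \<Longrightarrow> m + \<delta> \<le> u (Suc n) - u n \<and> u (Suc n) - u n \<le> m + 1 - \<delta>"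
    and mono: "\<And>n. a \<le> n \<Longrightarrow> Suc n < b \<Longrightarrow> u (Suc n) - u n \<le> u (Suc (Suc n)) - u (Suc n)"
  shows "norm (\<Sum>n\<in>{a..<b}. cis (2 * pi * u n)) \<le> 2 / \<delta>"
proof -
  define d where "d n = u (Suc n) - u n - m" for n
  define k where "k n = cot (pi * d n)" for n
  define c where "c n = - 1 / 2 - \<i> / 2 * complex_of_real (k n)" for n
  define z where "z n = cis (2 * pi * u n)" for n
  have d: "\<delta> \<le> d n" "d n \<le> 1 - \<delta>" if "a \<le> n" "n < b" for n using rng[OF that] by (auto simp: d_def)
  have spos: "sin (pi * d n) \<ge> 2 * \<delta>" if "a \<le> n" "n < b" for n
    using sin_pi_ge[OF assms(1) d[OF that]] .
  have z1: "z n = (z (Suc n) - z n) * c n" if "a \<le> n" "n < b" for n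
  proof -
    have "cis (2 * pi * (u n + d n)) = z (Suc n) * cis (2 * pi * of_int (- m))"
      by (simp add: z_def d_def cis_mult algebra_simps)
    also have "cis (2 * pi * of_int (- m)) = 1" by (rule cis_multiple_2pi) simp
    finally show ?thesis using cis_eq_diff_times_cot[of "d n" "u n"] spos[OF that] assms(1)
      by (simp add: z_def c_def k_def)
  qed
  have k_le: "\<bar>k n\<bar> \<le> 1 / (2 * \<delta>)" if "a \<le> n" "n < b" for n
  proof -
    have "\<bar>k n\<bar> = \<bar>cos (pi * d n)\<bar> / sin (pi * d n)" using spos[OF that] assms(1) by (simp add: k_def cot_def)
    also have "\<dots> \<le> 1 / (2 * \<delta>)" using spos[OF that] assms(1) by (intro frac_le) auto
    finally show ?thesis .
  qed
  have norm_c: "norm (c n) \<le> 1 / 2 + 1 / (4 * \<delta>)" if "a \<le> n" "n < b" for n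
  proof -
    have "norm (c n) \<le> norm (- 1 / 2 :: complex) + norm (\<i> / 2 * complex_of_real (k n))"
      unfolding c_def by (rule norm_triangle_ineq4)
    thus ?thesis using k_le[OF that] by (simp add: norm_mult norm_divide field_simps)
  qed
  have k_mono: "k (Suc n) \<le> k n" if "a \<le> n" "Suc n < b" for n
    unfolding k_def
  proof (rule cot_decreasing)
    show "0 < pi * d n" using d[of n] that assms(1) by simp
    show "pi * d n \<le> pi * d (Suc n)" using mono[OF that] by (simp add: d_def)
    show "pi * d (Suc n) < pi" using d[of "Suc n"] that assms(1) by simp
  qed
  \<comment> \<open>Once the boundary term is subtracted, only the first weight and the accumulated
    decrease of the cotangents remain.\<close>
  have main: "a + j < b \<Longrightarrow> norm ((\<Sum>n\<in>{a..<Suc (a + j)}. z n) - c (a + j) * z (Suc (a + j)))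
      \<le> norm (c a) + (k a - k (a + j)) / 2" for j
  proof (induction j)
    case 0
    have "z a - c a * z (Suc a) = - (c a * z a)" using z1[of a] ab by (simp add: algebra_simps)
    hence "norm (z a - c a * z (Suc a)) = norm (c a * z a)" by (metis norm_minus_cancel)
    thus ?case by (simp add: norm_mult z_def)
  next
    case (Suc j)
    let ?n = "a + j"
    have "(\<Sum>n\<in>{a..<Suc (a + Suc j)}. z n) - c (a + Suc j) * z (Suc (a + Suc j))
       = ((\<Sum>n\<in>{a..<Suc ?n}. z n) - c ?n * z (Suc ?n)) + (c ?n - c (Suc ?n)) * z (Suc ?n)"
      using z1[of "Suc ?n"] Suc.prems by (simp add: algebra_simps)
    also have "norm \<dots> \<le> norm ((\<Sum>n\<in>{a..<Suc ?n}. z n) - c ?n * z (Suc ?n)) + norm ((c ?n - c (Suc ?n)) * z (Suc ?n))"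
      by (rule norm_triangle_ineq)
    also have "c ?n - c (Suc ?n) = - (\<i> / 2 * complex_of_real (k ?n - k (Suc ?n)))"
      by (simp add: c_def algebra_simps)
    also have "norm (- (\<i> / 2 * complex_of_real (k ?n - k (Suc ?n))) * z (Suc ?n)) = (k ?n - k (Suc ?n)) / 2"
      using k_mono[of ?n] Suc.prems by (simp add: norm_mult norm_divide z_def del: of_real_diff)
    also have "norm ((\<Sum>n\<in>{a..<Suc ?n}. z n) - c ?n * z (Suc ?n)) \<le> norm (c a) + (k a - k ?n) / 2"
      using Suc by simp
    finally show ?case by (simp add: field_simps)
  qed
  obtain j where j: "b = Suc (a + j)" using ab less_iff_Suc_add by auto
  have "norm (\<Sum>n\<in>{a..<b}. z n) \<le> norm ((\<Sum>n\<in>{a..<b}. z n) - c (a + j) * z b) + norm (c (a + j) * z b)"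
    using norm_triangle_ineq[of "(\<Sum>n\<in>{a..<b}. z n) - c (a + j) * z b" "c (a + j) * z b"] by simp
  also have "\<dots> \<le> norm (c a) + (k a - k (a + j)) / 2 + norm (c (a + j))"
    using main[of j] j by (simp add: norm_mult z_def)
  also have "\<dots> \<le> (1 / 2 + 1 / (4 * \<delta>)) + (1 / (2 * \<delta>) + 1 / (2 * \<delta>)) / 2 + (1 / 2 + 1 / (4 * \<delta>))"
    using norm_c[of a] norm_c[of "a + j"] k_le[of a] k_le[of "a + j"] j by (intro add_mono) auto
  also have "\<dots> \<le> 2 / \<delta>"
    using d[of a] ab assms(1) by (simp add: field_simps)
  finally show ?thesis by (simp add: z_def)
qed

text \<open>The sum is averaged over \<open>H\<close> shifts, and Cauchy-Schwarz over the
  \<open>L + H\<close> positions leaves correlations of \<open>z\<close> with its translates.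
  Diagonal pairs give \<open>H * L\<close>, the others at most \<open>H\<^sup>2 * M\<close>.\<close>

lemma van_der_Corput_inequality:
  fixes z :: "nat \<Rightarrow> complex"
  assumes H: "H \<ge> 1" and z: "\<And>n. norm (z n) \<le> 1"
    and M: "\<And>h. 1 \<le> h \<Longrightarrow> h < H \<Longrightarrow> norm (\<Sum>n<L-h. z (n + h) * cnj (z n)) \<le> M" and M0: "M \<ge> 0"
  shows "(norm (\<Sum>n<L. z n))\<^sup>2 \<le> real (L + H) * (real L / real H + M)"
proof -
  \<comment> \<open>The sequence moved by \<open>h\<close> and set to 0 outside its range, so that
    every shift has the same sum over the \<open>L + H\<close> positions.\<close>
  define w where "w m h = (if h \<le> m \<and> m - h < L then z (m - h) else 0)" for m h
  have sumw: "(\<Sum>m<L+H. w m h) = (\<Sum>n<L. z n)" if "h < H" for h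
  proof -
    have "(\<Sum>m<L+H. w m h) = (\<Sum>m\<in>{m\<in>{..<L+H}. h \<le> m \<and> m - h < L}. z (m - h))"
      by (rule sum.mono_neutral_cong_right) (auto simp: w_def)
    also have "\<dots> = (\<Sum>n<L. z n)"
      by (rule sum.reindex_bij_witness[of _ "\<lambda>n. n + h" "\<lambda>m. m - h"]) (use that in auto)
    finally show ?thesis .
  qed
  have corr_lt: "norm (\<Sum>m<L+H. w m h * cnj (w m h')) \<le> M" if hh: "h < h'" "h' < H" for h h'
  proof -
    have "(\<Sum>m<L+H. w m h * cnj (w m h')) = (\<Sum>m\<in>{m\<in>{..<L+H}. h' \<le> m \<and> m - h < L}. z (m - h) * cnj (z (m - h')))"
      by (rule sum.mono_neutral_cong_right) (use hh in \<open>auto simp: w_def\<close>)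
    also have "\<dots> = (\<Sum>n<L-(h'-h). z (n + (h' - h)) * cnj (z n))"
      by (rule sum.reindex_bij_witness[of _ "\<lambda>n. n + h'" "\<lambda>m. m - h'"]) (use hh in auto)
    finally show ?thesis using M[of "h' - h"] hh by simp
  qed
  have corr: "norm (\<Sum>m<L+H. w m h * cnj (w m h')) \<le> M + (if h = h' then real L else 0)" if hh: "h < H" "h' < H" for h h'
  proof (cases h h' rule: linorder_cases)
    case less thus ?thesis using corr_lt[of h h'] hh by simp
  next
    case greater
    have "(\<Sum>m<L+H. w m h * cnj (w m h')) = cnj (\<Sum>m<L+H. w m h' * cnj (w m h))" by (simp add: mult.commute)
    hence "norm (\<Sum>m<L+H. w m h * cnj (w m h')) = norm (\<Sum>m<L+H. w m h' * cnj (w m h))"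
      by (simp only: complex_mod_cnj)
    thus ?thesis using corr_lt[of h' h] greater hh by simp
  next
    case equal
    have "(\<Sum>m<L+H. w m h * cnj (w m h)) = (\<Sum>m\<in>{m\<in>{..<L+H}. h \<le> m \<and> m - h < L}. z (m - h) * cnj (z (m - h)))"
      by (rule sum.mono_neutral_cong_right) (auto simp: w_def)
    also have "\<dots> = (\<Sum>n<L. z n * cnj (z n))"
      by (rule sum.reindex_bij_witness[of _ "\<lambda>n. n + h" "\<lambda>m. m - h"]) (use hh in auto)
    also have "norm \<dots> \<le> (\<Sum>n<L. 1)"
      using z by (intro sum_norm_le) (auto simp: norm_mult intro: mult_le_one)
    finally show ?thesis using equal M0 by simp
  qed
  define S where "S = (\<Sum>n<L. z n)"
  have HS: "of_nat H * S = (\<Sum>m<L+H. \<Sum>h<H. w m h)"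
    by (subst sum.swap) (simp add: sumw S_def)
  have "(real H * norm S)\<^sup>2 \<le> (\<Sum>m<L+H. norm (\<Sum>h<H. w m h))\<^sup>2"
    using arg_cong[OF HS, of norm] norm_sum[of "\<lambda>m. \<Sum>h<H. w m h" "{..<L+H}"]
    by (intro power_mono) (auto simp: norm_mult)
  also have "\<dots> \<le> (\<Sum>m<L+H. (norm (\<Sum>h<H. w m h))\<^sup>2) * real (L + H)"
    using sum_squared_le_sum_of_squares[of "\<lambda>m. norm (\<Sum>h<H. w m h)" "{..<L+H}"] by simp
  also have "(\<Sum>m<L+H. (norm (\<Sum>h<H. w m h))\<^sup>2) \<le> real H * real L + (real H)\<^sup>2 * M"
  proof -
    have "complex_of_real (\<Sum>m<L+H. (norm (\<Sum>h<H. w m h))\<^sup>2) = (\<Sum>m<L+H. (\<Sum>h<H. w m h) * cnj (\<Sum>h<H. w m h))"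
      by (simp only: of_real_sum complex_norm_square)
    also have "\<dots> = (\<Sum>m<L+H. \<Sum>h<H. \<Sum>h'<H. w m h * cnj (w m h'))"
      by (simp add: sum_product)
    also have "\<dots> = (\<Sum>h<H. \<Sum>m<L+H. \<Sum>h'<H. w m h * cnj (w m h'))" by (rule sum.swap)
    also have "\<dots> = (\<Sum>h<H. \<Sum>h'<H. \<Sum>m<L+H. w m h * cnj (w m h'))"
      by (intro sum.cong refl sum.swap)
    also have "norm \<dots> \<le> (\<Sum>h<H. \<Sum>h'<H. M + (if h = h' then real L else 0))"
      by (intro sum_norm_le corr) auto
    also have "\<dots> = real H * real L + (real H)\<^sup>2 * M"
      by (simp add: sum.distrib power2_eq_square algebra_simps)
    finally show ?thesis by (simp only: norm_of_real)
  qed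
  finally have "(real H * norm S)\<^sup>2 \<le> (real H * real L + (real H)\<^sup>2 * M) * real (L + H)"
    by (simp add: mult_right_mono)
  also have "(real H * real L + (real H)\<^sup>2 * M) * real (L + H) = (real H)\<^sup>2 * (real (L + H) * (real L / real H + M))"
    using H by (simp add: power2_eq_square field_simps)
  finally have "(real H)\<^sup>2 * (norm S)\<^sup>2 \<le> (real H)\<^sup>2 * (real (L + H) * (real L / real H + M))"
    by (simp add: power_mult_distrib)
  thus ?thesis using H by (simp add: S_def)
qed

section \<open>Van der Corput's second derivative test\<close>

lemma card_le_of_spread:
  fixes d :: "nat \<Rightarrow> real"
  assumes lam: "\<mu> > 0" and d: "\<And>n. Suc n < K \<Longrightarrow> d n + \<mu> \<le> d (Suc n)"
    and A: "A \<subseteq> {..<K}" "\<And>n. n \<in> A \<Longrightarrow> x \<le> d n \<and> d n \<le> x + \<rho>" and rho: "\<rho> \<ge> 0"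
  shows "real (card A) \<le> \<rho> / \<mu> + 1"
proof (cases "A = {}")
  case True thus ?thesis using rho lam by simp
next
  case False
  have fin: "finite A" using A(1) finite_subset by blast
  have incr: "i + j < K \<Longrightarrow> d i + \<mu> * real j \<le> d (i + j)" for i j
  proof (induction j)
    case (Suc j)
    thus ?case using d[of "i + j"] by (simp add: algebra_simps)
  qed simp
  define a where "a = Min A"
  define b where "b = Max A"
  have ab: "a \<in> A" "b \<in> A" "a \<le> b" using fin False by (auto simp: a_def b_def)
  have "A \<subseteq> {a..b}" using fin by (auto simp: a_def b_def)
  hence "card A \<le> Suc b - a" using card_mono[of "{a..b}" A] by simp
  hence "real (card A) \<le> real (b - a) + 1" using ab by linarith
  moreover have "d a + \<mu> * real (b - a) \<le> d b" using incr[of a "b - a"] ab A(1) by auto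
  hence "\<mu> * real (b - a) \<le> \<rho>" using A(2)[OF ab(1)] A(2)[OF ab(2)] by linarith
  hence "real (b - a) \<le> \<rho> / \<mu>" using lam by (simp add: field_simps)
  ultimately show ?thesis by linarith
qed

text \<open>The first differences have at most \<open>B * \<mu> * N + 2\<close> integer parts. For
  each of them, the terms whose difference lies within \<open>\<delta>\<close> of an integer are
  counted trivially, since consecutive differences are at least \<open>\<mu>\<close> apart; the
  others fall under Kuzmin-Landau. The choice \<open>\<delta>\<close> = sqrt \<open>\<mu>\<close>
  balances \<open>\<delta>\<close> / \<open>\<mu>\<close> with 1 / \<open>\<delta>\<close>.\<close>

lemma second_difference_test:
  fixes u :: "nat \<Rightarrow> real"
  assumes lam: "0 < \<mu>" "\<mu> \<le> 1 / 4" and B: "B \<ge> 1" and LN: "L \<le> N"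
    and d2: "\<And>n. n + 2 < L \<Longrightarrow> \<mu> \<le> (u (Suc (Suc n)) - u (Suc n)) - (u (Suc n) - u n)
             \<and> (u (Suc (Suc n)) - u (Suc n)) - (u (Suc n) - u n) \<le> B * \<mu>"
  shows "norm (\<Sum>n<L. cis (2 * pi * u n)) \<le> 1 + (B * \<mu> * N + 2) * (6 / sqrt \<mu>)"
proof (cases "L \<le> 1")
  case True
  have "norm (\<Sum>n<L. cis (2 * pi * u n)) \<le> (\<Sum>n<L. 1)" by (rule sum_norm_le) simp
  also have "\<dots> \<le> 1" using True by simp
  also have "\<dots> \<le> 1 + (B * \<mu> * N + 2) * (6 / sqrt \<mu>)" using lam B by simp
  finally show ?thesis .
next
  case False
  define K where "K = L - 1"
  have L: "L = Suc K" and K: "K \<ge> 1" using False by (auto simp: K_def)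
  define d where "d n = u (Suc n) - u n" for n
  define \<delta> where "\<delta> = sqrt \<mu>"
  have del: "\<delta> > 0" "\<delta> \<le> 1 / 2" "\<delta> * \<delta> = \<mu>"
    using lam real_sqrt_le_mono[of \<mu> "1/4"] by (auto simp: \<delta>_def real_sqrt_divide)
  have dl: "d n + \<mu> \<le> d (Suc n)" and du: "d (Suc n) \<le> d n + B * \<mu>" if "Suc n < K" for n
    using d2[of n] that L by (auto simp: d_def)
  have dmono: "i + j < K \<Longrightarrow> d i \<le> d (i + j)" for i j
  proof (induction j)
    case (Suc j) thus ?case using dl[of "i + j"] lam by simp
  qed simp
  have dmono': "d i \<le> d j" if "i \<le> j" "j < K" for i j using dmono[of i "j - i"] that by simp
  have dtop: "j < K \<Longrightarrow> d j \<le> d 0 + B * \<mu> * real j" for j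
  proof (induction j)
    case (Suc j) thus ?case using du[of j] by (simp add: algebra_simps)
  qed simp
  define z where "z n = cis (2 * pi * u n)" for n
  define Ms where "Ms = (\<lambda>n. \<lfloor>d n\<rfloor>) ` {..<K}"
  have cardMs: "real (card Ms) \<le> B * \<mu> * N + 2"
  proof -
    have "Ms \<subseteq> {\<lfloor>d 0\<rfloor>..\<lfloor>d 0 + B * \<mu> * real N\<rfloor>}"
    proof
      fix m assume "m \<in> Ms"
      then obtain n where n: "n < K" "m = \<lfloor>d n\<rfloor>" by (auto simp: Ms_def)
      have "B * \<mu> * real n \<le> B * \<mu> * real N" using n L LN B lam by (intro mult_left_mono) auto
      hence "d n \<le> d 0 + B * \<mu> * real N" using dtop[OF n(1)] by linarith
      thus "m \<in> {\<lfloor>d 0\<rfloor>..\<lfloor>d 0 + B * \<mu> * real N\<rfloor>}"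
        using n dmono'[of 0 n] by (auto intro: floor_mono)
    qed
    hence "card Ms \<le> card {\<lfloor>d 0\<rfloor>..\<lfloor>d 0 + B * \<mu> * real N\<rfloor>}" by (intro card_mono) auto
    hence "real (card Ms) \<le> real (nat (\<lfloor>d 0 + B * \<mu> * real N\<rfloor> - \<lfloor>d 0\<rfloor> + 1))" by simp
    also have "\<dots> \<le> B * \<mu> * N + 2"
    proof -
      have "0 \<le> B * \<mu> * real N" using B lam by simp
      thus ?thesis by linarith
    qed
    finally show ?thesis .
  qed
  have block: "norm (\<Sum>n | n \<in> {..<K} \<and> \<lfloor>d n\<rfloor> = m. z n) \<le> 6 / \<delta>" for m
  proof -
    define I where "I = {n. n \<in> {..<K} \<and> \<lfloor>d n\<rfloor> = m}"
    define I1 where "I1 = {n\<in>I. d n < m + \<delta>}"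
    define I2 where "I2 = {n\<in>I. m + 1 - \<delta> < d n}"
    define J where "J = {n\<in>I. m + \<delta> \<le> d n \<and> d n \<le> m + 1 - \<delta>}"
    have fin: "finite I" by (simp add: I_def)
    have "real (card I1) \<le> \<delta> / \<mu> + 1"
      by (rule card_le_of_spread[where d = d and K = K and x = m, OF lam(1) dl])
         (use del in \<open>auto simp: I1_def I_def floor_eq_iff\<close>)
    moreover have "real (card I2) \<le> \<delta> / \<mu> + 1"
      by (rule card_le_of_spread[where d = d and K = K and x = "m + 1 - \<delta>", OF lam(1) dl])
         (use del in \<open>auto simp: I2_def I_def floor_eq_iff\<close>)
    ultimately have I12: "real (card I1) \<le> \<delta> / \<mu> + 1" "real (card I2) \<le> \<delta> / \<mu> + 1" .
    have IJ: "I = J \<union> (I1 \<union> I2)" "J \<inter> (I1 \<union> I2) = {}" by (auto simp: I1_def I2_def J_def)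
    have J: "norm (\<Sum>n\<in>J. z n) \<le> 2 / \<delta>"
    proof (cases "J = {}")
      case True thus ?thesis using del by simp
    next
      case False
      have finJ: "finite J" using fin by (simp add: J_def)
      define a where "a = Min J"
      define b where "b = Suc (Max J)"
      have ab: "a \<in> J" "b - 1 \<in> J" "a < b" using finJ False by (auto simp: a_def b_def less_Suc_eq_le)
      have "J = {a..<b}"
      proof
        show "J \<subseteq> {a..<b}" using finJ by (auto simp: a_def b_def less_Suc_eq_le)
        show "{a..<b} \<subseteq> J"
        proof
          fix n assume n: "n \<in> {a..<b}"
          have bK: "b - 1 < K" using ab by (auto simp: J_def I_def)
          have "d a \<le> d n" "d n \<le> d (b - 1)" "n < K" using n bK ab by (auto intro!: dmono')
          moreover have "m + \<delta> \<le> d a" "d (b - 1) \<le> m + 1 - \<delta>" using ab by (auto simp: J_def)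
          ultimately show "n \<in> J" using del by (auto simp: J_def I_def floor_eq_iff)
        qed
      qed
      moreover have "norm (\<Sum>n\<in>{a..<b}. cis (2 * pi * u n)) \<le> 2 / \<delta>"
      proof (rule Kuzmin_Landau[OF del(1) ab(3), of m])
        fix n assume "a \<le> n" "n < b"
        hence "n \<in> J" using \<open>J = {a..<b}\<close> by simp
        thus "m + \<delta> \<le> u (Suc n) - u n \<and> u (Suc n) - u n \<le> m + 1 - \<delta>" by (simp add: J_def d_def)
      next
        fix n assume "a \<le> n" "Suc n < b"
        hence "Suc n \<in> J" using \<open>J = {a..<b}\<close> by simp
        hence "Suc n < K" by (simp add: J_def I_def)
        thus "u (Suc n) - u n \<le> u (Suc (Suc n)) - u (Suc n)" using dl[of n] lam by (simp add: d_def)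
      qed
      ultimately show ?thesis by (simp add: z_def)
    qed
    have "(\<Sum>n\<in>I. z n) = (\<Sum>n\<in>J. z n) + (\<Sum>n\<in>I1 \<union> I2. z n)"
      unfolding IJ(1) using fin by (intro sum.union_disjoint IJ(2)) (auto simp: J_def I1_def I2_def)
    hence "norm (\<Sum>n\<in>I. z n) \<le> norm (\<Sum>n\<in>J. z n) + norm (\<Sum>n\<in>I1 \<union> I2. z n)"
      by (metis norm_triangle_ineq)
    also have "norm (\<Sum>n\<in>I1 \<union> I2. z n) \<le> real (card (I1 \<union> I2))"
      using sum_norm_le[of "I1 \<union> I2" z "\<lambda>_. 1"] by (simp add: z_def)
    also have "\<dots> \<le> real (card I1) + real (card I2)" using card_Un_le[of I1 I2] by linarith
    also have "\<dots> \<le> 4 / \<delta>"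
    proof -
      have "\<delta> / \<mu> = 1 / \<delta>" using del lam(1) by (simp add: field_simps)
      moreover have "2 \<le> 2 / \<delta>" using del by (simp add: field_simps)
      ultimately show ?thesis using I12 by (simp add: field_simps)
    qed
    finally show ?thesis using J unfolding I_def by (simp add: field_simps)
  qed
  have "(\<Sum>n<K. z n) = (\<Sum>m\<in>Ms. \<Sum>n | n \<in> {..<K} \<and> \<lfloor>d n\<rfloor> = m. z n)"
    unfolding Ms_def by (rule sum.group[symmetric]) auto
  also have "norm \<dots> \<le> (\<Sum>m\<in>Ms. 6 / \<delta>)" by (intro sum_norm_le block)
  also have "\<dots> = real (card Ms) * (6 / \<delta>)" by simp
  also have "\<dots> \<le> (B * \<mu> * N + 2) * (6 / \<delta>)" using cardMs del by (intro mult_right_mono) auto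
  finally have "norm (\<Sum>n<K. z n) \<le> (B * \<mu> * N + 2) * (6 / \<delta>)" .
  \<comment> \<open>There are only \<open>K = L - 1\<close> first differences; the last term is
    added by hand.\<close>
  moreover have "norm (\<Sum>n<L. z n) \<le> norm (\<Sum>n<K. z n) + norm (z K)"
    unfolding L sum.lessThan_Suc by (rule norm_triangle_ineq)
  ultimately show ?thesis by (simp add: z_def \<delta>_def)
qed

section \<open>Higher derivative tests by Weyl differencing\<close>

definition fdiff :: "(nat \<Rightarrow> real) \<Rightarrow> nat \<Rightarrow> real" where
  "fdiff u n = u (Suc n) - u n"

lemma fdiff_pow_shift: "(fdiff ^^ q) (\<lambda>n. u (n + h)) n = (fdiff ^^ q) u (n + h)"
  by (induction q arbitrary: n) (simp_all add: fdiff_def)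

lemma fdiff_pow_diff: "(fdiff ^^ q) (\<lambda>n. u n - v n) n = (fdiff ^^ q) u n - (fdiff ^^ q) v n"
  by (induction q arbitrary: n) (simp_all add: fdiff_def)

text \<open>Differencing with shift \<open>h\<close> lowers the order by one: \<open>h\<close>
  consecutive differences of order \<open>q + 1\<close> are added, so both of their bounds are
  multiplied by \<open>h\<close> and their ratio is kept.\<close>

lemma fdiff_pow_increment:
  "(fdiff ^^ q) (\<lambda>n. u (n + h) - u n) n = (\<Sum>j<h. (fdiff ^^ Suc q) u (n + j))"
proof -
  have "(\<Sum>j<h. (fdiff ^^ Suc q) u (n + j)) = (\<Sum>j<h. (fdiff ^^ q) u (n + Suc j) - (fdiff ^^ q) u (n + j))"
    by (simp add: fdiff_def)
  also have "\<dots> = (fdiff ^^ q) u (n + h) - (fdiff ^^ q) u n"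
    using sum_lessThan_telescope[of "\<lambda>j. (fdiff ^^ q) u (n + j)" h] by simp
  finally show ?thesis by (simp add: fdiff_pow_diff fdiff_pow_shift)
qed

text \<open>The induction runs over the whole chain of derivatives: one difference turns each
  \<open>D i\<close> into \<open>D i (x + 1) - D i x\<close>, which is again such a chain, and one
  application of the mean value theorem completes the step.\<close>

lemma fdiff_pow_mean_value:
  fixes D :: "nat \<Rightarrow> real \<Rightarrow> real"
  assumes "\<And>i x. i < q \<Longrightarrow> a \<le> x \<Longrightarrow> x \<le> a + q \<Longrightarrow> (D i has_real_derivative D (Suc i) x) (at x)"
  shows "\<exists>\<xi>. a \<le> \<xi> \<and> \<xi> \<le> a + q \<and> (fdiff ^^ q) (\<lambda>n. D 0 (a + real n)) 0 = D q \<xi>"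
  using assms
proof (induction q arbitrary: D)
  case 0
  show ?case by (intro exI[of _ a]) simp
next
  case (Suc q)
  define E where "E i x = D i (x + 1) - D i x" for i x
  have "\<exists>\<xi>. a \<le> \<xi> \<and> \<xi> \<le> a + q \<and> (fdiff ^^ q) (\<lambda>n. E 0 (a + real n)) 0 = E q \<xi>"
  proof (rule Suc.IH)
    fix i x assume i: "i < q" "a \<le> x" "x \<le> a + real q"
    have "(D i has_real_derivative D (Suc i) (x + 1)) (at (x + 1))"
      using i by (intro Suc.prems) auto
    hence "((\<lambda>x. D i (x + 1)) has_real_derivative D (Suc i) (x + 1)) (at x)"
      by (simp add: DERIV_shift)
    moreover have "(D i has_real_derivative D (Suc i) x) (at x)"
      using i by (intro Suc.prems) auto
    ultimately show "(E i has_real_derivative E (Suc i) x) (at x)"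
      unfolding E_def by (rule DERIV_diff)
  qed
  then obtain \<xi> where xi: "a \<le> \<xi>" "\<xi> \<le> a + q" "(fdiff ^^ q) (\<lambda>n. E 0 (a + real n)) 0 = E q \<xi>" by blast
  have "\<exists>\<eta>>\<xi>. \<eta> < \<xi> + 1 \<and> D q (\<xi> + 1) - D q \<xi> = (\<xi> + 1 - \<xi>) * D (Suc q) \<eta>"
    by (rule MVT2) (use xi in \<open>auto intro!: Suc.prems\<close>)
  then obtain \<eta> where eta: "\<xi> < \<eta>" "\<eta> < \<xi> + 1" "E q \<xi> = D (Suc q) \<eta>" by (auto simp: E_def)
  have "(fdiff ^^ Suc q) (\<lambda>n. D 0 (a + real n)) = (fdiff ^^ q) (fdiff (\<lambda>n. D 0 (a + real n)))"
    by (simp only: funpow_Suc_right o_def)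
  also have "fdiff (\<lambda>n. D 0 (a + real n)) = (\<lambda>n. E 0 (a + real n))"
    by (auto simp: fdiff_def E_def algebra_simps)
  finally show ?case using xi eta by (intro exI[of _ \<eta>]) auto
qed

text \<open>
  The statement of van der Corput's \<open>q\<close>-th derivative test without explicit exponents: if the \<open>q\<close>-th
  differences of \<open>u\<close> have size about \<open>\<mu>\<close>, with \<open>\<mu>\<close> between the powers \<open>\<theta> - 2\<close> and \<open>- \<theta>\<close> of \<open>N\<close>, the sum
  saves the power \<open>c\<close> of \<open>N\<close>. One Weyl differencing step reduces \<open>q + 1\<close> to \<open>q\<close>.
\<close>

definition exp_sum_saving :: "nat \<Rightarrow> real \<Rightarrow> real \<Rightarrow> real \<Rightarrow> real \<Rightarrow> bool" where
  "exp_sum_saving q \<theta> B c C \<longleftrightarrow> 0 < c \<and> c \<le> 1 \<and> 0 \<le> C \<and>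
     (\<forall>(N::nat) L \<mu> u. 1 \<le> N \<longrightarrow> L \<le> N \<longrightarrow> 0 < \<mu> \<longrightarrow>
       real N powr (\<theta> - 2) \<le> B * \<mu> \<longrightarrow> \<mu> \<le> B * real N powr (- \<theta>) \<longrightarrow>
       (\<forall>n. n + q < L \<longrightarrow> \<mu> \<le> (fdiff ^^ q) u n \<and> (fdiff ^^ q) u n \<le> B * \<mu>) \<longrightarrow>
       norm (\<Sum>n<L. cis (2 * pi * u n)) \<le> C * real N powr (1 - c))"

lemma exp_sum_savingD:
  assumes "exp_sum_saving q \<theta> B c C" "1 \<le> N" "L \<le> N" "0 < \<mu>"
    "real N powr (\<theta> - 2) \<le> B * \<mu>" "\<mu> \<le> B * real N powr (- \<theta>)"
    "\<And>n. n + q < L \<Longrightarrow> \<mu> \<le> (fdiff ^^ q) u n \<and> (fdiff ^^ q) u n \<le> B * \<mu>"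
  shows "norm (\<Sum>n<L. cis (2 * pi * u n)) \<le> C * real N powr (1 - c)"
  using assms unfolding exp_sum_saving_def by blast

lemma exp_sum_saving_exists:
  assumes "q \<ge> 2" "0 < \<theta>" "\<theta> \<le> 1" "1 \<le> B"
  shows "\<exists>c C. exp_sum_saving q \<theta> B c C"
  using assms
proof (induction q arbitrary: \<theta> rule: nat_induct_at_least)
  case base
  note th = base
  show ?case unfolding exp_sum_saving_def
  proof (rule exI[of _ "\<theta> / 2"], rule exI[of _ "1 + 18 * B\<^sup>2"], intro conjI allI impI)
    fix N L :: nat and \<mu> :: real and u :: "nat \<Rightarrow> real"
    assume N: "1 \<le> N" "L \<le> N" and mu: "0 < \<mu>" "real N powr (\<theta> - 2) \<le> B * \<mu>" "\<mu> \<le> B * real N powr (- \<theta>)"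
      and d: "\<forall>n. n + 2 < L \<longrightarrow> \<mu> \<le> (fdiff ^^ 2) u n \<and> (fdiff ^^ 2) u n \<le> B * \<mu>"
    \<comment> \<open>Both terms of the second test, N sqrt \<open>\<mu>\<close> and 1 / sqrt
      \<open>\<mu>\<close>, are at most \<open>B * Y\<close>; this is where the upper and the lower
      bound on \<open>\<mu>\<close> enter.\<close>
    define Y where "Y = real N powr (1 - \<theta> / 2)"
    have Y1: "Y \<ge> 1" using N th by (simp add: Y_def ge_one_powr_ge_zero)
    have sB: "sqrt B \<le> B" using th real_sqrt_le_mono[of B "B * B"] by simp
    have NY: "sqrt (real N powr (- \<theta>)) * real N = Y"
    proof -
      have "sqrt (real N powr (- \<theta>)) = real N powr (- \<theta> / 2)" by (simp add: powr_half_sqrt[symmetric] powr_powr)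
      thus ?thesis using N powr_add[of "real N" "- \<theta> / 2" 1] by (simp add: Y_def)
    qed
    have smu: "sqrt \<mu> * real N \<le> B * Y"
    proof -
      have "sqrt \<mu> \<le> sqrt B * sqrt (real N powr (- \<theta>))"
        using mu by (simp add: real_sqrt_mult[symmetric])
      from mult_right_mono[OF this, of "real N"]
      have "sqrt \<mu> * real N \<le> sqrt B * (sqrt (real N powr (- \<theta>)) * real N)"
        by (simp add: mult.assoc)
      also have "\<dots> \<le> B * Y" unfolding NY using sB Y1 by (intro mult_right_mono) auto
      finally show ?thesis .
    qed
    have ismu: "1 / sqrt \<mu> \<le> B * Y"
    proof -
      have "sqrt (real N powr (\<theta> - 2)) = real N powr (\<theta> / 2 - 1)"
        by (simp add: powr_half_sqrt[symmetric] powr_powr diff_divide_distrib)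
      moreover have "\<dots> = 1 / Y" 
        using powr_minus_divide[of "real N" "1 - \<theta> / 2"] by (simp add: Y_def)
      moreover have "sqrt (real N powr (\<theta> - 2)) \<le> sqrt B * sqrt \<mu>"
        using mu(2) by (simp add: real_sqrt_mult[symmetric])
      ultimately have "1 / Y \<le> sqrt B * sqrt \<mu>" by simp
      also have "\<dots> \<le> B * sqrt \<mu>" using sB mu by (intro mult_right_mono) auto
      finally show ?thesis using Y1 mu by (simp add: field_simps)
    qed
    show "norm (\<Sum>n<L. cis (2 * pi * u n)) \<le> (1 + 18 * B\<^sup>2) * real N powr (1 - \<theta> / 2)"
    proof (cases "\<mu> \<le> 1 / 4")
      case True
      have "norm (\<Sum>n<L. cis (2 * pi * u n)) \<le> 1 + (B * \<mu> * N + 2) * (6 / sqrt \<mu>)"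
      proof (rule second_difference_test[OF mu(1) True th(3) N(2)])
        fix n assume "n + 2 < L"
        moreover have "(fdiff ^^ 2) u n = (u (Suc (Suc n)) - u (Suc n)) - (u (Suc n) - u n)"
          by (simp add: numeral_2_eq_2 fdiff_def)
        ultimately show "\<mu> \<le> (u (Suc (Suc n)) - u (Suc n)) - (u (Suc n) - u n)
           \<and> (u (Suc (Suc n)) - u (Suc n)) - (u (Suc n) - u n) \<le> B * \<mu>" using d by metis
      qed
      also have "\<dots> = 1 + 6 * B * (\<mu> / sqrt \<mu> * N) + 12 * (1 / sqrt \<mu>)"
        using mu by (simp add: field_simps)
      also have "\<mu> / sqrt \<mu> = sqrt \<mu>" using mu by (simp add: real_div_sqrt)
      also have "1 + 6 * B * (sqrt \<mu> * N) + 12 * (1 / sqrt \<mu>) \<le> 1 * Y + 6 * B * (B * Y) + 12 * B * (B * Y)"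
      proof (intro add_mono)
        show "1 \<le> 1 * Y" using Y1 by simp
        show "6 * B * (sqrt \<mu> * N) \<le> 6 * B * (B * Y)" using smu th by (intro mult_left_mono) auto
        have "12 * (1 / sqrt \<mu>) \<le> 12 * B * (1 / sqrt \<mu>)" using th mu by (simp add: field_simps)
        also have "\<dots> \<le> 12 * B * (B * Y)" using ismu th by (intro mult_left_mono) auto
        finally show "12 * (1 / sqrt \<mu>) \<le> 12 * B * (B * Y)" .
      qed
      also have "\<dots> = (1 + 18 * B\<^sup>2) * Y" by (simp add: power2_eq_square algebra_simps)
      finally show ?thesis by (simp add: Y_def)
    next
      case False
      \<comment> \<open>For \<open>\<mu>\<close> above 1/4 the trivial bound \<open>N\<close> is
        already at most 2 N sqrt \<open>\<mu>\<close>.\<close>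
      have "norm (\<Sum>n<L. cis (2 * pi * u n)) \<le> (\<Sum>n<L. 1)" by (rule sum_norm_le) simp
      hence "norm (\<Sum>n<L. cis (2 * pi * u n)) \<le> real N" using N by simp
      also have "sqrt (1 / 4) \<le> sqrt \<mu>" using False by (intro real_sqrt_le_mono) simp
      hence "real N \<le> 2 * (sqrt \<mu> * real N)" using N by (simp add: real_sqrt_divide)
      also have "\<dots> \<le> 2 * (B * Y)" using smu by simp
      also have "\<dots> \<le> (1 + 18 * B\<^sup>2) * Y"
      proof -
        have "B \<le> B\<^sup>2" using th by (simp add: power2_eq_square)
        hence "2 * B \<le> 1 + 18 * B\<^sup>2" using th by linarith
        thus ?thesis using Y1 by (simp only: mult.assoc[symmetric] mult_right_mono)
      qed
      finally show ?thesis by (simp add: Y_def)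
    qed
  qed (use th in auto)
next
  case (Suc q)
  note th = Suc.prems
  \<comment> \<open>Half of \<open>\<theta>\<close> is reserved for the shifts: \<open>h\<close> up
    to the power \<open>\<theta> / 2\<close> of \<open>N\<close> multiplies the differences by
    \<open>h\<close>.\<close>
  obtain c C where sav: "exp_sum_saving q (\<theta> / 2) B c C"
    using Suc.IH[of "\<theta> / 2"] th by auto
  hence c: "0 < c" "c \<le> 1" "0 \<le> C" by (auto simp: exp_sum_saving_def)
  \<comment> \<open>\<open>L / H\<close> saves the power \<open>\<theta> / 2\<close> and the
    correlations save \<open>c\<close>; the square root halves the smaller saving.\<close>
  define e where "e = min (\<theta> / 2) c"
  have e: "0 < e" "e \<le> c" "e \<le> \<theta> / 2" using th c by (auto simp: e_def)
  show ?case unfolding exp_sum_saving_def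
  proof (rule exI[of _ "e / 2"], rule exI[of _ "sqrt (4 + 2 * C)"], intro conjI allI impI)
    fix N L :: nat and \<mu> :: real and u :: "nat \<Rightarrow> real"
    assume N: "1 \<le> N" "L \<le> N" and mu: "0 < \<mu>" "real N powr (\<theta> - 2) \<le> B * \<mu>" "\<mu> \<le> B * real N powr (- \<theta>)"
      and d: "\<forall>n. n + Suc q < L \<longrightarrow> \<mu> \<le> (fdiff ^^ Suc q) u n \<and> (fdiff ^^ Suc q) u n \<le> B * \<mu>"
    define H where "H = nat \<lfloor>real N powr (\<theta> / 2)\<rfloor>"
    have N1: "real N powr (\<theta> / 2) \<ge> 1" using N th by (simp add: ge_one_powr_ge_zero)
    have H: "1 \<le> H" "real H \<le> real N powr (\<theta> / 2)" "real N powr (\<theta> / 2) \<le> 2 * real H"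
    proof -
      have "1 \<le> \<lfloor>real N powr (\<theta> / 2)\<rfloor>" using N1 by simp
      moreover have "real N powr (\<theta> / 2) < of_int \<lfloor>real N powr (\<theta> / 2)\<rfloor> + 1" by linarith
      ultimately show "1 \<le> H" "real H \<le> real N powr (\<theta> / 2)" "real N powr (\<theta> / 2) \<le> 2 * real H"
        unfolding H_def by linarith+
    qed
    have "real N powr (\<theta> / 2) \<le> real N powr 1" using N th by (intro powr_mono) auto
    hence HN: "H \<le> N" using H(2) N by simp
    define M where "M = C * real N powr (1 - c)"
    define z where "z n = cis (2 * pi * u n)" for n
    have "(norm (\<Sum>n<L. z n))\<^sup>2 \<le> real (L + H) * (real L / real H + M)"
    proof (rule van_der_Corput_inequality[OF H(1)])
      fix h assume h: "1 \<le> h" "h < H"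
      define v where "v n = u (n + h) - u n" for n
      have "(\<Sum>n<L-h. z (n + h) * cnj (z n)) = (\<Sum>n<L-h. cis (2 * pi * v n))"
        by (simp add: z_def v_def cis_cnj cis_mult algebra_simps)
      also have "norm \<dots> \<le> C * real N powr (1 - c)"
      proof (rule exp_sum_savingD[OF sav, of N "L - h" "real h * \<mu>" v])
        have hmu: "\<mu> \<le> real h * \<mu>" using h mu by simp
        have "real N powr (\<theta> / 2 - 2) \<le> real N powr (\<theta> - 2)" using N th by (intro powr_mono) auto
        also have "\<dots> \<le> B * \<mu>" by (rule mu)
        also have "\<dots> \<le> B * (real h * \<mu>)" using hmu th by (intro mult_left_mono) auto
        finally show "real N powr (\<theta> / 2 - 2) \<le> B * (real h * \<mu>)" .
        have "real h * \<mu> \<le> real N powr (\<theta> / 2) * (B * real N powr (- \<theta>))"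
          using h H mu by (intro mult_mono) auto
        also have "\<dots> = B * real N powr (- (\<theta> / 2))"
          using powr_add[of "real N" "\<theta> / 2" "- \<theta>"] by simp
        finally show "real h * \<mu> \<le> B * real N powr (- (\<theta> / 2))" .
        fix n assume n: "n + q < L - h"
        have v: "(fdiff ^^ q) v n = (\<Sum>j<h. (fdiff ^^ Suc q) u (n + j))"
          unfolding v_def by (rule fdiff_pow_increment)
        have b: "\<mu> \<le> (fdiff ^^ Suc q) u (n + j) \<and> (fdiff ^^ Suc q) u (n + j) \<le> B * \<mu>" if "j < h" for j
          using d n that by auto
        have "(\<Sum>j<h. \<mu>) \<le> (\<Sum>j<h. (fdiff ^^ Suc q) u (n + j))" using b by (intro sum_mono) blast
        moreover have "(\<Sum>j<h. (fdiff ^^ Suc q) u (n + j)) \<le> (\<Sum>j<h. B * \<mu>)" using b by (intro sum_mono) blast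
        ultimately show "real h * \<mu> \<le> (fdiff ^^ q) v n \<and> (fdiff ^^ q) v n \<le> B * (real h * \<mu>)"
          unfolding v by (simp add: algebra_simps)
      qed (use N h mu in auto)
      finally show "norm (\<Sum>n<L-h. z (n + h) * cnj (z n)) \<le> M" by (simp add: M_def)
    qed (use c in \<open>auto simp: z_def M_def\<close>)
    also have "\<dots> \<le> (2 * real N) * (2 * real N powr (1 - e) + C * real N powr (1 - e))"
    proof (intro mult_mono add_mono)
      have "real L / real H \<le> real N / (real N powr (\<theta> / 2) / 2)"
        using N H N1 by (intro frac_le) auto
      also have "\<dots> = 2 * real N powr (1 - \<theta> / 2)" using N by (simp add: powr_diff)
      also have "\<dots> \<le> 2 * real N powr (1 - e)" using N e by (intro mult_left_mono powr_mono) auto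
      finally show "real L / real H \<le> 2 * real N powr (1 - e)" .
      show "M \<le> C * real N powr (1 - e)" unfolding M_def using N e c by (intro mult_left_mono powr_mono) auto
    qed (use N HN c in \<open>auto simp: M_def\<close>)
    also have "\<dots> = (4 + 2 * C) * (real N powr (1 - e / 2))\<^sup>2"
    proof -
      have "(real N powr (1 - e / 2))\<^sup>2 = real N powr (1 + (1 - e))"
        using N by (simp add: power2_eq_square powr_add[symmetric])
      also have "\<dots> = real N * real N powr (1 - e)" using N by (simp only: powr_add) simp
      finally show ?thesis by (simp add: algebra_simps)
    qed
    also have "\<dots> = (sqrt (4 + 2 * C) * real N powr (1 - e / 2))\<^sup>2"
      using c by (simp add: power_mult_distrib)
    finally show "norm (\<Sum>n<L. cis (2 * pi * u n)) \<le> sqrt (4 + 2 * C) * real N powr (1 - e / 2)"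
      unfolding z_def by (rule power2_le_imp_le) (use c in auto)
  qed (use e th c in auto)
qed

section \<open>Sums of n^(it) over dyadic blocks\<close>

lemma fdiff_pow_ln:
  fixes \<kappa> :: real
  assumes "N \<ge> (1::nat)" "\<kappa> > 0" "q \<ge> 1"
  shows "\<exists>\<xi>. real (N + n) \<le> \<xi> \<and> \<xi> \<le> real (N + n + q) \<and>
     (fdiff ^^ q) (\<lambda>j. (-1) ^ (q - 1) * \<kappa> * ln (real (N + j))) n = \<kappa> * fact (q - 1) / \<xi> ^ q"
proof -
  \<comment> \<open>The successive derivatives of the logarithm; the sign
    \<open>(-1) ^ (q - 1)\<close> makes the one of order \<open>q\<close> positive, as the
    differencing test requires.\<close>
  define D where "D i x = (if i = 0 then (-1) ^ (q - 1) * \<kappa> * ln x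
     else (-1) ^ (q - 1) * \<kappa> * (-1) ^ (i - 1) * fact (i - 1) * inverse x ^ i)" for i and x :: real
  have "\<exists>\<xi>. real (N + n) \<le> \<xi> \<and> \<xi> \<le> real (N + n) + q \<and>
     (fdiff ^^ q) (\<lambda>j. D 0 (real (N + n) + real j)) 0 = D q \<xi>"
  proof (rule fdiff_pow_mean_value)
    fix i x assume i: "i < q" "real (N + n) \<le> x"
    have x: "x > 0" using i assms by simp
    show "(D i has_real_derivative D (Suc i) x) (at x)"
    proof (cases i)
      case 0
      thus ?thesis using x unfolding D_def by (auto intro!: derivative_eq_intros simp: field_simps)
    next
      case (Suc j)
      have "((\<lambda>x. K * inverse x ^ Suc j) has_real_derivative - (K * real (Suc j) * inverse x ^ Suc (Suc j))) (at x)" for K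
      proof -
        have "((\<lambda>x. K * inverse x ^ Suc j) has_real_derivative
            K * (real (Suc j) * (- (inverse x ^ Suc (Suc 0)) * inverse x ^ (Suc j - Suc 0)))) (at x)"
          using x by (intro DERIV_cmult DERIV_power DERIV_inverse) simp
        thus ?thesis by (simp add: algebra_simps)
      qed
      from this[of "(-1) ^ (q - 1) * \<kappa> * (-1) ^ j * fact j"] show ?thesis
        using Suc unfolding D_def by (simp add: algebra_simps)
    qed
  qed
  then obtain \<xi> where xi: "real (N + n) \<le> \<xi>" "\<xi> \<le> real (N + n) + q"
    and eq: "(fdiff ^^ q) (\<lambda>j. D 0 (real (N + n) + real j)) 0 = D q \<xi>" by blast
  have "(fdiff ^^ q) (\<lambda>j. (-1) ^ (q - 1) * \<kappa> * ln (real (N + j))) n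
      = (fdiff ^^ q) (\<lambda>j. D 0 (real (N + n) + real j)) 0"
    using fdiff_pow_shift[of q "\<lambda>j. (-1) ^ (q - 1) * \<kappa> * ln (real (N + j))" n 0]
    by (simp add: D_def algebra_simps)
  also have "\<dots> = \<kappa> * fact (q - 1) / \<xi> ^ q"
    unfolding eq using assms
    by (simp add: D_def power_add[symmetric] mult_2[symmetric] power_inverse divide_inverse)
  finally show ?thesis using xi by (intro exI[of _ \<xi>]) auto
qed

lemma zeta_sum_bound_pos:
  fixes q :: nat
  assumes q: "q \<ge> 2"
  shows "\<exists>c C. 0 < c \<and> c \<le> 1 \<and> 0 \<le> C \<and> (\<forall>(N::nat) L t. 1 \<le> N \<longrightarrow> L \<le> N \<longrightarrow>
     real N powr (real q - 3 / 2) \<le> t \<longrightarrow> t \<le> real N powr (real q - 1 / 2) \<longrightarrow>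
     norm (\<Sum>n<L. cis (t * ln (real (N + n)))) \<le> C * real N powr (1 - c))"
proof -
  define B where "B = 2 * pi * 2 ^ q * fact (q - 1)"
  have f1: "fact (q - 1) \<ge> (1::real)" by simp
  have p1: "2 ^ q \<ge> (1::real)" by simp
  have pi2: "2 * pi \<ge> 1" using pi_gt3 by simp
  have B1: "B \<ge> 1"
    unfolding B_def using mult_mono[OF mult_mono[OF pi2 p1] f1] by simp
  have B2: "2 ^ q \<le> B"
    unfolding B_def using mult_mono[OF mult_mono[OF pi2 order_refl[of "2 ^ q :: real"]] f1] by simp
  obtain c C where sav: "exp_sum_saving q (1 / 2) B c C"
    using exp_sum_saving_exists[OF q, of "1 / 2" B] B1 by auto
  hence c: "0 < c" "c \<le> 1" "0 \<le> C" by (auto simp: exp_sum_saving_def)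
  show ?thesis
  proof (rule exI[of _ c], rule exI[of _ C], intro conjI allI impI c)
    fix N L :: nat and t :: real
    assume N: "1 \<le> N" "L \<le> N" and t: "real N powr (real q - 3 / 2) \<le> t" "t \<le> real N powr (real q - 1 / 2)"
    have N0: "real N > 0" using N by simp
    have "real N powr (real q - 3 / 2) > 0" using N0 by simp
    hence t0: "t > 0" using t(1) by linarith
    define \<kappa> where "\<kappa> = t / (2 * pi)"
    define u where "u n = (-1) ^ (q - 1) * \<kappa> * ln (real (N + n))" for n
    define \<mu> where "\<mu> = \<kappa> * fact (q - 1) / (2 * real N) ^ q"
    have k0: "\<kappa> > 0" using t0 by (simp add: \<kappa>_def)
    have "norm (\<Sum>n<L. cis (2 * pi * u n)) \<le> C * real N powr (1 - c)"
    proof (rule exp_sum_savingD[OF sav N])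
      show "0 < \<mu>" using k0 N by (simp add: \<mu>_def)
      have Nq: "real N ^ q = real N powr q" using N0 by (simp add: powr_realpow)
      have "B * \<mu> = t * (fact (q - 1) * fact (q - 1)) / real N ^ q"
        using N0 by (simp add: B_def \<mu>_def \<kappa>_def power_mult_distrib field_simps)
      also have "\<dots> \<ge> real N powr (real q - 3 / 2) * (1 * 1) / real N ^ q"
        using t f1 N0 t0 by (intro divide_right_mono mult_mono) auto
      also have "real N powr (real q - 3 / 2) * (1 * 1) / real N ^ q = real N powr (1 / 2 - 2)"
        unfolding Nq using N0 by (simp add: powr_diff[symmetric])
      finally show "real N powr (1 / 2 - 2) \<le> B * \<mu>" .
      have "\<mu> = t * (fact (q - 1) / (2 * pi * 2 ^ q)) / real N ^ q"
        using N0 by (simp add: \<mu>_def \<kappa>_def power_mult_distrib field_simps)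
      also have "\<dots> \<le> real N powr (real q - 1 / 2) * B / real N ^ q"
      proof (intro divide_right_mono mult_mono t)
        have "fact (q - 1) / (2 * pi * 2 ^ q) \<le> (fact (q - 1) :: real) / (1 * 1)"
          using pi2 p1 by (intro divide_left_mono mult_mono) auto
        also have "\<dots> \<le> B" unfolding B_def
          using mult_mono[OF mult_mono[OF pi2 p1] order_refl[of "fact (q - 1) :: real"]] by simp
        finally show "fact (q - 1) / (2 * pi * 2 ^ q) \<le> B" .
      qed (use N0 in auto)
      also have "\<dots> = B * real N powr (- (1 / 2))"
        using powr_diff[of "real N" "real q - 1 / 2" "real q"] by (simp add: Nq)
      finally show "\<mu> \<le> B * real N powr (- (1 / 2))" .
      fix n assume n: "n + q < L"
      obtain \<xi> where xi: "real (N + n) \<le> \<xi>" "\<xi> \<le> real (N + n + q)"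
        "(fdiff ^^ q) u n = \<kappa> * fact (q - 1) / \<xi> ^ q"
        using fdiff_pow_ln[OF N(1) k0, of q n] q unfolding u_def by auto
      have xiN: "real N \<le> \<xi>" "\<xi> \<le> 2 * real N" using xi n N by auto
      have "\<mu> \<le> \<kappa> * fact (q - 1) / \<xi> ^ q"
        unfolding \<mu>_def using xiN N0 k0 by (intro divide_left_mono power_mono mult_pos_pos) auto
      moreover have "\<kappa> * fact (q - 1) / \<xi> ^ q \<le> \<kappa> * fact (q - 1) / real N ^ q"
        using xiN N0 k0 by (intro divide_left_mono power_mono mult_pos_pos) auto
      moreover have "\<kappa> * fact (q - 1) / real N ^ q = 2 ^ q * \<mu>"
        using N0 by (simp add: \<mu>_def power_mult_distrib)
      moreover have "2 ^ q * \<mu> \<le> B * \<mu>" using B2 \<open>0 < \<mu>\<close> by (intro mult_right_mono) auto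
      ultimately show "\<mu> \<le> (fdiff ^^ q) u n \<and> (fdiff ^^ q) u n \<le> B * \<mu>" unfolding xi(3) by linarith
    qed
    moreover have "norm (\<Sum>n<L. cis (2 * pi * u n)) = norm (\<Sum>n<L. cis (t * ln (real (N + n))))"
    proof (cases "even (q - 1)")
      case True
      thus ?thesis by (simp add: u_def \<kappa>_def)
    next
      case False
      hence "(\<Sum>n<L. cis (2 * pi * u n)) = cnj (\<Sum>n<L. cis (t * ln (real (N + n))))"
        by (simp add: u_def \<kappa>_def cis_cnj)
      thus ?thesis by (simp only: complex_mod_cnj)
    qed
    ultimately show "norm (\<Sum>n<L. cis (t * ln (real (N + n)))) \<le> C * real N powr (1 - c)" by simp
  qed
qed

text \<open>The windows for q = 2, ..., k + 2 abut and cover all \<open>t\<close> from sqrt N to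
  N^k. Being finitely many, they have a common positive saving. Negative \<open>t\<close> follow by
  conjugation.\<close>

lemma zeta_sum_bound:
  "\<exists>c C. 0 < c \<and> c \<le> 1 \<and> 0 \<le> C \<and> (\<forall>(N::nat) L t. 1 \<le> N \<longrightarrow> L \<le> N \<longrightarrow>
     \<bar>t\<bar> \<le> real N ^ k \<longrightarrow> real N \<le> t\<^sup>2 \<longrightarrow>
     norm (\<Sum>n<L. cis (t * ln (real (N + n)))) \<le> C * real N powr (1 - c))"
proof -
  define good where "good q p \<longleftrightarrow> (0 < fst p \<and> fst p \<le> 1 \<and> 0 \<le> snd p \<and> (\<forall>(N::nat) L t. 1 \<le> N \<longrightarrow> L \<le> N \<longrightarrow>
     real N powr (real q - 3 / 2) \<le> t \<longrightarrow> t \<le> real N powr (real q - 1 / 2) \<longrightarrow>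
     norm (\<Sum>n<L. cis (t * ln (real (N + n)))) \<le> snd p * real N powr (1 - fst p)))" for q :: nat and p :: "real \<times> real"
  define p where "p q = (SOME x. good q x)" for q
  have good: "good q (p q)" if "q \<ge> 2" for q
  proof -
    from zeta_sum_bound_pos[OF that] obtain c C where "good q (c, C)" unfolding good_def by auto
    thus ?thesis unfolding p_def by (rule someI)
  qed
  have p: "0 < fst (p q) \<and> fst (p q) \<le> 1 \<and> 0 \<le> snd (p q)" if "q \<ge> 2" for q
    using good[OF that] by (simp add: good_def)
  have est: "norm (\<Sum>n<L. cis (t * ln (real (N + n)))) \<le> snd (p q) * real N powr (1 - fst (p q))"
    if "q \<ge> 2" "1 \<le> N" "L \<le> N" "real N powr (real q - 3 / 2) \<le> t" "t \<le> real N powr (real q - 1 / 2)"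
    for q N L :: nat and t :: real
    using good[OF that(1)] that unfolding good_def by blast
  define Q where "Q = {2..k + 2}"
  define c where "c = Min ((\<lambda>q. fst (p q)) ` Q)"
  define C where "C = Max ((\<lambda>q. snd (p q)) ` Q)"
  have Q: "finite Q" "Q \<noteq> {}" "2 \<in> Q" by (auto simp: Q_def)
  have cC: "c \<le> fst (p q)" "snd (p q) \<le> C" if "q \<in> Q" for q
    using that Q by (auto simp: c_def C_def)
  have c: "0 < c" unfolding c_def using Q p by (subst Min_gr_iff) (auto simp: Q_def)
  have "c \<le> 1" "0 \<le> C" using cC[OF Q(3)] p[of 2] by auto
  have bound: "norm (\<Sum>n<L. cis (t * ln (real (N + n)))) \<le> C * real N powr (1 - c)"
    if N: "1 \<le> N" "L \<le> N" and t: "0 < t" "t \<le> real N ^ k" "real N \<le> t\<^sup>2" for N L :: nat and t :: real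
  proof -
    \<comment> \<open>Minimality of \<open>q\<close> gives the lower end of its window; for q = 2
      the lower end is the hypothesis \<open>real N \<le> t\<^sup>2\<close>.\<close>
    define q where "q = (LEAST q. q \<ge> 2 \<and> t \<le> real N powr (real q - 1 / 2))"
    have N1: "real N \<ge> 1" using N by simp
    have "real N ^ k = real N powr k" using N1 by (simp add: powr_realpow)
    also have "\<dots> \<le> real N powr (real (k + 2) - 1 / 2)" using N1 by (intro powr_mono) auto
    finally have ex: "k + 2 \<ge> 2 \<and> t \<le> real N powr (real (k + 2) - 1 / 2)" using t by simp
    have q: "q \<ge> 2" "t \<le> real N powr (real q - 1 / 2)"
      unfolding q_def using LeastI[where P = "\<lambda>q. q \<ge> 2 \<and> t \<le> real N powr (real q - 1 / 2)", OF ex] by auto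
    have "q \<le> k + 2" unfolding q_def by (rule Least_le) (rule ex)
    hence qQ: "q \<in> Q" using q by (simp add: Q_def)
    have lower: "real N powr (real q - 3 / 2) \<le> t"
    proof (cases "q = 2")
      case True
      have "real N powr (1 / 2) = sqrt (real N)" using N1 by (simp add: powr_half_sqrt)
      also have "\<dots> \<le> sqrt (t\<^sup>2)" using t by (intro real_sqrt_le_mono)
      finally show ?thesis using t True by simp
    next
      case False
      have "\<not> (q - 1 \<ge> 2 \<and> t \<le> real N powr (real (q - 1) - 1 / 2))"
        using not_less_Least[of "q - 1" "\<lambda>q. q \<ge> 2 \<and> t \<le> real N powr (real q - 1 / 2)"] q
        unfolding q_def[symmetric] by auto
      thus ?thesis using False q by (auto simp: of_nat_diff)
    qed
    have "norm (\<Sum>n<L. cis (t * ln (real (N + n)))) \<le> snd (p q) * real N powr (1 - fst (p q))"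
      by (rule est[OF q(1) N lower q(2)])
    also have "\<dots> \<le> C * real N powr (1 - c)"
      using cC[OF qQ] p[OF q(1)] N1 by (intro mult_mono powr_mono) auto
    finally show ?thesis .
  qed
  show ?thesis
  proof (rule exI[of _ c], rule exI[of _ C], intro conjI allI impI)
    fix N L :: nat and t :: real
    assume N: "1 \<le> N" "L \<le> N" and t: "\<bar>t\<bar> \<le> real N ^ k" "real N \<le> t\<^sup>2"
    have "t \<noteq> 0" using t N by auto
    then consider "t > 0" | "t < 0" by linarith
    thus "norm (\<Sum>n<L. cis (t * ln (real (N + n)))) \<le> C * real N powr (1 - c)"
    proof cases
      case 1 thus ?thesis using bound N t by simp
    next
      case 2
      have "(\<Sum>n<L. cis (t * ln (real (N + n)))) = cnj (\<Sum>n<L. cis (- t * ln (real (N + n))))"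
        by (simp add: cis_cnj)
      hence "norm (\<Sum>n<L. cis (t * ln (real (N + n)))) = norm (\<Sum>n<L. cis (- t * ln (real (N + n))))"
        by (simp only: complex_mod_cnj)
      thus ?thesis using bound[of N L "- t"] 2 N t by simp
    qed
  qed (use c \<open>c \<le> 1\<close> \<open>0 \<le> C\<close> in auto)
qed



section \<open>Euler products\<close>

definition prime_suminf :: "(nat \<Rightarrow> real) \<Rightarrow> real" where
  "prime_suminf h = (\<Sum>n. if prime n then h n else 0)"

text \<open>The sieve of Eratosthenes: by complete multiplicativity, the multiples of a new prime
  \<open>p\<close> carry exactly the share \<open>w p\<close> of what the earlier primes have
  left.\<close>

lemma sieved_sum_eq:
  fixes w :: "nat \<Rightarrow> complex"
  assumes mult: "\<And>m n. w (m * n) = w m * w n" and sm: "summable (\<lambda>n. norm (w n))"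
    and A: "finite A" "\<And>p. p \<in> A \<Longrightarrow> prime p"
  shows "(\<Sum>n. if \<forall>p\<in>A. \<not> p dvd n then w n else 0) = (\<Prod>p\<in>A. 1 - w p) * suminf w"
  using A
proof (induction A rule: finite_induct)
  case empty
  show ?case by simp
next
  case (insert p A)
  define I where "I n = (if \<forall>q\<in>A. \<not> q dvd n then w n else 0)" for n
  define I' where "I' n = (if \<forall>q\<in>insert p A. \<not> q dvd n then w n else 0)" for n
  define D where "D n = (if p dvd n then I n else 0)" for n
  have p: "prime p" and p0: "p > 0" using insert.prems by (auto intro: prime_gt_0_nat)
  have smI: "summable I" and smD: "summable D"
    by (rule summable_comparison_test'[OF sm, of 0]; simp add: I_def D_def)+
  have "strict_mono (\<lambda>m. p * m)" using p0 by (auto simp: strict_mono_def)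
  hence "suminf D = (\<Sum>m. D (p * m))"
    by (rule suminf_mono_reindex[symmetric]) (auto simp: D_def dvd_def image_iff)
  also have "(\<lambda>m. D (p * m)) = (\<lambda>m. w p * I m)"
  proof
    fix m
    have "q dvd p * m \<longleftrightarrow> q dvd m" if "q \<in> A" for q
    proof -
      have "prime q" "q \<noteq> p" using that insert by auto
      hence "\<not> q dvd p" using p primes_dvd_imp_eq by blast
      thus ?thesis using \<open>prime q\<close> by (simp add: prime_dvd_mult_iff)
    qed
    thus "D (p * m) = w p * I m" by (auto simp: D_def I_def mult)
  qed
  also have "(\<Sum>m. w p * I m) = w p * suminf I" using smI by (rule suminf_mult)
  finally have D: "suminf D = w p * suminf I" .
  have "I' = (\<lambda>n. I n - D n)" by (auto simp: I'_def I_def D_def fun_eq_iff)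
  hence "suminf I' = suminf I - suminf D" using suminf_diff[OF smI smD] by simp
  also have "\<dots> = (1 - w p) * suminf I" unfolding D by (simp add: algebra_simps)
  also have "suminf I = (\<Prod>p\<in>A. 1 - w p) * suminf w"
    using insert.IH insert.prems unfolding I_def by simp
  finally show ?case using insert.hyps unfolding I'_def by (simp add: mult_ac)
qed

text \<open>After sieving by the primes up to \<open>y\<close>, only 1 and integers beyond
  \<open>y\<close> survive, and the latter form part of the tail of a convergent series.\<close>

lemma Euler_product_tendsto:
  fixes w :: "nat \<Rightarrow> complex"
  assumes mult: "\<And>m n. w (m * n) = w m * w n" and w1: "w 1 = 1" and w0: "w 0 = 0"
    and sm: "summable (\<lambda>n. norm (w n))"
  shows "(\<lambda>y. (\<Prod>p | prime p \<and> p \<le> y. 1 - w p) * suminf w) \<longlonglongrightarrow> 1"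
proof -
  define A where "A y = {p::nat. prime p \<and> p \<le> y}" for y
  define I where "I y n = (if \<forall>p\<in>A y. \<not> p dvd n then w n else 0)" for y n
  have smI: "summable (\<lambda>n. norm (I y n))" for y
    by (rule summable_comparison_test'[OF sm, of 0]) (simp add: I_def)
  have bound: "norm ((\<Sum>n. I y n) - 1) \<le> (\<Sum>n. norm (w (n + Suc y)))" if y: "y \<ge> 1" for y
  proof -
    have "I y n = (if n = 1 then 1 else 0)" if "n < Suc y" for n
    proof -
      have "I y n = 0" if n1: "n \<noteq> 1"
      proof (cases "n = 0")
        case False
        obtain p where "prime p" "p dvd n" using prime_factor_nat[OF n1] by blast
        moreover have "p \<le> y" using \<open>p dvd n\<close> False \<open>n < Suc y\<close> dvd_imp_le[of p n] by simp
        ultimately show ?thesis by (auto simp: I_def A_def)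
      qed (simp add: I_def w0)
      moreover have "I y 1 = 1" by (auto simp: I_def A_def w1[simplified])
      ultimately show ?thesis by simp
    qed
    hence "(\<Sum>n<Suc y. I y n) = (\<Sum>n<Suc y. if n = 1 then 1 else 0)" by (intro sum.cong) auto
    also have "\<dots> = 1" using y by simp
    finally have "(\<Sum>n. I y n) - 1 = (\<Sum>n. I y (n + Suc y))"
      using suminf_split_initial_segment[OF summable_norm_cancel[OF smI], of y "Suc y"] by simp
    also have "norm \<dots> \<le> (\<Sum>n. norm (I y (n + Suc y)))"
      by (rule summable_norm) (rule summable_ignore_initial_segment[OF smI])
    also have "\<dots> \<le> (\<Sum>n. norm (w (n + Suc y)))"
      by (rule suminf_le[OF _ summable_ignore_initial_segment[OF smI] summable_ignore_initial_segment[OF sm]])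
         (simp add: I_def)
    finally show ?thesis .
  qed
  have tail: "(\<lambda>y. \<Sum>n. norm (w (n + Suc y))) \<longlonglongrightarrow> 0"
    using suminf_exist_split2[OF sm] by (rule LIMSEQ_Suc)
  have "(\<lambda>y. (\<Sum>n. I y n) - 1) \<longlonglongrightarrow> 0"
    by (rule Lim_null_comparison[OF _ tail]) (use bound in \<open>auto simp: eventually_at_top_linorder\<close>)
  hence "(\<lambda>y. \<Sum>n. I y n) \<longlonglongrightarrow> 1" by (rule LIM_zero_cancel)
  moreover have "(\<Sum>n. I y n) = (\<Prod>p | prime p \<and> p \<le> y. 1 - w p) * suminf w" for y
  proof -
    have "finite (A y)" by (simp add: A_def)
    from sieved_sum_eq[OF mult sm this] show ?thesis unfolding I_def A_def by blast
  qed
  ultimately show ?thesis by (simp only:)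
qed

lemma sum_inverse_squares_le: "(\<Sum>n=2..y. 1 / (real n)\<^sup>2) \<le> 1"
proof -
  have "y \<ge> 1 \<Longrightarrow> (\<Sum>n=2..y. 1 / (real n)\<^sup>2) \<le> 1 - 1 / real y"
  proof (induction y rule: nat_induct_at_least)
    case (Suc y)
    have "1 / (real (Suc y))\<^sup>2 \<le> 1 / real y - 1 / real (Suc y)"
    proof -
      have "1 / (real (Suc y))\<^sup>2 \<le> 1 / (real y * real (Suc y))"
        unfolding power2_eq_square using Suc.hyps by (intro divide_left_mono mult_right_mono) auto
      also have "\<dots> = 1 / real y - 1 / real (Suc y)" using Suc.hyps by (simp add: field_simps)
      finally show ?thesis .
    qed
    thus ?case using Suc by simp
  qed simp
  thus ?thesis by (cases "y \<ge> 1") (auto intro: order_trans)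
qed

text \<open>The limit 1 of the sieved series excludes a zero sum. Each factor satisfies |log (1 - w)
  + w| \<le> 2 / p^2 because |w| \<le> 1 / p \<le> 1 / 2, and these errors add up to at most
  2.\<close>

lemma ln_norm_Euler_product:
  fixes w :: "nat \<Rightarrow> complex"
  assumes mult: "\<And>m n. w (m * n) = w m * w n" and w1: "w 1 = 1" and w0: "w 0 = 0"
    and sm: "summable (\<lambda>n. norm (w n))" and le: "\<And>n. n > 0 \<Longrightarrow> norm (w n) \<le> 1 / real n"
  shows "suminf w \<noteq> 0" "\<bar>ln (norm (suminf w)) - prime_suminf (\<lambda>p. Re (w p))\<bar> \<le> 2"
proof -
  define P where "P y = (\<Prod>p | prime p \<and> p \<le> y. 1 - w p)" for y :: nat
  have lim: "(\<lambda>y. P y * suminf w) \<longlonglongrightarrow> 1"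
    unfolding P_def by (rule Euler_product_tendsto[OF mult w1 w0 sm])
  show nz: "suminf w \<noteq> 0"
    using lim LIMSEQ_unique[of "\<lambda>_. 0 :: complex" 0 1] by auto
  have half: "norm (w p) \<le> 1 / 2" if "prime p" for p
  proof -
    have "p \<ge> 2" using that by (rule prime_ge_2_nat)
    hence "1 / real p \<le> 1 / 2" by (intro divide_left_mono) auto
    moreover have "norm (w p) \<le> 1 / real p" using \<open>p \<ge> 2\<close> by (intro le) simp
    ultimately show ?thesis by linarith
  qed
  have fac: "1 - w p \<noteq> 0" if "prime p" for p using half[OF that] by auto
  have each: "\<bar>ln (norm (1 - w p)) + Re (w p)\<bar> \<le> 2 * (1 / (real p)\<^sup>2)" if p: "prime p" for p
  proof -
    have "norm (Ln (1 - w p) + w p) \<le> (norm (w p))\<^sup>2 / (1 - norm (w p))"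
      using Ln_approx_linear[of "- w p"] half[OF p] by simp
    also have "\<dots> \<le> (1 / real p)\<^sup>2 / (1 / 2)"
      using le[OF prime_gt_0_nat[OF p]] half[OF p] by (intro frac_le power_mono) auto
    finally have "norm (Ln (1 - w p) + w p) \<le> 2 * (1 / (real p)\<^sup>2)" by (simp add: power_divide)
    moreover have "Re (Ln (1 - w p) + w p) = ln (norm (1 - w p)) + Re (w p)" using fac[OF p] by simp
    ultimately show ?thesis using abs_Re_le_cmod[of "Ln (1 - w p) + w p"] by linarith
  qed
  have lnP: "ln (norm (P y)) = (\<Sum>p | prime p \<and> p \<le> y. ln (norm (1 - w p)))" for y
  proof -
    have "norm (P y) = (\<Prod>p | prime p \<and> p \<le> y. norm (1 - w p))"
      by (simp only: P_def prod_norm)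
    also have "ln \<dots> = (\<Sum>p | prime p \<and> p \<le> y. ln (norm (1 - w p)))"
      using fac by (intro ln_prod) auto
    finally show ?thesis .
  qed
  have bnd: "\<bar>ln (norm (P y)) + (\<Sum>p | prime p \<and> p \<le> y. Re (w p))\<bar> \<le> 2" for y
  proof -
    have "\<bar>ln (norm (P y)) + (\<Sum>p | prime p \<and> p \<le> y. Re (w p))\<bar>
        = \<bar>\<Sum>p | prime p \<and> p \<le> y. ln (norm (1 - w p)) + Re (w p)\<bar>"
      by (simp add: lnP sum.distrib)
    also have "\<dots> \<le> (\<Sum>p | prime p \<and> p \<le> y. 2 * (1 / (real p)\<^sup>2))"
      by (rule order_trans[OF sum_abs]) (use each in \<open>auto intro!: sum_mono\<close>)
    also have "\<dots> \<le> (\<Sum>p=2..y. 2 * (1 / (real p)\<^sup>2))"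
      by (rule sum_mono2) (auto dest: prime_ge_2_nat)
    also have "\<dots> = 2 * (\<Sum>p=2..y. 1 / (real p)\<^sup>2)" by (simp add: sum_distrib_left)
    also have "\<dots> \<le> 2" using sum_inverse_squares_le[of y] by simp
    finally show ?thesis .
  qed
  have "summable (\<lambda>n. if prime n then Re (w n) else 0)"
    by (rule summable_comparison_test'[OF sm, of 0]) (auto simp: abs_Re_le_cmod)
  hence "(\<lambda>y. \<Sum>n\<le>y. if prime n then Re (w n) else 0) \<longlonglongrightarrow> prime_suminf (\<lambda>p. Re (w p))"
    unfolding prime_suminf_def by (rule summable_LIMSEQ')
  also have "(\<lambda>y. \<Sum>n\<le>y. if prime n then Re (w n) else 0) = (\<lambda>y. \<Sum>p | prime p \<and> p \<le> y. Re (w p))"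
    by (intro ext sum.mono_neutral_cong_right) auto
  finally have limR: "(\<lambda>y. \<Sum>p | prime p \<and> p \<le> y. Re (w p)) \<longlonglongrightarrow> prime_suminf (\<lambda>p. Re (w p))" .
  have "(\<lambda>y. ln (norm (P y * suminf w))) \<longlonglongrightarrow> ln (norm (1::complex))"
    by (intro tendsto_ln tendsto_norm lim) simp
  moreover have "ln (norm (P y * suminf w)) = ln (norm (P y)) + ln (norm (suminf w))" for y
    using nz fac by (auto simp: norm_mult ln_mult P_def)
  ultimately have "(\<lambda>y. ln (norm (P y)) + ln (norm (suminf w))) \<longlonglongrightarrow> 0" by simp
  have "(\<lambda>y. - ln (norm (P y))) \<longlonglongrightarrow> ln (norm (suminf w))"
    using tendsto_minus[OF tendsto_diff[OF \<open>(\<lambda>y. ln (norm (P y)) + ln (norm (suminf w))) \<longlonglongrightarrow> 0\<close> tendsto_const[of "ln (norm (suminf w))"]]]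
    by simp
  from tendsto_rabs[OF tendsto_diff[OF this limR]]
  have "(\<lambda>y. \<bar>- ln (norm (P y)) - (\<Sum>p | prime p \<and> p \<le> y. Re (w p))\<bar>) \<longlonglongrightarrow> \<bar>ln (norm (suminf w)) - prime_suminf (\<lambda>p. Re (w p))\<bar>" .
  moreover have "\<bar>- ln (norm (P y)) - (\<Sum>p | prime p \<and> p \<le> y. Re (w p))\<bar> \<le> 2" for y
    using bnd[of y] by linarith
  ultimately show "\<bar>ln (norm (suminf w)) - prime_suminf (\<lambda>p. Re (w p))\<bar> \<le> 2"
    using LIMSEQ_le_const2 by blast
qed



section \<open>Analytic continuation of the zeta function\<close>

lemma norm_nat_powr: "n > 0 \<Longrightarrow> norm (of_nat n powr s :: complex) = real n powr Re s"
  using norm_powr_real_powr[of "of_nat n" s] by simp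

lemma norm_powr_diff_le:
  assumes s: "Re s \<ge> 0" and n: "n \<ge> (1::nat)" and x: "real n \<le> x" "x \<le> real n + 1"
  shows "norm (of_nat n powr (- s) - of_real x powr (- s) :: complex) \<le> norm s * real n powr (- Re s - 1)"
proof -
  define S where "S = closed_segment (complex_of_real (real n)) (complex_of_real x)"
  have S: "\<exists>y. z = complex_of_real y \<and> real n \<le> y" if z: "z \<in> S" for z
  proof -
    obtain u where u: "0 \<le> u" "u \<le> 1" "z = (1 - u) *\<^sub>R complex_of_real (real n) + u *\<^sub>R complex_of_real x"
      using z unfolding S_def closed_segment_def by auto
    hence "z = complex_of_real (real n + u * (x - real n))" by (simp add: scaleR_conv_of_real algebra_simps)
    thus ?thesis using u x by (intro exI[of _ "real n + u * (x - real n)"]) auto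
  qed
  have "norm ((\<lambda>z. z powr (- s)) (complex_of_real x) - (\<lambda>z. z powr (- s)) (complex_of_real (real n)))
      \<le> (norm s * real n powr (- Re s - 1)) * norm (complex_of_real x - complex_of_real (real n))"
  proof (rule field_differentiable_bound[where S = S])
    fix z assume "z \<in> S"
    then obtain y where y: "z = complex_of_real y" "real n \<le> y" using S by blast
    have y0: "y > 0" using y n by linarith
    show "((\<lambda>z. z powr (- s)) has_field_derivative (- s) * z powr (- s - 1)) (at z within S)"
      using y y0 by (intro has_field_derivative_at_within[OF has_field_derivative_powr])
                    (simp add: complex_nonpos_Reals_iff)
    have "norm (z powr (- s - 1)) = y powr (- Re s - 1)"
      using y y0 norm_powr_real_powr[of z "- s - 1"] by simp
    also have "\<dots> \<le> real n powr (- Re s - 1)" using y s n by (intro powr_mono2') auto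
    finally show "norm ((- s) * z powr (- s - 1)) \<le> norm s * real n powr (- Re s - 1)"
      by (simp add: norm_mult mult_left_mono)
  qed (auto simp: S_def)
  also have "norm (complex_of_real x - complex_of_real (real n)) \<le> 1"
    unfolding of_real_diff[symmetric] norm_of_real using x by simp
  hence "(norm s * real n powr (- Re s - 1)) * norm (complex_of_real x - complex_of_real (real n))
       \<le> (norm s * real n powr (- Re s - 1)) * 1" by (intro mult_left_mono) auto
  finally show ?thesis by (simp add: norm_minus_commute)
qed

text \<open>The difference between n^(-s) and the integral of x^(-s) over [n, n + 1].\<close>

definition zeta_term :: "nat \<Rightarrow> complex \<Rightarrow> complex" where
  "zeta_term n s = of_nat n powr (- s) - (of_nat (Suc n) powr (1 - s) - of_nat n powr (1 - s)) / (1 - s)"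

lemma norm_zeta_term:
  assumes s: "Re s \<ge> 0" "s \<noteq> 1" and n: "n \<ge> (1::nat)"
  shows "norm (zeta_term n s) \<le> norm s * real n powr (- Re s - 1)"
proof -
  define S where "S = closed_segment (complex_of_real (real n)) (complex_of_real (real (Suc n)))"
  have S: "\<exists>y. z = complex_of_real y \<and> real n \<le> y \<and> y \<le> real n + 1" if z: "z \<in> S" for z
  proof -
    obtain u where u: "0 \<le> u" "u \<le> 1" "z = (1 - u) *\<^sub>R complex_of_real (real n) + u *\<^sub>R complex_of_real (real (Suc n))"
      using z unfolding S_def closed_segment_def by auto
    hence "z = complex_of_real (real n + u)" by (simp add: scaleR_conv_of_real algebra_simps)
    thus ?thesis using u by (intro exI[of _ "real n + u"]) auto
  qed
  define g where "g z = of_nat n powr (- s) * z - z powr (1 - s) / (1 - s)" for z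
  have "norm (g (complex_of_real (real (Suc n))) - g (complex_of_real (real n)))
      \<le> (norm s * real n powr (- Re s - 1)) * norm (complex_of_real (real (Suc n)) - complex_of_real (real n))"
  proof (rule field_differentiable_bound[where S = S])
    fix z assume "z \<in> S"
    then obtain y where y: "z = complex_of_real y" "real n \<le> y" "y \<le> real n + 1" using S by blast
    have y0: "y > 0" using y n by linarith
    have "((\<lambda>z. z powr (1 - s)) has_field_derivative (1 - s) * z powr (1 - s - 1)) (at z within S)"
      using y y0 by (intro has_field_derivative_at_within[OF has_field_derivative_powr])
                    (simp add: complex_nonpos_Reals_iff)
    from DERIV_cdivide[OF this, of "1 - s"]
    have "((\<lambda>z. z powr (1 - s) / (1 - s)) has_field_derivative z powr (- s)) (at z within S)"
      using s by simp
    moreover have "((\<lambda>z. of_nat n powr (- s) * z) has_field_derivative of_nat n powr (- s)) (at z within S)"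
      by (auto intro!: derivative_eq_intros)
    ultimately show "(g has_field_derivative of_nat n powr (- s) - z powr (- s)) (at z within S)"
      unfolding g_def by (intro DERIV_diff)
    show "norm (of_nat n powr (- s) - z powr (- s)) \<le> norm s * real n powr (- Re s - 1)"
      unfolding y(1) by (rule norm_powr_diff_le) (use s n y in auto)
  qed (auto simp: S_def)
  also have "norm (complex_of_real (real (Suc n)) - complex_of_real (real n)) = 1" by simp
  also have "g (complex_of_real (real (Suc n))) - g (complex_of_real (real n)) = zeta_term n s"
    by (simp add: g_def zeta_term_def diff_divide_distrib algebra_simps)
  finally show ?thesis by simp
qed

text \<open>The value zeta(5/4). The exponent belongs to the half-plane Re s \<ge> 1/4, where the
  correction terms are at most |s| n^(-5/4).\<close>

definition powr_const :: real where
  "powr_const = (\<Sum>n. real (Suc n) powr (- (5 / 4)))"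

lemma summable_powr_const: "summable (\<lambda>n. real (Suc n) powr (- (5 / 4)))"
  using summable_real_powr_iff[of "- (5/4)"] by (subst summable_Suc_iff) simp

lemma powr_const_nonneg: "powr_const \<ge> 0"
  unfolding powr_const_def by (intro suminf_nonneg summable_powr_const) auto

text \<open>The power n^(-Re s - 1) is split into n^(-5/4), which is summed, and n^(1/4 - Re s),
  which is bounded by its first value; the second factor makes the tail small for large
  \<open>M\<close>.\<close>

lemma zeta_term_tail:
  assumes s: "Re s \<ge> 1 / 4" "s \<noteq> 1"
  shows "summable (\<lambda>n. norm (zeta_term (Suc n + M) s))"
    "norm (\<Sum>n. zeta_term (Suc n + M) s) \<le> norm s * real (Suc M) powr (1 / 4 - Re s) * powr_const"
proof -
  have le: "norm (zeta_term (Suc n + M) s) \<le> norm s * real (Suc M) powr (1 / 4 - Re s) * real (Suc n) powr (- (5 / 4))" for n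
  proof -
    have "norm (zeta_term (Suc n + M) s) \<le> norm s * real (Suc n + M) powr (- Re s - 1)"
      by (rule norm_zeta_term) (use s in auto)
    also have "real (Suc n + M) powr (- Re s - 1) = real (Suc n + M) powr (1 / 4 - Re s) * real (Suc n + M) powr (- (5 / 4))"
      unfolding powr_add[symmetric] by (rule arg_cong[where f = "(powr) (real (Suc n + M))"]) simp
    also have "\<dots> \<le> real (Suc M) powr (1 / 4 - Re s) * real (Suc n) powr (- (5 / 4))"
      using s by (intro mult_mono powr_mono2') auto
    finally show ?thesis by (simp add: mult_left_mono mult.assoc)
  qed
  have sm: "summable (\<lambda>n. norm s * real (Suc M) powr (1 / 4 - Re s) * real (Suc n) powr (- (5 / 4)))"
    by (intro summable_mult summable_powr_const)
  show 1: "summable (\<lambda>n. norm (zeta_term (Suc n + M) s))"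
    by (rule summable_comparison_test'[OF sm, of 0]) (use le in simp)
  have "norm (\<Sum>n. zeta_term (Suc n + M) s) \<le> (\<Sum>n. norm (zeta_term (Suc n + M) s))"
    by (rule summable_norm[OF 1])
  also have "\<dots> \<le> (\<Sum>n. norm s * real (Suc M) powr (1 / 4 - Re s) * real (Suc n) powr (- (5 / 4)))"
    by (rule suminf_le[OF le 1 sm])
  also have "\<dots> = norm s * real (Suc M) powr (1 / 4 - Re s) * powr_const"
    unfolding powr_const_def by (rule suminf_mult[OF summable_powr_const])
  finally show "norm (\<Sum>n. zeta_term (Suc n + M) s) \<le> norm s * real (Suc M) powr (1 / 4 - Re s) * powr_const" .
qed

text \<open>For Re s > 1 the fraction is the integral of x^(-s) over x \<ge> 1, so adding the
  corrections gives zeta; the series of corrections converges further to the left.\<close>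

definition zeta_cont :: "complex \<Rightarrow> complex" where
  "zeta_cont s = 1 / (s - 1) + (\<Sum>n. zeta_term (Suc n) s)"

lemma norm_zeta_cont_minus_pole:
  assumes s: "Re s \<ge> 1 / 4" "s \<noteq> 1"
  shows "norm (zeta_cont s - 1 / (s - 1)) \<le> norm s * powr_const"
  using zeta_term_tail(2)[OF s, of 0] by (simp add: zeta_cont_def)

text \<open>Euler-Maclaurin summation of first order: the integrals in the first \<open>M\<close>
  corrections telescope.\<close>

lemma zeta_cont_partial:
  assumes s: "Re s \<ge> 1 / 4" "s \<noteq> 1"
  shows "zeta_cont s = (\<Sum>n=1..M. of_nat n powr (- s)) + of_nat (Suc M) powr (1 - s) / (s - 1)
           + (\<Sum>n. zeta_term (Suc n + M) s)"
proof -
  have "summable (\<lambda>n. zeta_term (Suc n) s)"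
    using summable_norm_cancel[OF zeta_term_tail(1)[OF s, of 0]] by simp
  from suminf_split_initial_segment[OF this, of M]
  have 1: "(\<Sum>n. zeta_term (Suc n) s) = (\<Sum>n. zeta_term (Suc n + M) s) + (\<Sum>n<M. zeta_term (Suc n) s)"
    by simp
  have "(\<Sum>n<M. zeta_term (Suc n) s) = (\<Sum>n=1..M. of_nat n powr (- s)) + of_nat (Suc M) powr (1 - s) / (s - 1) - 1 / (s - 1)"
  proof (induction M)
    case (Suc M)
    have "x / (1 - s) = - (x / (s - 1))" for x by (metis minus_diff_eq minus_divide_right)
    hence "zeta_term (Suc M) s = of_nat (Suc M) powr (- s) + of_nat (Suc (Suc M)) powr (1 - s) / (s - 1) - of_nat (Suc M) powr (1 - s) / (s - 1)"
      by (simp only: zeta_term_def diff_divide_distrib) (simp add: algebra_simps)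
    thus ?case using Suc by simp
  qed simp
  thus ?thesis using 1 by (simp add: zeta_cont_def)
qed

lemma summable_nat_powr:
  assumes "Re s > 1"
  shows "summable (\<lambda>n. norm (of_nat n powr (- s) :: complex))"
proof (rule summable_comparison_test')
  show "summable (\<lambda>n. real n powr (- Re s))" using assms by (simp add: summable_real_powr_iff)
  show "norm (norm (of_nat n powr (- s) :: complex)) \<le> real n powr (- Re s)" if "n \<ge> 1" for n
    using that norm_nat_powr[of n "- s"] by simp
qed

lemma zeta_cont_eq_suminf:
  assumes s: "Re s > 1"
  shows "zeta_cont s = (\<Sum>n. of_nat n powr (- s))"
proof -
  have s': "Re s \<ge> 1 / 4" "s \<noteq> 1" using s by auto
  have "(\<lambda>M. \<Sum>n\<le>M. of_nat n powr (- s) :: complex) \<longlonglongrightarrow> (\<Sum>n. of_nat n powr (- s))"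
    by (rule summable_LIMSEQ'[OF summable_norm_cancel[OF summable_nat_powr[OF s]]])
  \<comment> \<open>\<open>0 powr _\<close> is 0, so the index 0 adds nothing.\<close>
  also have "(\<lambda>M. \<Sum>n\<le>M. of_nat n powr (- s) :: complex) = (\<lambda>M. \<Sum>n=1..M. of_nat n powr (- s))"
  proof
    show "(\<Sum>n\<le>M. of_nat n powr (- s) :: complex) = (\<Sum>n=1..M. of_nat n powr (- s))" for M
      by (rule sum.mono_neutral_right) (auto simp: not_less_eq_eq)
  qed
  finally have 1: "(\<lambda>M. \<Sum>n=1..M. of_nat n powr (- s) :: complex) \<longlonglongrightarrow> (\<Sum>n. of_nat n powr (- s))" .
  have lim0: "(\<lambda>M. real (Suc M) powr a) \<longlonglongrightarrow> 0" if "a < 0" for a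
    using tendsto_neg_powr[OF that filterlim_real_sequentially] by (rule LIMSEQ_Suc)
  have 2: "(\<lambda>M. of_nat (Suc M) powr (1 - s) / (s - 1)) \<longlonglongrightarrow> 0"
  proof (rule tendsto_norm_zero_cancel)
    have "(\<lambda>M. real (Suc M) powr (1 - Re s) / norm (s - 1)) \<longlonglongrightarrow> 0 / norm (s - 1)"
      by (intro tendsto_divide lim0 tendsto_const) (use s s' in auto)
    thus "(\<lambda>M. norm (of_nat (Suc M) powr (1 - s) / (s - 1))) \<longlonglongrightarrow> 0"
      by (simp add: norm_divide norm_nat_powr del: of_nat_Suc)
  qed
  have 3: "(\<lambda>M. \<Sum>n. zeta_term (Suc n + M) s) \<longlonglongrightarrow> 0"
  proof (rule Lim_null_comparison)
    show "\<forall>\<^sub>F M in sequentially. norm (\<Sum>n. zeta_term (Suc n + M) s) \<le> norm s * real (Suc M) powr (1 / 4 - Re s) * powr_const"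
      using zeta_term_tail(2)[OF s'] by simp
    have "(\<lambda>M. norm s * real (Suc M) powr (1 / 4 - Re s) * powr_const) \<longlonglongrightarrow> norm s * 0 * powr_const"
      by (intro tendsto_mult lim0 tendsto_const) (use s in auto)
    thus "(\<lambda>M. norm s * real (Suc M) powr (1 / 4 - Re s) * powr_const) \<longlonglongrightarrow> 0" by simp
  qed
  have "(\<lambda>M::nat. zeta_cont s) \<longlonglongrightarrow> (\<Sum>n. of_nat n powr (- s)) + 0 + 0"
    using tendsto_add[OF tendsto_add[OF 1 2] 3] by (simp only: zeta_cont_partial[OF s', symmetric])
  thus ?thesis by (simp add: LIMSEQ_const_iff)
qed

lemma holomorphic_zeta_cont: "zeta_cont holomorphic_on ({s. Re s > 1 / 4} - {1})"
proof -
  have op: "open ({s. Re s > 1 / 4} - {1})" by (intro open_Diff open_halfspace_Re_gt) auto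
  have "(\<lambda>s. \<Sum>n. zeta_term (Suc n) s) holomorphic_on ({s. Re s > 1 / 4} - {1})"
  proof (rule holomorphic_uniform_sequence[OF op])
    show "(\<lambda>s. \<Sum>n<N. zeta_term (Suc n) s) holomorphic_on ({s. Re s > 1 / 4} - {1})" for N
      unfolding zeta_term_def by (intro holomorphic_intros) auto
    fix x assume "x \<in> {s. Re s > 1 / 4} - {1}"
    then obtain d where d: "d > 0" "cball x d \<subseteq> {s. Re s > 1 / 4} - {1}"
      using op open_contains_cball by metis
    have "uniform_limit (cball x d) (\<lambda>N s. \<Sum>n<N. zeta_term (Suc n) s) (\<lambda>s. \<Sum>n. zeta_term (Suc n) s) sequentially"
    proof (rule Weierstrass_m_test)
      fix n s assume s: "s \<in> cball x d"
      hence s1: "Re s > 1 / 4" "s \<noteq> 1" using d by auto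
      have "norm s \<le> norm x + d" using s norm_triangle_ineq2[of s x] by (simp add: dist_norm norm_minus_commute)
      moreover have "norm (zeta_term (Suc n) s) \<le> norm s * real (Suc n) powr (- Re s - 1)"
        using s1 by (intro norm_zeta_term) auto
      moreover have "real (Suc n) powr (- Re s - 1) \<le> real (Suc n) powr (- (5 / 4))"
        using s1 by (intro powr_mono) auto
      ultimately have "norm s * real (Suc n) powr (- Re s - 1) \<le> (norm x + d) * real (Suc n) powr (- (5 / 4))"
        using d by (intro mult_mono) auto
      with \<open>norm (zeta_term (Suc n) s) \<le> _\<close>
      show "norm (zeta_term (Suc n) s) \<le> (norm x + d) * real (Suc n) powr (- (5 / 4))" by (rule order_trans)
    qed (intro summable_mult summable_powr_const)
    thus "\<exists>d>0. cball x d \<subseteq> {s. Re s > 1 / 4} - {1} \<and>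
        uniform_limit (cball x d) (\<lambda>N s. \<Sum>n<N. zeta_term (Suc n) s) (\<lambda>s. \<Sum>n. zeta_term (Suc n) s) sequentially"
      using d by blast
  qed
  thus ?thesis unfolding zeta_cont_def by (intro holomorphic_intros) auto
qed



section \<open>Sums over primes and Euler products near 1\<close>

abbreviation primes_le :: "real \<Rightarrow> nat set" where
  "primes_le X \<equiv> {p. prime p \<and> real p \<le> X}"

lemma finite_primes_le [simp]: "finite (primes_le X)"
proof (rule finite_subset)
  show "primes_le X \<subseteq> {..nat \<lfloor>X\<rfloor>}" by (auto intro: le_nat_floor)
qed simp

lemma sum_primes_le_split:
  fixes h :: "nat \<Rightarrow> real"
  assumes "y \<le> X"
  shows "(\<Sum>p\<in>primes_le X. h p) = (\<Sum>p\<in>primes_le y. h p) + (\<Sum>p | prime p \<and> y < real p \<and> real p \<le> X. h p)"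
proof -
  have eq: "primes_le X = primes_le y \<union> {p. prime p \<and> y < real p \<and> real p \<le> X}" using assms by auto
  have "finite {p. prime p \<and> y < real p \<and> real p \<le> X}"
    by (rule finite_subset[OF _ finite_primes_le[of X]]) auto
  thus ?thesis by (subst eq, intro sum.union_disjoint) auto
qed

definition dirichlet_sum :: "(nat \<Rightarrow> complex) \<Rightarrow> real \<Rightarrow> complex" where
  "dirichlet_sum g \<sigma> = (\<Sum>n. g n * of_real (real n powr (- \<sigma>)))"

text \<open>The value at 0 is left free: in \<open>dirichlet_sum\<close> the factor
  \<open>real n powr (- \<sigma>)\<close> vanishes there.\<close>

definition completely_mult :: "(nat \<Rightarrow> complex) \<Rightarrow> bool" where
  "completely_mult g \<longleftrightarrow> g 1 = 1 \<and> (\<forall>m>0. \<forall>n>0. g (m * n) = g m * g n) \<and> (\<forall>n>0. norm (g n) \<le> 1)"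

lemma completely_mult_cis: "completely_mult (\<lambda>n. cis (t * ln (real n)))"
  by (auto simp: completely_mult_def cis_mult ln_mult algebra_simps)

lemma summable_dirichlet:
  fixes g :: "nat \<Rightarrow> complex"
  assumes "\<And>n. n > 0 \<Longrightarrow> norm (g n) \<le> 1" "\<sigma> > 1"
  shows "summable (\<lambda>n. norm (g n * of_real (real n powr (- \<sigma>))))"
proof (rule summable_comparison_test')
  show "summable (\<lambda>n. real n powr (- \<sigma>))" using assms by (simp add: summable_real_powr_iff)
  show "norm (norm (g n * of_real (real n powr (- \<sigma>)))) \<le> real n powr (- \<sigma>)" if "n \<ge> 1" for n
    using assms(1)[of n] that by (simp add: norm_mult mult_left_le_one_le)
qed

lemma summable_prime_powr:
  fixes h :: "nat \<Rightarrow> real"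
  assumes "\<And>p. prime p \<Longrightarrow> \<bar>h p\<bar> \<le> 1" "\<sigma> > 1"
  shows "summable (\<lambda>n. if prime n then h n * real n powr (- \<sigma>) else 0)"
proof (rule summable_comparison_test')
  show "summable (\<lambda>n. real n powr (- \<sigma>))" using assms by (simp add: summable_real_powr_iff)
  show "norm (if prime n then h n * real n powr (- \<sigma>) else 0) \<le> real n powr (- \<sigma>)" if "n \<ge> 0" for n
    using assms(1)[of n] by (auto simp: abs_mult mult_left_le_one_le)
qed

lemma ln_norm_dirichlet_sum:
  assumes g: "completely_mult g" and \<sigma>: "\<sigma> > 1"
  shows "dirichlet_sum g \<sigma> \<noteq> 0"
    "\<bar>ln (norm (dirichlet_sum g \<sigma>)) - prime_suminf (\<lambda>p. Re (g p) * real p powr (- \<sigma>))\<bar> \<le> 2"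
proof -
  define w where "w n = g n * of_real (real n powr (- \<sigma>))" for n
  have 1: "w (m * n) = w m * w n" for m n
    using g by (cases "m = 0 \<or> n = 0") (auto simp: w_def completely_mult_def powr_mult)
  have 2: "w 1 = 1" "w 0 = 0" using g by (auto simp: w_def completely_mult_def)
  have 3: "summable (\<lambda>n. norm (w n))"
    unfolding w_def using g \<sigma> by (intro summable_dirichlet) (auto simp: completely_mult_def)
  have 4: "norm (w n) \<le> 1 / real n" if n: "n > 0" for n
  proof -
    have "norm (w n) \<le> 1 * real n powr (- \<sigma>)"
      using g n by (auto simp: w_def norm_mult completely_mult_def mult_left_le_one_le)
    also have "\<dots> \<le> real n powr (- 1)" unfolding mult_1 using n \<sigma> by (intro powr_mono) auto
    finally show ?thesis using n by (simp add: powr_minus_divide)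
  qed
  have Re: "Re (w p) = Re (g p) * real p powr (- \<sigma>)" for p by (simp add: w_def)
  show "dirichlet_sum g \<sigma> \<noteq> 0"
    "\<bar>ln (norm (dirichlet_sum g \<sigma>)) - prime_suminf (\<lambda>p. Re (g p) * real p powr (- \<sigma>))\<bar> \<le> 2"
    using ln_norm_Euler_product[OF 1 2 3 4] by (simp_all add: dirichlet_sum_def w_def)
qed

lemma nat_powr_complex:
  assumes "n > (0::nat)"
  shows "of_nat n powr Complex a b = of_real (real n powr a) * cis (b * ln (real n))"
proof -
  have "Ln (of_nat n) = of_real (ln (real n))"
    using assms by (metis Ln_of_nat)
  hence "of_nat n powr Complex a b = exp (Complex a b * of_real (ln (real n)))"
    using assms by (simp add: powr_def)
  also have "\<dots> = exp (of_real (a * ln (real n)) + \<i> * of_real (b * ln (real n)))"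
    by (rule arg_cong[where f = exp]) (simp add: complex_eq_iff)
  finally show ?thesis using assms by (simp add: exp_add cis_conv_exp powr_def exp_of_real[symmetric])
qed

lemma zeta_cont_eq_dirichlet_sum:
  assumes "\<sigma> > 1"
  shows "zeta_cont (Complex \<sigma> t) = dirichlet_sum (\<lambda>n. cis (- t * ln (real n))) \<sigma>"
proof -
  have "of_nat n powr (- Complex \<sigma> t) = cis (- t * ln (real n)) * of_real (real n powr (- \<sigma>))" for n
  proof (cases "n = 0")
    case False
    have "- Complex \<sigma> t = Complex (- \<sigma>) (- t)" by (simp add: complex_eq_iff)
    thus ?thesis using nat_powr_complex[of n "- \<sigma>" "- t"] False by simp
  qed simp
  thus ?thesis using assms zeta_cont_eq_suminf[of "Complex \<sigma> t"] by (simp add: dirichlet_sum_def)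
qed

definition zeta_const :: real where
  "zeta_const = ln (2 + 4 * powr_const)"

text \<open>Both quantities are at least 1 and they differ by a bounded amount, so their ratio is
  bounded in both directions; \<open>zeta_const\<close> is the logarithm of a bound for it.\<close>

lemma ln_zeta_bounds:
  assumes \<sigma>: "1 < \<sigma>" "\<sigma> \<le> 2"
  shows "\<bar>ln (norm (zeta_cont (of_real \<sigma>))) - ln (1 / (\<sigma> - 1))\<bar> \<le> zeta_const"
proof -
  define a where "a = 1 / (\<sigma> - 1)"
  define Z where "Z = norm (zeta_cont (of_real \<sigma>))"
  define K where "K = powr_const"
  have K: "K \<ge> 0" by (simp add: K_def powr_const_nonneg)
  have a: "a \<ge> 1" using \<sigma> by (simp add: a_def)
  have "norm (1 / (complex_of_real \<sigma> - 1)) = a"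
  proof -
    have "1 / (complex_of_real \<sigma> - 1) = of_real a" by (simp add: a_def)
    thus ?thesis using a by (simp only: norm_of_real)
  qed
  moreover have "norm (zeta_cont (of_real \<sigma>) - 1 / (of_real \<sigma> - 1)) \<le> \<sigma> * K"
    using norm_zeta_cont_minus_pole[of "of_real \<sigma>"] \<sigma> by (auto simp: K_def)
  ultimately have d: "\<bar>Z - a\<bar> \<le> \<sigma> * K"
    unfolding Z_def using norm_triangle_ineq3 by (metis order_trans)
  also have "\<dots> \<le> 2 * K" using \<sigma> K by (intro mult_right_mono) auto
  finally have d: "\<bar>Z - a\<bar> \<le> 2 * K" .
  have Z1: "Z \<ge> 1"
  proof -
    have sm: "summable (\<lambda>n. real n powr (- \<sigma>))" using \<sigma> by (simp add: summable_real_powr_iff)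
    have "zeta_cont (of_real \<sigma>) = (\<Sum>n. complex_of_real (real n powr (- \<sigma>)))"
      using zeta_cont_eq_dirichlet_sum[of \<sigma> 0] \<sigma> by (simp add: dirichlet_sum_def complex_of_real_def)
    also have "\<dots> = of_real (\<Sum>n. real n powr (- \<sigma>))" by (rule suminf_of_real[OF sm, symmetric])
    finally have "Z = \<bar>\<Sum>n. real n powr (- \<sigma>)\<bar>" by (simp only: Z_def norm_of_real)
    moreover have "(\<Sum>n\<in>{1}. real n powr (- \<sigma>)) \<le> (\<Sum>n. real n powr (- \<sigma>))"
      by (intro sum_le_suminf sm) auto
    ultimately show ?thesis by simp
  qed
  have "Z \<le> a * (2 + 4 * K)"
  proof -
    have "Z \<le> a * 1 + 1 * (2 * K)" using d by simp
    also have "\<dots> \<le> a * 2 + a * (4 * K)" using a K by (intro add_mono mult_mono) auto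
    finally show ?thesis by (simp add: algebra_simps)
  qed
  moreover have "a \<le> Z * (2 + 4 * K)"
  proof -
    have "a \<le> Z * 1 + 1 * (2 * K)" using d by simp
    also have "\<dots> \<le> Z * 2 + Z * (4 * K)" using Z1 K by (intro add_mono mult_mono) auto
    finally show ?thesis by (simp add: algebra_simps)
  qed
  ultimately have "ln Z \<le> ln (a * (2 + 4 * K))" "ln a \<le> ln (Z * (2 + 4 * K))"
    using a Z1 K by (auto intro!: ln_mono)
  hence "ln Z \<le> ln a + zeta_const" "ln a \<le> ln Z + zeta_const"
    using a Z1 K by (auto simp: ln_mult zeta_const_def K_def)
  thus ?thesis by (simp add: Z_def a_def abs_le_iff)
qed

definition prime_zeta_const :: real where "prime_zeta_const = 2 + zeta_const"

lemma zeta_const_nonneg: "zeta_const \<ge> 0"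
  using powr_const_nonneg by (simp add: zeta_const_def)

lemma prime_zeta_bounds:
  assumes \<sigma>: "1 < \<sigma>" "\<sigma> \<le> 2"
  shows "\<bar>prime_suminf (\<lambda>p. real p powr (- \<sigma>)) - ln (1 / (\<sigma> - 1))\<bar> \<le> prime_zeta_const"
proof -
  have "zeta_cont (of_real \<sigma>) = dirichlet_sum (\<lambda>n. cis (0 * ln (real n))) \<sigma>"
    using zeta_cont_eq_dirichlet_sum[of \<sigma> 0] \<sigma> by (simp add: complex_of_real_def)
  hence "\<bar>ln (norm (zeta_cont (of_real \<sigma>))) - prime_suminf (\<lambda>p. real p powr (- \<sigma>))\<bar> \<le> 2"
    using ln_norm_dirichlet_sum(2)[OF completely_mult_cis[of 0] \<sigma>(1)] by simp
  thus ?thesis using ln_zeta_bounds[OF \<sigma>] unfolding prime_zeta_const_def by linarith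
qed

definition prime_kernel_const :: real where
  "prime_kernel_const = 6 * (ln 2 + 2 * prime_zeta_const) + prime_zeta_const"

text \<open>A sharp cutoff compared with the weight e^(-u). The function e^(-u) - e^(-2u) vanishes
  only to first order at 0 and decays like e^(-u), so it dominates both the cutoff error and u^2 on
  [0, 1]. The constant 6 comes from the second bound, where 6 (1/3) (u/2) = u.\<close>

lemma exp_kernel_bounds:
  fixes u :: real
  assumes "u \<ge> 0"
  shows "\<bar>(if u \<le> 1 then 1 else 0) - exp (- u)\<bar> \<le> 6 * (exp (- u) - exp (- 2 * u))"
    "u \<le> 1 \<Longrightarrow> u\<^sup>2 \<le> 6 * (exp (- u) - exp (- 2 * u))"
proof -
  define e where "e = exp (- u)"
  have e: "0 < e" "e \<le> 1" using assms by (auto simp: e_def)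
  have e2: "exp (- 2 * u) = e * e" by (simp add: e_def exp_add[symmetric])
  have e1: "exp (- 1) \<ge> (1 / 3 :: real)" "exp (- 1) \<le> (1 / 2 :: real)"
    using exp_le exp_ge_add_one_self[of 1] by (auto simp: exp_minus field_simps)
  have small: "e \<ge> 1 / 3" if "u \<le> 1"
  proof -
    have "exp (- 1) \<le> e" using that by (simp add: e_def)
    thus ?thesis using e1 by linarith
  qed
  show "\<bar>(if u \<le> 1 then 1 else 0) - exp (- u)\<bar> \<le> 6 * (exp (- u) - exp (- 2 * u))"
  proof (cases "u \<le> 1")
    case True
    have "1 * (1 - e) \<le> (6 * e) * (1 - e)" using small[OF True] e by (intro mult_right_mono) auto
    thus ?thesis using True e unfolding e2 e_def[symmetric] by (simp add: algebra_simps)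
  next
    case False
    have "e \<le> exp (- 1)" using False by (simp add: e_def)
    hence "e \<le> 1 / 2" using e1 by linarith
    hence "e * 1 \<le> e * (6 * (1 - e))" using e by (intro mult_left_mono) auto
    thus ?thesis using False e unfolding e2 e_def[symmetric] by (simp add: algebra_simps)
  qed
  show "u\<^sup>2 \<le> 6 * (exp (- u) - exp (- 2 * u))" if "u \<le> 1"
  proof -
    have "e \<le> 1 / (1 + u)"
      using exp_ge_add_one_self[of u] assms by (simp add: e_def exp_minus field_simps)
    hence "1 - e \<ge> u / (1 + u)" using assms by (simp add: field_simps)
    moreover have "u / (1 + u) \<ge> u / 2" using that assms by (intro divide_left_mono) auto
    ultimately have h: "u / 2 \<le> 1 - e" by linarith
    have "6 * e * (1 - e) \<ge> (6 * (1 / 3)) * (u / 2)"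
      by (rule mult_mono) (use small[OF that] e assms h in linarith)+
    moreover have "u\<^sup>2 \<le> u" using that assms by (simp add: power2_eq_square mult_left_le_one_le)
    ultimately show ?thesis unfolding e2 e_def[symmetric] by (simp add: algebra_simps)
  qed
qed

lemma prime_powr_as_exp:
  assumes "prime p" "ln X > 0"
  shows "real p powr (- (1 + c / ln X)) = exp (- c * (ln (real p) / ln X)) / real p"
proof -
  have p: "real p > 0" using prime_gt_0_nat[OF assms(1)] by simp
  have "real p powr (- (1 + c / ln X)) = real p powr (- c / ln X) * real p powr (- 1)"
    unfolding powr_add[symmetric] by (rule arg_cong[where f = "(powr) (real p)"]) simp
  also have "real p powr (- 1) = 1 / real p" using p by (simp add: powr_minus_divide)
  also have "real p powr (- c / ln X) = exp (- c * (ln (real p) / ln X))"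
    using p by (simp add: powr_def)
  finally show ?thesis by simp
qed

lemma sum_primes_le_eq_suminf:
  fixes h :: "nat \<Rightarrow> real"
  shows "(\<Sum>p\<in>primes_le X. h p) = (\<Sum>n. if prime n then (if real n \<le> X then h n else 0) else 0)"
proof -
  have "(\<Sum>n. if prime n then (if real n \<le> X then h n else 0) else 0)
      = (\<Sum>n\<in>primes_le X. if prime n then (if real n \<le> X then h n else 0) else 0)"
    by (intro suminf_finite finite_primes_le) auto
  also have "\<dots> = (\<Sum>p\<in>primes_le X. h p)" by (rule sum.cong) auto
  finally show ?thesis by simp
qed

lemma ln_ge_2: "exp 2 \<le> X \<Longrightarrow> ln X \<ge> (2::real)"
  using ln_mono[of "exp 2" X] by simp

text \<open>
  With \<open>u = ln p / ln X\<close>, the bounds of \<open>exp_kernel_bounds\<close> dominate the error by the difference of the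
  prime zeta function at \<open>1 + 1 / ln X\<close> and \<open>1 + 2 / ln X\<close>, which is bounded since zeta has a simple
  pole. This replaces the estimates of Chebyshev and Mertens.
\<close>

lemma prime_kernel:
  assumes X: "exp 2 \<le> X"
  shows "\<And>h. (\<And>p. prime p \<Longrightarrow> \<bar>h p\<bar> \<le> 1) \<Longrightarrow>
      \<bar>(\<Sum>p\<in>primes_le X. h p / real p) - prime_suminf (\<lambda>p. h p * real p powr (- (1 + 1 / ln X)))\<bar> \<le> prime_kernel_const"
    "(\<Sum>p\<in>primes_le X. (ln (real p))\<^sup>2 / real p) \<le> prime_kernel_const * (ln X)\<^sup>2"
proof -
  define L where "L = ln X"
  have L: "L \<ge> 2" using ln_ge_2[OF X] by (simp add: L_def)
  have X0: "X > 0" using assms exp_gt_zero[of 2] by linarith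
  define \<sigma>1 where "\<sigma>1 = 1 + 1 / L"
  define \<sigma>2 where "\<sigma>2 = 1 + 2 / L"
  have \<sigma>: "1 < \<sigma>1" "\<sigma>1 \<le> 2" "1 < \<sigma>2" "\<sigma>2 \<le> 2" using L by (auto simp: \<sigma>1_def \<sigma>2_def)
  define k where "k p = real p powr (- \<sigma>1) - real p powr (- \<sigma>2)" for p
  have sm1: "summable (\<lambda>n. if prime n then real n powr (- \<sigma>1) else 0)"
    using summable_prime_powr[of "\<lambda>_. 1" \<sigma>1, unfolded mult_1] \<sigma> by simp
  have sm2: "summable (\<lambda>n. if prime n then real n powr (- \<sigma>2) else 0)"
    using summable_prime_powr[of "\<lambda>_. 1" \<sigma>2, unfolded mult_1] \<sigma> by simp
  have keq: "(\<lambda>n. if prime n then k n else 0) = (\<lambda>n. (if prime n then real n powr (- \<sigma>1) else 0) - (if prime n then real n powr (- \<sigma>2) else 0))"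
    by (auto simp: k_def)
  have smk: "summable (\<lambda>n. if prime n then k n else 0)"
    unfolding keq by (intro summable_diff sm1 sm2)
  have sumk: "prime_suminf k \<le> ln 2 + 2 * prime_zeta_const"
  proof -
    have "prime_suminf k = prime_suminf (\<lambda>p. real p powr (- \<sigma>1)) - prime_suminf (\<lambda>p. real p powr (- \<sigma>2))"
      unfolding prime_suminf_def keq by (rule suminf_diff[OF sm1 sm2, symmetric])
    moreover have "ln (1 / (\<sigma>1 - 1)) = ln L" "ln (1 / (\<sigma>2 - 1)) = ln L - ln 2"
      using L by (auto simp: \<sigma>1_def \<sigma>2_def ln_div)
    ultimately show ?thesis using prime_zeta_bounds[of \<sigma>1] prime_zeta_bounds[of \<sigma>2] \<sigma> by linarith
  qed
  have pz0: "prime_zeta_const \<ge> 0" using zeta_const_nonneg by (simp add: prime_zeta_const_def)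
  define u where "u p = ln (real p) / L" for p :: nat
  have u0: "u p \<ge> 0" if "prime p" for p
    using prime_ge_1_nat[OF that] L by (simp add: u_def)
  have k_exp: "k p = (exp (- u p) - exp (- 2 * u p)) / real p"
    and p1: "real p powr (- \<sigma>1) = exp (- u p) / real p" if "prime p" for p
    using prime_powr_as_exp[OF that, of X 1] prime_powr_as_exp[OF that, of X 2] L
    by (auto simp: k_def \<sigma>1_def \<sigma>2_def L_def[symmetric] u_def diff_divide_distrib)
  have u1: "real p \<le> X \<longleftrightarrow> u p \<le> 1" if "prime p" for p
  proof -
    have "real p \<le> X \<longleftrightarrow> ln (real p) \<le> L"
      using prime_gt_0_nat[OF that] X0 unfolding L_def by (subst ln_le_cancel_iff) auto
    also have "\<dots> \<longleftrightarrow> u p \<le> 1" using L by (simp add: u_def divide_le_eq)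
    finally show ?thesis .
  qed
  show "\<bar>(\<Sum>p\<in>primes_le X. h p / real p) - prime_suminf (\<lambda>p. h p * real p powr (- (1 + 1 / ln X)))\<bar> \<le> prime_kernel_const"
    if h: "\<And>p. prime p \<Longrightarrow> \<bar>h p\<bar> \<le> 1" for h
  proof -
    define a where "a n = (if prime n then (if real n \<le> X then h n / real n else 0) else 0)" for n
    define b where "b n = (if prime n then h n * real n powr (- \<sigma>1) else 0)" for n
    have sma: "summable a"
      by (rule summable_finite[of "primes_le X"]) (auto simp: a_def)
    have smb: "summable b" unfolding b_def using h \<sigma> by (intro summable_prime_powr) auto
    have ab: "\<bar>a n - b n\<bar> \<le> 6 * (if prime n then k n else 0)" for n
    proof (cases "prime n")
      case True
      have "a n - b n = h n * ((if u n \<le> 1 then 1 else 0) - exp (- u n)) / real n"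
        using True by (simp add: a_def b_def p1[OF True] u1[OF True] diff_divide_distrib algebra_simps)
      hence "\<bar>a n - b n\<bar> = \<bar>h n\<bar> * \<bar>(if u n \<le> 1 then 1 else 0) - exp (- u n)\<bar> / real n"
        by (simp add: abs_mult)
      also have "\<dots> \<le> 1 * (6 * (exp (- u n) - exp (- 2 * u n))) / real n"
        using h[OF True] exp_kernel_bounds(1)[OF u0[OF True]] by (intro divide_right_mono mult_mono) auto
      also have "\<dots> = 6 * k n" by (simp add: k_exp[OF True])
      finally show ?thesis using True by simp
    qed (simp add: a_def b_def)
    have "\<bar>suminf a - suminf b\<bar> = \<bar>\<Sum>n. a n - b n\<bar>" by (simp add: suminf_diff[OF sma smb])
    also have smab: "summable (\<lambda>n. \<bar>a n - b n\<bar>)"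
      by (rule summable_comparison_test'[OF summable_mult[OF smk, of 6], of 0]) (use ab in simp)
    hence "\<bar>\<Sum>n. a n - b n\<bar> \<le> (\<Sum>n. \<bar>a n - b n\<bar>)" by (rule summable_rabs)
    also have "\<dots> \<le> (\<Sum>n. 6 * (if prime n then k n else 0))"
      by (rule suminf_le[OF ab smab summable_mult[OF smk]])
    also have "\<dots> = 6 * prime_suminf k" unfolding prime_suminf_def by (rule suminf_mult[OF smk])
    also have "\<dots> \<le> prime_kernel_const" using sumk pz0 by (simp add: prime_kernel_const_def)
    finally show ?thesis
      unfolding sum_primes_le_eq_suminf prime_suminf_def a_def b_def \<sigma>1_def L_def .
  qed
  show "(\<Sum>p\<in>primes_le X. (ln (real p))\<^sup>2 / real p) \<le> prime_kernel_const * (ln X)\<^sup>2"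
  proof -
    have le: "(ln (real p))\<^sup>2 / real p \<le> 6 * L\<^sup>2 * k p" if p: "p \<in> primes_le X" for p
    proof -
      have "(u p)\<^sup>2 \<le> 6 * (exp (- u p) - exp (- 2 * u p))"
        using p u0 u1 by (intro exp_kernel_bounds(2)) auto
      hence "L\<^sup>2 * (u p)\<^sup>2 \<le> L\<^sup>2 * (6 * (exp (- u p) - exp (- 2 * u p)))" by (intro mult_left_mono) auto
      moreover have "L\<^sup>2 * (u p)\<^sup>2 = (ln (real p))\<^sup>2" using L by (simp add: u_def power_divide)
      ultimately have "(ln (real p))\<^sup>2 / real p \<le> L\<^sup>2 * (6 * (exp (- u p) - exp (- 2 * u p))) / real p"
        by (intro divide_right_mono) auto
      also have "\<dots> = 6 * L\<^sup>2 * k p" using p by (subst k_exp) auto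
      finally show ?thesis .
    qed
    have "(\<Sum>p\<in>primes_le X. (ln (real p))\<^sup>2 / real p) \<le> (\<Sum>p\<in>primes_le X. 6 * L\<^sup>2 * k p)"
      by (intro sum_mono le)
    also have "\<dots> = 6 * L\<^sup>2 * (\<Sum>p\<in>primes_le X. if prime p then k p else 0)"
      by (simp add: sum_distrib_left)
    also have "(\<Sum>p\<in>primes_le X. if prime p then k p else 0) \<le> prime_suminf k"
      unfolding prime_suminf_def
    proof (rule sum_le_suminf[OF smk finite_primes_le])
      show "0 \<le> (if prime n then k n else 0)" for n
        using u0[of n] by (auto simp: k_exp)
    qed
    also have "\<dots> \<le> ln 2 + 2 * prime_zeta_const" by (rule sumk)
    finally have "(\<Sum>p\<in>primes_le X. (ln (real p))\<^sup>2 / real p) \<le> 6 * L\<^sup>2 * (ln 2 + 2 * prime_zeta_const)"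
      by (simp add: mult_left_mono)
    also have "\<dots> \<le> prime_kernel_const * L\<^sup>2"
      unfolding prime_kernel_const_def using pz0 by (simp add: algebra_simps)
    finally show ?thesis by (simp add: L_def)
  qed
qed

definition mertens_const :: real where
  "mertens_const = prime_kernel_const + prime_zeta_const + 4"

lemma mertens_const_ge: "mertens_const \<ge> 4" "prime_kernel_const \<le> mertens_const" "prime_kernel_const \<ge> 0"
  using zeta_const_nonneg by (auto simp: mertens_const_def prime_kernel_const_def prime_zeta_const_def)

text \<open>Mertens' theorem, from the kernel comparison with \<open>h\<close> = 1 and the simple
  pole of zeta.\<close>

lemma sum_inverse_primes:
  assumes X: "exp 2 \<le> X"
  shows "\<bar>(\<Sum>p\<in>primes_le X. 1 / real p) - ln (ln X)\<bar> \<le> mertens_const"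
proof -
  have "\<bar>prime_suminf (\<lambda>p. real p powr (- (1 + 1 / ln X))) - ln (1 / (1 + 1 / ln X - 1))\<bar> \<le> prime_zeta_const"
    using ln_ge_2[OF X] by (intro prime_zeta_bounds) auto
  moreover have "\<bar>(\<Sum>p\<in>primes_le X. 1 / real p) - prime_suminf (\<lambda>p. 1 * real p powr (- (1 + 1 / ln X)))\<bar> \<le> prime_kernel_const"
    by (rule prime_kernel(1)[OF X]) simp
  ultimately show ?thesis unfolding mertens_const_def by simp
qed

text \<open>The logarithm of the modulus of the series is the prime sum of Re g(p) / p up to a
  constant, so an upper bound for the series becomes a lower bound for the distance from
  \<open>g\<close> to 1. It serves both L-functions and zeta.\<close>

lemma distance_lower_bound:
  assumes X: "exp 2 \<le> X" and g: "completely_mult g"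
  shows "(\<Sum>p\<in>primes_le X. (1 - Re (g p)) / real p)
     \<ge> ln (ln X) - ln (norm (dirichlet_sum g (1 + 1 / ln X))) - 2 * mertens_const"
proof -
  have "\<bar>Re (g p)\<bar> \<le> 1" if "prime p" for p
    using g prime_gt_0_nat[OF that] abs_Re_le_cmod[of "g p"] unfolding completely_mult_def by (meson order_trans)
  hence "\<bar>(\<Sum>p\<in>primes_le X. Re (g p) / real p) - prime_suminf (\<lambda>p. Re (g p) * real p powr (- (1 + 1 / ln X)))\<bar> \<le> prime_kernel_const"
    by (rule prime_kernel(1)[OF X])
  moreover have "\<bar>ln (norm (dirichlet_sum g (1 + 1 / ln X))) - prime_suminf (\<lambda>p. Re (g p) * real p powr (- (1 + 1 / ln X)))\<bar> \<le> 2"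
    using ln_ge_2[OF X] by (intro ln_norm_dirichlet_sum(2)[OF g]) auto
  moreover have "(\<Sum>p\<in>primes_le X. (1 - Re (g p)) / real p) = (\<Sum>p\<in>primes_le X. 1 / real p) - (\<Sum>p\<in>primes_le X. Re (g p) / real p)"
    by (simp add: diff_divide_distrib sum_subtractf)
  moreover have "prime_kernel_const + 2 \<le> mertens_const"
    using zeta_const_nonneg by (simp add: mertens_const_def prime_zeta_const_def)
  ultimately show ?thesis using sum_inverse_primes[OF X] by linarith
qed



section \<open>Sets of primes of zero relative density\<close>

definition recip_sum :: "nat set \<Rightarrow> real \<Rightarrow> real \<Rightarrow> real" where
  "recip_sum P y X = (\<Sum>p | p \<in> P \<and> y < real p \<and> real p \<le> X. 1 / real p)"

lemma finite_real_le [simp]: "finite {p. p \<in> P \<and> y < real p \<and> real p \<le> X}"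
proof (rule finite_subset)
  show "{p. p \<in> P \<and> y < real p \<and> real p \<le> X} \<subseteq> {..nat \<lfloor>X\<rfloor>}" by (auto intro: le_nat_floor)
qed simp

lemma sum_two_over_primes:
  assumes "P \<subseteq> {p. prime p}"
  shows "(\<Sum>p | prime p \<and> y < real p \<and> real p \<le> X. if p \<in> P then 2 / real p else 0) = 2 * recip_sum P y X"
proof -
  have "(\<Sum>p | prime p \<and> y < real p \<and> real p \<le> X. if p \<in> P then 2 / real p else 0)
      = (\<Sum>p | p \<in> P \<and> y < real p \<and> real p \<le> X. 2 / real p)"
    using assms finite_real_le[of "{p. prime p}" y X] by (intro sum.mono_neutral_cong_right) auto
  thus ?thesis by (simp add: recip_sum_def sum_distrib_left)
qed

lemma sum_two_over_primes_le:
  assumes "P \<subseteq> {p. prime p}"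
  shows "(\<Sum>p\<in>primes_le X. if p \<in> P then 2 / real p else 0) = 2 * recip_sum P 0 X"
proof -
  have "primes_le X = {p. prime p \<and> 0 < real p \<and> real p \<le> X}" by (auto dest: prime_gt_0_nat)
  thus ?thesis using sum_two_over_primes[OF assms, of 0 X] by simp
qed

lemma recip_sum_split:
  assumes "y \<le> z" "z \<le> X"
  shows "recip_sum P y X = recip_sum P y z + recip_sum P z X"
proof -
  have "{p. p \<in> P \<and> y < real p \<and> real p \<le> X} = {p. p \<in> P \<and> y < real p \<and> real p \<le> z} \<union> {p. p \<in> P \<and> z < real p \<and> real p \<le> X}"
    using assms by auto
  thus ?thesis unfolding recip_sum_def by (simp add: sum.union_disjoint disjoint_iff)
qed

lemma recip_sum_nonneg: "recip_sum P y X \<ge> 0"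
  unfolding recip_sum_def by (intro sum_nonneg) auto

lemma recip_sum_mono_set: "P \<subseteq> Q \<Longrightarrow> recip_sum P y X \<le> recip_sum Q y X"
  unfolding recip_sum_def by (intro sum_mono2) auto

lemma recip_sum_mono: "X \<le> X' \<Longrightarrow> recip_sum P y X \<le> recip_sum P y X'"
  unfolding recip_sum_def by (intro sum_mono2) auto

lemma recip_sum_primes_0: "recip_sum {p. prime p} 0 X = (\<Sum>p\<in>primes_le X. 1 / real p)"
  unfolding recip_sum_def by (rule sum.cong) (auto intro: prime_gt_0_nat)

lemma recip_sum_primes_le:
  assumes "exp 2 \<le> y" "y \<le> X"
  shows "\<bar>recip_sum {p. prime p} y X - ln (ln X / ln y)\<bar> \<le> 2 * mertens_const"
proof -
  have y0: "0 \<le> y" using assms(1) exp_ge_zero[of 2] by linarith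
  have l: "ln y \<ge> 2" "ln X \<ge> 2" using assms by (auto intro: ln_ge_2)
  have "recip_sum {p. prime p} y X = (\<Sum>p\<in>primes_le X. 1 / real p) - (\<Sum>p\<in>primes_le y. 1 / real p)"
    using recip_sum_split[OF y0 assms(2), of "{p. prime p}"] by (simp add: recip_sum_primes_0)
  moreover have "ln (ln X / ln y) = ln (ln X) - ln (ln y)" using l by (simp add: ln_div)
  ultimately show ?thesis using sum_inverse_primes[of X] sum_inverse_primes[of y] assms by linarith
qed

text \<open>Partial summation applied to \<open>\<epsilon> * \<pi> N - A N\<close>, which is
  nonnegative from some point on. The weights 1 / n decrease, so only the boundary term at the lower
  end is lost, and it is at most \<open>\<epsilon>\<close> because
  \<open>\<pi> M \<le> real M\<close>.\<close>

lemma sparse_recip_sum: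
  assumes P: "P \<subseteq> {p. prime p}" and dens: "zero_relative_density P" and eps: "\<epsilon> > 0"
  shows "\<exists>y0\<ge>exp 2. \<forall>y\<ge>y0. \<forall>X\<ge>y. recip_sum P y X \<le> \<epsilon> * (recip_sum {p. prime p} y X + 1)"
proof -
  define A where "A N = real (card {p \<in> P. p \<le> N})" for N
  define \<pi> where "\<pi> N = real (card {p::nat. prime p \<and> p \<le> N})" for N
  have "(\<lambda>N. A N / \<pi> N) \<longlonglongrightarrow> 0"
    using dens by (simp add: zero_relative_density_def A_def \<pi>_def)
  hence "\<forall>\<^sub>F N in sequentially. A N / \<pi> N < \<epsilon>" using eps by (rule order_tendstoD)
  then obtain N0 where N0: "\<And>N. N \<ge> N0 \<Longrightarrow> A N / \<pi> N < \<epsilon>"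
    by (auto simp: eventually_at_top_linorder)
  have Ale: "A N \<le> \<epsilon> * \<pi> N" if "N \<ge> N0" "N \<ge> 2" for N
  proof -
    have "2 \<in> {p::nat. prime p \<and> p \<le> N}" using that by simp
    moreover have "finite {p::nat. prime p \<and> p \<le> N}" by simp
    ultimately have "card {p::nat. prime p \<and> p \<le> N} > 0" using card_gt_0_iff by blast
    hence "\<pi> N > 0" by (simp add: \<pi>_def)
    thus ?thesis using N0[OF that(1)] by (simp add: divide_less_eq)
  qed
  define D where "D N = \<epsilon> * \<pi> N - A N" for N
  define e where "e n = \<epsilon> * (if prime n then 1 else 0) - (if n \<in> P then 1 else 0)" for n :: nat
  have Dstep: "D (Suc N) - D N = e (Suc N)" for N
  proof -
    have "{p \<in> P. p \<le> Suc N} = (if Suc N \<in> P then insert (Suc N) {p \<in> P. p \<le> N} else {p \<in> P. p \<le> N})"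
      by (auto simp: le_Suc_eq)
    moreover have "{p. prime p \<and> p \<le> Suc N} = (if prime (Suc N) then insert (Suc N) {p. prime p \<and> p \<le> N} else {p. prime p \<and> p \<le> N})"
      by (auto simp: le_Suc_eq)
    ultimately show ?thesis by (simp add: D_def e_def A_def \<pi>_def algebra_simps)
  qed
  define N1 where "N1 = max N0 2"
  have D0: "D N \<ge> 0" if "N \<ge> N1" for N using Ale[of N] that by (simp add: D_def N1_def)
  have abel: "(\<Sum>n\<in>{M<..K}. e n / real n) \<ge> D K / real K - D M / real M"
    if "N1 \<le> M" "M \<le> K" for M K
    using that(2)
  proof (induction K rule: dec_induct)
    case (step K)
    have K: "K \<ge> 2" using that step by (simp add: N1_def)
    have "{M<..Suc K} = insert (Suc K) {M<..K}" using step by auto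
    hence "(\<Sum>n\<in>{M<..Suc K}. e n / real n) = e (Suc K) / real (Suc K) + (\<Sum>n\<in>{M<..K}. e n / real n)" by simp
    also have "\<dots> \<ge> (D (Suc K) - D K) / real (Suc K) + (D K / real K - D M / real M)"
      using step.IH by (simp add: Dstep)
    moreover have "D K / real (Suc K) \<le> D K / real K"
      using D0[of K] that step K by (intro divide_left_mono) auto
    ultimately show ?case by (simp add: diff_divide_distrib)
  qed simp
  define y0 where "y0 = max (exp 2) (real N1)"
  show ?thesis
  proof (intro exI[of _ y0] conjI allI impI)
    show "exp 2 \<le> y0" by (simp add: y0_def)
    fix y X assume y: "y0 \<le> y" and X: "y \<le> X"
    define M where "M = nat \<lfloor>y\<rfloor>"
    define K where "K = nat \<lfloor>X\<rfloor>"
    have yN: "real N1 \<le> y" using y by (simp add: y0_def)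
    have y0': "0 \<le> y" using yN by linarith
    have M: "N1 \<le> M" unfolding M_def by (rule le_nat_floor) (rule yN)
    have MK: "M \<le> K" unfolding M_def K_def using X by (intro nat_mono floor_mono)
    have iff: "y < real p \<and> real p \<le> X \<longleftrightarrow> p \<in> {M<..K}" for p
    proof -
      have "real p \<le> x \<longleftrightarrow> p \<le> nat \<lfloor>x\<rfloor>" if "x \<ge> 0" for x
        using that by (simp add: le_nat_iff le_floor_iff)
      from this[of X] this[of y] show ?thesis using y0' X by (auto simp: M_def K_def not_le[symmetric])
    qed
    have s1: "recip_sum P y X = (\<Sum>n\<in>{M<..K}. (if n \<in> P then 1 else 0) / real n)"
      unfolding recip_sum_def iff by (rule sum.mono_neutral_cong_left) auto
    have s2: "recip_sum {p. prime p} y X = (\<Sum>n\<in>{M<..K}. (if prime n then 1 else 0) / real n)"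
      unfolding recip_sum_def iff by (rule sum.mono_neutral_cong_left) auto
    have "\<epsilon> * recip_sum {p. prime p} y X - recip_sum P y X = (\<Sum>n\<in>{M<..K}. e n / real n)"
      by (simp add: s1 s2 e_def diff_divide_distrib sum_subtractf sum_distrib_left)
    also have "\<dots> \<ge> D K / real K - D M / real M" by (rule abel[OF M MK])
    moreover have "D K / real K \<ge> 0" using D0 M MK by simp
    moreover have "D M / real M \<le> \<epsilon>"
    proof -
      have "\<pi> M \<le> real M"
      proof -
        have "card {p::nat. prime p \<and> p \<le> M} \<le> card {1..M}"
          by (intro card_mono) (auto dest: prime_ge_1_nat)
        thus ?thesis by (simp add: \<pi>_def)
      qed
      hence "\<epsilon> * \<pi> M \<le> \<epsilon> * real M" using eps by (intro mult_left_mono) auto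
      hence "D M \<le> \<epsilon> * real M" by (simp add: D_def A_def)
      moreover have "M > 0" using M by (simp add: N1_def)
      ultimately show ?thesis by (simp add: divide_le_eq)
    qed
    ultimately show "recip_sum P y X \<le> \<epsilon> * (recip_sum {p. prime p} y X + 1)"
      by (simp add: algebra_simps)
  qed
qed

text \<open>For y = X^(1/k) the right-hand side is \<open>\<epsilon>\<close> (ln k + O(1)),
  independent of X; large heights need the bound in this form.\<close>

lemma sparse_recip_sum_ln:
  assumes P: "P \<subseteq> {p. prime p}" and dens: "zero_relative_density P" and eps: "\<epsilon> > 0"
  shows "\<exists>y0\<ge>exp 2. \<forall>y\<ge>y0. \<forall>X\<ge>y. recip_sum P y X \<le> \<epsilon> * (ln (ln X / ln y) + 2 * mertens_const + 1)"
proof -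
  obtain y0 where y0: "y0 \<ge> exp 2" "\<And>y X. y \<ge> y0 \<Longrightarrow> X \<ge> y \<Longrightarrow> recip_sum P y X \<le> \<epsilon> * (recip_sum {p. prime p} y X + 1)"
    using sparse_recip_sum[OF assms] by blast
  show ?thesis
  proof (intro exI[of _ y0] conjI allI impI y0(1))
    fix y X assume y: "y0 \<le> y" "y \<le> X"
    have "recip_sum P y X \<le> \<epsilon> * (recip_sum {p. prime p} y X + 1)" using y0(2) y by blast
    also have "\<dots> \<le> \<epsilon> * (ln (ln X / ln y) + 2 * mertens_const + 1)"
      using recip_sum_primes_le[of y X] y y0(1) eps by (intro mult_left_mono) auto
    finally show "recip_sum P y X \<le> \<epsilon> * (ln (ln X / ln y) + 2 * mertens_const + 1)" .
  qed
qed

lemma eventually_ln_ln_ge: "\<forall>\<^sub>F X in at_top. K \<le> ln (ln (X::real))"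
proof -
  have "filterlim (\<lambda>X::real. ln (ln X)) at_top at_top"
    by (rule filterlim_compose[OF ln_at_top ln_at_top])
  thus ?thesis by (simp add: filterlim_at_top)
qed

text \<open>The threshold \<open>y0\<close> is fixed, so the primes below it contribute a constant,
  which half of \<open>\<epsilon>\<close> absorbs as ln ln X grows.\<close>

lemma sparse_recip_sum_small:
  assumes P: "P \<subseteq> {p. prime p}" and dens: "zero_relative_density P" and eps: "\<epsilon> > 0"
  shows "\<forall>\<^sub>F X in at_top. recip_sum P 0 X \<le> \<epsilon> * ln (ln X)"
proof -
  obtain y0 where y0: "y0 \<ge> exp 2" "\<And>y X. y \<ge> y0 \<Longrightarrow> X \<ge> y \<Longrightarrow> recip_sum P y X \<le> \<epsilon> / 2 * (ln (ln X / ln y) + 2 * mertens_const + 1)"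
    using sparse_recip_sum_ln[OF P dens, of "\<epsilon> / 2"] eps by auto
  define B where "B = recip_sum P 0 y0 + \<epsilon> / 2 * (2 * mertens_const + 1)"
  have ly: "ln y0 \<ge> 2" using y0(1) by (rule ln_ge_2)
  have y00: "y0 \<ge> 0" using y0(1) exp_ge_zero[of 2] by linarith
  have "\<forall>\<^sub>F X in at_top. 2 * B / \<epsilon> \<le> ln (ln X)" by (rule eventually_ln_ln_ge)
  thus ?thesis using eventually_ge_at_top[of y0]
  proof eventually_elim
    case (elim X)
    have lX: "ln X \<ge> 2" using elim y0(1) by (intro ln_ge_2) linarith
    have "recip_sum P 0 X \<le> recip_sum P 0 y0 + \<epsilon> / 2 * (ln (ln X / ln y0) + 2 * mertens_const + 1)"
      using recip_sum_split[OF y00 elim(2), of P] y0(2)[of y0 X] elim by simp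
    also have "ln (ln X / ln y0) \<le> ln (ln X)"
    proof -
      have "ln X / ln y0 \<le> ln X / 1" using ly lX by (intro divide_left_mono) auto
      thus ?thesis using ly lX by (intro ln_mono) auto
    qed
    also have "recip_sum P 0 y0 + \<epsilon> / 2 * (ln (ln X) + 2 * mertens_const + 1) = B + \<epsilon> / 2 * ln (ln X)"
      by (simp add: B_def algebra_simps)
    also have "B \<le> \<epsilon> / 2 * ln (ln X)" using elim(1) eps by (simp add: field_simps)
    finally show ?case using eps by (simp add: mult_left_mono)
  qed
qed

lemma recip_sum_at_top:
  assumes "filterlim (\<lambda>N::nat. \<Sum>p\<in>{p \<in> P. p \<le> N}. 1 / real p) at_top sequentially"
    and P: "P \<subseteq> {p. prime p}"
  shows "\<exists>X0. \<forall>X\<ge>X0. recip_sum P 0 X \<ge> K"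
proof -
  have "\<forall>\<^sub>F N in sequentially. K \<le> (\<Sum>p\<in>{p \<in> P. p \<le> N}. 1 / real p)"
    using assms(1) by (simp add: filterlim_at_top)
  then obtain N where N: "K \<le> (\<Sum>p\<in>{p \<in> P. p \<le> N}. 1 / real p)"
    by (auto simp: eventually_at_top_linorder)
  have "(\<Sum>p\<in>{p \<in> P. p \<le> N}. 1 / real p) = recip_sum P 0 (real N)"
    unfolding recip_sum_def using P by (intro sum.cong) (auto intro: prime_gt_0_nat)
  hence "\<forall>X\<ge>real N. recip_sum P 0 X \<ge> K" using N recip_sum_mono[of "real N"] order_trans by metis
  thus ?thesis by blast
qed



section \<open>Growth of zeta near the line of abscissa 1\<close>

lemma norm_sum_decreasing_weights:
  fixes a :: "nat \<Rightarrow> real" and z :: "nat \<Rightarrow> complex"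
  assumes S: "\<And>m. m \<le> L \<Longrightarrow> norm (\<Sum>n<m. z n) \<le> B"
    and a: "\<And>n. a (Suc n) \<le> a n" "\<And>n. a n \<ge> 0"
  shows "norm (\<Sum>n<L. of_real (a n) * z n) \<le> B * a 0"
proof -
  have B: "B \<ge> 0" using S[of 0] by simp
  have key: "m \<le> L \<Longrightarrow> norm ((\<Sum>n<m. of_real (a n) * z n) - of_real (a m) * (\<Sum>n<m. z n)) \<le> B * (a 0 - a m)" for m
  proof (induction m)
    case (Suc m)
    have "(\<Sum>n<Suc m. of_real (a n) * z n) - of_real (a (Suc m)) * (\<Sum>n<Suc m. z n)
       = ((\<Sum>n<m. of_real (a n) * z n) - of_real (a m) * (\<Sum>n<m. z n)) + of_real (a m - a (Suc m)) * (\<Sum>n<Suc m. z n)"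
      by (simp add: algebra_simps)
    also have "norm \<dots> \<le> B * (a 0 - a m) + (a m - a (Suc m)) * B"
    proof (rule norm_triangle_mono)
      show "norm ((\<Sum>n<m. of_real (a n) * z n) - of_real (a m) * (\<Sum>n<m. z n)) \<le> B * (a 0 - a m)"
        using Suc by simp
      show "norm (of_real (a m - a (Suc m)) * (\<Sum>n<Suc m. z n)) \<le> (a m - a (Suc m)) * B"
        using a(1)[of m] S[OF Suc.prems] unfolding norm_mult norm_of_real by (intro mult_mono) auto
    qed
    finally show ?case by (simp add: algebra_simps)
  qed simp
  have "norm (\<Sum>n<L. of_real (a n) * z n) \<le> norm ((\<Sum>n<L. of_real (a n) * z n) - of_real (a L) * (\<Sum>n<L. z n))
      + norm (of_real (a L) * (\<Sum>n<L. z n))"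
    using norm_triangle_ineq[of "(\<Sum>n<L. of_real (a n) * z n) - of_real (a L) * (\<Sum>n<L. z n)" "of_real (a L) * (\<Sum>n<L. z n)"] by simp
  also have "norm (of_real (a L) * (\<Sum>n<L. z n)) \<le> a L * B"
    using a(2)[of L] S[of L] by (simp add: norm_mult mult_left_mono)
  finally show ?thesis using key[of L] by (simp add: algebra_simps)
qed

text \<open>Zeta is summed over dyadic blocks up to about |Im s|^2. In a block starting at N with
  |Im s| \<le> N^k the exponential sums save N^c, which covers the loss N^r caused by Re s \<ge> 1 -
  r. An earlier block is bounded trivially by N^r \<le> |Im s|^(r/k). The number of blocks gives the
  logarithm.\<close>

lemma zeta_growth:
  assumes k: "k \<ge> (1::nat)"
  shows "\<exists>r C. 0 < r \<and> r \<le> 1 / 4 \<and> 1 \<le> C \<and> (\<forall>s. 1 - r \<le> Re s \<longrightarrow> Re s \<le> 4 \<longrightarrow> \<bar>Im s\<bar> \<ge> 1 \<longrightarrow>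
     norm (zeta_cont s) \<le> C * (1 + ln \<bar>Im s\<bar>) * \<bar>Im s\<bar> powr (r / k))"
proof -
  obtain c C where c: "0 < c" "c \<le> 1" "0 \<le> C" and est: "\<And>(N::nat) L t. 1 \<le> N \<Longrightarrow> L \<le> N \<Longrightarrow>
     \<bar>t\<bar> \<le> real N ^ k \<Longrightarrow> real N \<le> t\<^sup>2 \<Longrightarrow>
     norm (\<Sum>n<L. cis (t * ln (real (N + n)))) \<le> C * real N powr (1 - c)"
    using zeta_sum_bound[of k] by blast
  \<comment> \<open>\<open>r \<le> c\<close> lets the saving cover the width of the strip;
    \<open>r \<le> 1 / 4\<close> keeps Re s at least 3/4 for the remainder terms.\<close>
  define r where "r = min c (1 / 4)"
  have r: "0 < r" "r \<le> 1 / 4" "r \<le> c" using c by (auto simp: r_def)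
  define K where "K = powr_const"
  have K: "K \<ge> 0" by (simp add: K_def powr_const_nonneg)
  define C' where "C' = 4 * (1 + C) + 1 + 10 * K"
  show ?thesis
  proof (rule exI[of _ r], rule exI[of _ C'], intro conjI allI impI r(1,2))
    show "1 \<le> C'" using c K by (simp add: C'_def)
    fix s assume s: "1 - r \<le> Re s" "Re s \<le> 4" "\<bar>Im s\<bar> \<ge> 1"
    define \<sigma> where "\<sigma> = Re s"
    define t where "t = Im s"
    define \<tau> where "\<tau> = \<bar>t\<bar>"
    have tau: "\<tau> \<ge> 1" using s by (simp add: \<tau>_def t_def)
    have st: "s = Complex \<sigma> t" by (simp add: \<sigma>_def t_def)
    have \<sigma>: "1 - r \<le> \<sigma>" "\<sigma> \<le> 4" "3 / 4 \<le> \<sigma>" using s r by (auto simp: \<sigma>_def)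
    have s1: "s \<noteq> 1" using s by auto
    have s4: "Re s \<ge> 1 / 4" using \<sigma> by (simp add: \<sigma>_def)
    define Y where "Y = \<tau> powr (r / k)"
    have Y1: "Y \<ge> 1" using tau r by (simp add: Y_def ge_one_powr_ge_zero)
    \<comment> \<open>The blocks end at 2^J, which lies between \<open>\<tau>\<^sup>2 / 2\<close>
      and \<open>\<tau>\<^sup>2\<close>: low enough for the exponential sums, high enough for the
      tail.\<close>
    define J where "J = nat \<lfloor>log 2 (\<tau>\<^sup>2)\<rfloor>"
    have tau2: "\<tau>\<^sup>2 \<ge> 1" using tau by simp
    have tau20: "\<tau>\<^sup>2 > 0" using tau2 by linarith
    have lg: "log 2 (\<tau>\<^sup>2) \<ge> 0" using tau2 by (intro zero_le_log_cancel_iff[THEN iffD2]) linarith+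
    have J1: "real J \<le> log 2 (\<tau>\<^sup>2)" using lg by (simp add: J_def)
    have J2: "log 2 (\<tau>\<^sup>2) < real J + 1" unfolding J_def using lg by linarith
    have MJ: "2 ^ J \<le> \<tau>\<^sup>2"
    proof -
      have "2 powr real J \<le> 2 powr log 2 (\<tau>\<^sup>2)" using J1 by (intro powr_mono) auto
      thus ?thesis using tau20 by (simp add: powr_realpow)
    qed
    have MJ2: "\<tau>\<^sup>2 \<le> 2 * 2 ^ J"
    proof -
      have "2 powr log 2 (\<tau>\<^sup>2) \<le> 2 powr (real J + 1)" using J2 by (intro powr_mono) auto
      thus ?thesis using tau20 by (simp add: powr_add powr_realpow)
    qed
    have Jln: "real J \<le> 4 * ln \<tau>"
    proof -
      have ln2: "ln 2 \<ge> (1 / 2 :: real)"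
        using ln_add_one_self_le_self2[of "-1/2"] by (simp add: ln_div)
      have "real J \<le> 2 * (ln \<tau> / ln 2)" using J1 tau by (simp add: log_def ln_realpow)
      also have "\<dots> \<le> 2 * (ln \<tau> / (1 / 2))" using ln2 tau by (intro mult_left_mono divide_left_mono) auto
      finally show ?thesis by simp
    qed
    have block: "norm (\<Sum>n<2^j. of_nat (2^j + n) powr (- s)) \<le> (1 + C) * Y" if j: "j < J" for j
    proof -
      define N where "N = (2::nat) ^ j"
      have N1: "N \<ge> 1" by (simp add: N_def)
      have NJ: "real N \<le> 2 ^ J" using j by (simp add: N_def power_increasing)
      have Nt: "real N \<le> t\<^sup>2" using order_trans[OF NJ MJ] by (simp add: \<tau>_def)
      have eq: "of_nat (N + n) powr (- s) = of_real (real (N + n) powr (- \<sigma>)) * cis (- t * ln (real (N + n)))" for n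
      proof -
        have "- s = Complex (- \<sigma>) (- t)" by (simp add: st complex_eq_iff)
        thus ?thesis using nat_powr_complex[of "N + n" "- \<sigma>" "- t"] N1 by (simp only:)
      qed
      have rr: "real N powr (- \<sigma>) * real N powr (1 - d) \<le> real N powr (r - d)" for d
        unfolding powr_add[symmetric] using N1 \<sigma> by (intro powr_mono) auto
      have dec: "norm (\<Sum>n<N. of_nat (N + n) powr (- s)) \<le> B * real (N + 0) powr (- \<sigma>)"
        if "\<And>m. m \<le> N \<Longrightarrow> norm (\<Sum>n<m. cis (- t * ln (real (N + n)))) \<le> B" for B
        unfolding eq using N1 \<sigma> by (intro norm_sum_decreasing_weights that) (auto intro!: powr_mono2')
      have "norm (\<Sum>n<N. of_nat (N + n) powr (- s)) \<le> (1 + C) * Y"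
      proof (cases "\<tau> \<le> real N ^ k")
        case True
        have "norm (\<Sum>n<N. of_nat (N + n) powr (- s)) \<le> (C * real N powr (1 - c)) * real (N + 0) powr (- \<sigma>)"
          using True N1 Nt by (intro dec est) (auto simp: \<tau>_def)
        also have "\<dots> = C * (real N powr (- \<sigma>) * real N powr (1 - c))" by simp
        also have "\<dots> \<le> C * real N powr (r - c)" using c by (intro mult_left_mono rr) auto
        also have "real N powr (r - c) \<le> real N powr 0" using N1 r by (intro powr_mono) auto
        hence "C * real N powr (r - c) \<le> C * 1" using N1 c by (intro mult_left_mono) auto
        also have "\<dots> \<le> (1 + C) * Y" using c Y1 by (intro mult_mono) auto
        finally show ?thesis by simp
      next
        case False
        have "norm (\<Sum>n<m. cis (- t * ln (real (N + n)))) \<le> real N" if "m \<le> N" for m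
          using sum_norm_le[of "{..<m}" "\<lambda>n. cis (- t * ln (real (N + n)))" "\<lambda>_. 1"] that by simp
        hence "norm (\<Sum>n<N. of_nat (N + n) powr (- s)) \<le> real N * real (N + 0) powr (- \<sigma>)" by (rule dec)
        also have "\<dots> = real N powr (- \<sigma>) * real N powr (1 - 0)" using N1 by simp
        also have "\<dots> \<le> real N powr (r - 0)" by (rule rr)
        also have "\<dots> = (real N ^ k) powr (r / k)"
          using N1 k by (simp add: powr_realpow[symmetric] powr_powr)
        also have "\<dots> \<le> Y" unfolding Y_def using False r by (intro powr_mono2) auto
        also have "\<dots> \<le> (1 + C) * Y" using c Y1 by simp
        finally show ?thesis .
      qed
      thus ?thesis by (simp add: N_def)
    qed
    have dyadic: "(\<Sum>n=1..2^i - 1. of_nat n powr (- s)) = (\<Sum>j<i. \<Sum>n<2^j. of_nat (2^j + n) powr (- s))" for i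
    proof (induction i)
      case (Suc i)
      have "{1..2^Suc i - 1} = {1..2^i - 1} \<union> {2^i..<2^i + 2^i::nat}" by auto
      hence "(\<Sum>n=1..2^Suc i - 1. of_nat n powr (- s)) = (\<Sum>n=1..2^i - 1. of_nat n powr (- s)) + (\<Sum>n=2^i..<2^i + 2^i. of_nat n powr (- s))"
        by (simp only:) (rule sum.union_disjoint; force)
      also have "(\<Sum>n=2^i..<2^i + 2^i. of_nat n powr (- s)) = (\<Sum>n<2^i. of_nat (2^i + n) powr (- s))"
        by (rule sum.reindex_bij_witness[of _ "\<lambda>n. 2^i + n" "\<lambda>n. n - 2^i"]) auto
      finally show ?case using Suc by simp
    qed simp
    define M where "M = (2::nat) ^ J - 1"
    have SM: "Suc M = 2 ^ J" by (simp add: M_def)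
    have SMr: "real (Suc M) = 2 ^ J" by (simp add: SM)
    have "norm (zeta_cont s) \<le> norm (\<Sum>n=1..M. of_nat n powr (- s)) + norm (of_nat (Suc M) powr (1 - s) / (s - 1))
           + norm (\<Sum>n. zeta_term (Suc n + M) s)"
      unfolding zeta_cont_partial[OF s4 s1, of M]
      by (intro norm_triangle_le add_right_mono norm_triangle_ineq)
    also have "norm (\<Sum>n=1..M. of_nat n powr (- s)) \<le> (\<Sum>j<J. (1 + C) * Y)"
      unfolding M_def dyadic by (intro sum_norm_le block) auto
    also have "(\<Sum>j<J. (1 + C) * Y) = real J * ((1 + C) * Y)" by simp
    also have "\<dots> \<le> (4 * ln \<tau>) * ((1 + C) * Y)" using Jln c Y1 by (intro mult_right_mono) auto
    also have "norm (of_nat (Suc M) powr (1 - s) / (s - 1)) \<le> 1"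
    proof -
      have "norm (of_nat (Suc M) powr (1 - s)) = real (Suc M) powr (1 - \<sigma>)"
        using norm_nat_powr[of "Suc M" "1 - s"] by (simp add: \<sigma>_def)
      also have "\<dots> \<le> real (Suc M) powr (1 / 2)" using \<sigma> by (intro powr_mono) auto
      also have "\<dots> \<le> (\<tau>\<^sup>2) powr (1 / 2)" unfolding SMr using MJ by (intro powr_mono2) auto
      also have "\<dots> = \<tau>" using tau by (simp add: powr_half_sqrt)
      also have "\<dots> \<le> norm (s - 1)" using abs_Im_le_cmod[of "s - 1"] by (simp add: \<tau>_def t_def)
      finally show ?thesis using s1 by (simp add: norm_divide divide_le_eq)
    qed
    \<comment> \<open>Here |s| is at most 5 \<open>\<tau>\<close>, and the decay in \<open>M\<close>
      gives at most 2 / \<open>\<tau>\<close>, because 1/4 - Re s \<le> -1/2.\<close>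
    also have "norm (\<Sum>n. zeta_term (Suc n + M) s) \<le> 10 * K"
    proof -
      have "norm (\<Sum>n. zeta_term (Suc n + M) s) \<le> norm s * real (Suc M) powr (1 / 4 - Re s) * K"
        unfolding K_def by (rule zeta_term_tail(2)[OF s4 s1])
      also have "norm s * real (Suc M) powr (1 / 4 - Re s) \<le> (5 * \<tau>) * (2 / \<tau>)"
      proof (rule mult_mono)
        have "norm s \<le> \<bar>Re s\<bar> + \<bar>Im s\<bar>" by (rule cmod_le)
        also have "\<dots> \<le> 4 * 1 + \<tau>" using \<sigma> by (simp add: \<sigma>_def \<tau>_def t_def)
        also have "\<dots> \<le> 4 * \<tau> + \<tau>" using tau by simp
        finally show "norm s \<le> 5 * \<tau>" by simp
        have "real (Suc M) powr (1 / 4 - Re s) \<le> real (Suc M) powr (- (1 / 2))"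
          using \<sigma> unfolding SMr by (intro powr_mono) (auto simp: \<sigma>_def)
        also have "\<dots> = 1 / sqrt (2 ^ J)" unfolding SMr by (simp add: powr_minus_divide powr_half_sqrt)
        also have "\<dots> \<le> 1 / (\<tau> / 2)"
        proof (rule divide_left_mono)
          have "\<tau>\<^sup>2 \<le> 4 * 2 ^ J" using MJ2 by (rule order_trans) simp
          hence "\<tau> / 2 \<le> sqrt (2 ^ J)" by (intro real_le_rsqrt) (simp add: power_divide)
          thus "\<tau> / 2 \<le> sqrt (2 ^ J)" .
        qed (use tau in auto)
        finally show "real (Suc M) powr (1 / 4 - Re s) \<le> 2 / \<tau>" by simp
      qed (use tau in auto)
      also have "(5 * \<tau>) * (2 / \<tau>) = 10" using tau by simp
      finally show ?thesis using K by (simp add: mult_right_mono)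
    qed
    finally have "norm (zeta_cont s) \<le> 4 * ln \<tau> * ((1 + C) * Y) + 1 + 10 * K" by simp
    also have "\<dots> \<le> C' * (1 + ln \<tau>) * Y"
    proof -
      have lt: "ln \<tau> \<ge> 0" using tau by simp
      have "1 + 10 * K \<le> (1 + 10 * K) * ((1 + ln \<tau>) * Y)"
        using K lt Y1 mult_mono[of 1 "1 + ln \<tau>" 1 Y] by (intro mult_le_cancel_left1[THEN iffD2]) auto
      moreover have "4 * ln \<tau> * ((1 + C) * Y) \<le> 4 * (1 + ln \<tau>) * ((1 + C) * Y)"
        using c Y1 by (intro mult_right_mono) auto
      ultimately show ?thesis by (simp add: C'_def algebra_simps)
    qed
    finally show "norm (zeta_cont s) \<le> C' * (1 + ln \<bar>Im s\<bar>) * \<bar>Im s\<bar> powr (r / k)"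
      by (simp add: Y_def \<tau>_def t_def)
  qed
qed



section \<open>Cosine sums over primes\<close>

lemma zeta_cont_nonzero:
  assumes "Re s > 1"
  shows "zeta_cont s \<noteq> 0"
proof -
  have "completely_mult (\<lambda>n. cis (- Im s * ln (real n)))" by (rule completely_mult_cis)
  from ln_norm_dirichlet_sum(1)[OF this assms] show ?thesis
    using zeta_cont_eq_dirichlet_sum[OF assms, of "Im s"] by simp
qed

lemma ln_norm_zeta_cont:
  assumes "\<sigma> > 1"
  shows "\<bar>ln (norm (zeta_cont (Complex \<sigma> t))) - prime_suminf (\<lambda>p. cos (t * ln (real p)) * real p powr (- \<sigma>))\<bar> \<le> 2"
  using ln_norm_dirichlet_sum(2)[OF completely_mult_cis[of "- t"] assms] zeta_cont_eq_dirichlet_sum[OF assms, of t]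
  by simp

text \<open>The cosine is at least -1, so zeta is no smaller than the reciprocal of its value at the
  real point, up to a constant. At distance about 1 / ln X from abscissa 1 this loses only ln ln
  X.\<close>

lemma ln_norm_zeta_cont_ge:
  assumes \<sigma>: "1 < \<sigma>" "\<sigma> \<le> 2"
  shows "ln (norm (zeta_cont (Complex \<sigma> t))) \<ge> - ln (1 / (\<sigma> - 1)) - prime_zeta_const - 2"
proof -
  have sm1: "summable (\<lambda>n. if prime n then cos (t * ln (real n)) * real n powr (- \<sigma>) else 0)"
    by (rule summable_prime_powr) (use \<sigma> in auto)
  have sm2: "summable (\<lambda>n. if prime n then real n powr (- \<sigma>) else 0)"
    using summable_prime_powr[of "\<lambda>_. 1" \<sigma>, unfolded mult_1] \<sigma> by simp
  have "- prime_suminf (\<lambda>p. real p powr (- \<sigma>)) = (\<Sum>n. - (if prime n then real n powr (- \<sigma>) else 0))"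
    unfolding prime_suminf_def by (rule suminf_minus[OF sm2, symmetric])
  also have "\<dots> \<le> prime_suminf (\<lambda>p. cos (t * ln (real p)) * real p powr (- \<sigma>))"
    unfolding prime_suminf_def
  proof (rule suminf_le[OF _ summable_minus[OF sm2] sm1])
    fix n
    have "(-1) * real n powr (- \<sigma>) \<le> cos (t * ln (real n)) * real n powr (- \<sigma>)"
      by (intro mult_right_mono) auto
    thus "- (if prime n then real n powr (- \<sigma>) else 0) \<le> (if prime n then cos (t * ln (real n)) * real n powr (- \<sigma>) else 0)"
      by simp
  qed
  finally show ?thesis using ln_norm_zeta_cont[OF \<sigma>(1), of t] prime_zeta_bounds[OF \<sigma>] by linarith
qed

text \<open>The half-plane Re s > 1 is convex and free of zeros, so zeta has a holomorphic logarithm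
  there; the mean value theorem is applied to its real part along a horizontal segment.\<close>

lemma ln_norm_zeta_cont_mean_value:
  assumes "1 < \<sigma>1" "\<sigma>1 < \<sigma>2"
  shows "\<exists>\<xi>. \<sigma>1 < \<xi> \<and> \<xi> < \<sigma>2 \<and> ln (norm (zeta_cont (Complex \<sigma>2 t))) - ln (norm (zeta_cont (Complex \<sigma>1 t)))
    = (\<sigma>2 - \<sigma>1) * Re (deriv zeta_cont (Complex \<xi> t) / zeta_cont (Complex \<xi> t))"
proof -
  define S where "S = {s. Re s > 1}"
  have S: "convex S" "open S" "2 \<in> S"
    unfolding S_def by (auto simp: convex_halfspace_Re_gt open_halfspace_Re_gt)
  have hol: "zeta_cont holomorphic_on S"
    by (rule holomorphic_on_subset[OF holomorphic_zeta_cont]) (auto simp: S_def)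
  have nz: "zeta_cont s \<noteq> 0" if "s \<in> S" for s using that zeta_cont_nonzero by (simp add: S_def)
  obtain l where l: "l holomorphic_on S" and exl: "\<And>x. x \<in> S \<Longrightarrow> exp (l x) = zeta_cont x"
    using holomorphic_logarithm_exists[OF S(1,2) hol nz S(3)] by metis
  have Rel: "Re (l s) = ln (norm (zeta_cont s))" if "s \<in> S" for s
    using exl[OF that] by (metis ln_exp norm_exp_eq_Re)
  have inS: "Complex \<sigma> t \<in> S" if "\<sigma> \<ge> \<sigma>1" for \<sigma> using that assms by (simp add: S_def)
  have dl: "deriv l s = deriv zeta_cont s / zeta_cont s" if "s \<in> S" for s
    by (rule deriv_holomorphic_log[OF S(2) l _ that]) (rule exl)
  define \<phi> where "\<phi> \<sigma> = Re (l (Complex \<sigma> t))" for \<sigma>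
  have "\<exists>\<xi>>\<sigma>1. \<xi> < \<sigma>2 \<and> \<phi> \<sigma>2 - \<phi> \<sigma>1 = (\<sigma>2 - \<sigma>1) * Re (deriv l (Complex \<xi> t))"
  proof (rule MVT2[OF assms(2)])
    fix \<sigma> assume \<sigma>: "\<sigma>1 \<le> \<sigma>" "\<sigma> \<le> \<sigma>2"
    have "(l has_field_derivative deriv l (Complex \<sigma> t)) (at (Complex \<sigma> t))"
      by (rule holomorphic_derivI[OF l S(2) inS[OF \<sigma>(1)]])
    hence "((\<lambda>z. l (z + \<i> * of_real t)) has_field_derivative deriv l (Complex \<sigma> t)) (at (of_real \<sigma>))"
      by (simp add: DERIV_shift Complex_eq)
    hence "((\<lambda>x. l (of_real x + \<i> * of_real t)) has_vector_derivative deriv l (Complex \<sigma> t)) (at \<sigma>)"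
      by (rule has_vector_derivative_real_field)
    from bounded_linear.has_vector_derivative[OF bounded_linear_Re this]
    show "(\<phi> has_real_derivative Re (deriv l (Complex \<sigma> t))) (at \<sigma>)"
      unfolding \<phi>_def has_real_derivative_iff_has_vector_derivative by (simp add: Complex_eq)
  qed
  then obtain \<xi> where "\<sigma>1 < \<xi>" "\<xi> < \<sigma>2" "\<phi> \<sigma>2 - \<phi> \<sigma>1 = (\<sigma>2 - \<sigma>1) * Re (deriv l (Complex \<xi> t))" by blast
  thus ?thesis using dl[OF inS[of \<xi>]] Rel[OF inS[of \<sigma>1]] Rel[OF inS[of \<sigma>2]] assms
    by (intro exI[of _ \<xi>]) (simp add: \<phi>_def)
qed

text \<open>Comparing the kernel at X and at X^(1/k) turns the sum into the increment of log |zeta|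
  between abscissas 1 + k / ln X and 1 + 1 / ln X. Minus the real part of the logarithmic derivative
  is at most 24 ln X / k + O(ln ln X), and the segment is shorter than k / ln X, so \<open>k\<close>
  cancels.\<close>

lemma prime_cos_sum_le:
  assumes k: "k \<ge> (2::nat)"
  shows "\<forall>\<^sub>F X in at_top. \<forall>t. 2 \<le> \<bar>t\<bar> \<longrightarrow> \<bar>t\<bar> \<le> X\<^sup>2 \<longrightarrow>
    (\<Sum>p | prime p \<and> X powr (1 / k) < real p \<and> real p \<le> X. cos (t * ln (real p)) / real p) \<le> 2 * mertens_const + 29"
proof -
  obtain r C where r: "0 < r" "r \<le> 1 / 4" and C: "1 \<le> C" and growth:
    "\<And>s. 1 - r \<le> Re s \<Longrightarrow> Re s \<le> 4 \<Longrightarrow> \<bar>Im s\<bar> \<ge> 1 \<Longrightarrow>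
       norm (zeta_cont s) \<le> C * (1 + ln \<bar>Im s\<bar>) * \<bar>Im s\<bar> powr (r / k)"
    using zeta_growth[of k] k by auto
  define D where "D = ln (2 * C) + prime_zeta_const + 2"
  \<comment> \<open>Everything in the derivative bound except the power of |t|, times the length of
    the segment, tends to 0.\<close>
  have "((\<lambda>X. (8 * real k / (r * ln X)) * (D + ln (1 + 3 * ln X) + ln (ln X))) \<longlongrightarrow> 0) at_top"
    using r by real_asymp
  hence ev1: "\<forall>\<^sub>F X in at_top. (8 * real k / (r * ln X)) * (D + ln (1 + 3 * ln X) + ln (ln X)) < 1"
    by (rule order_tendstoD) simp
  show ?thesis using ev1 eventually_ge_at_top[of "exp (2 * real k)"]
  proof eventually_elim
    case (elim X)
    have k0: "real k \<ge> 2" using k by simp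
    have "exp 2 \<le> exp (2 * real k)" using k0 by simp
    hence X2: "exp 2 \<le> X" using elim(2) by linarith
    have X0: "X > 0" using X2 exp_gt_zero[of 2] by linarith
    define L where "L = ln X"
    have L2k: "L \<ge> 2 * real k" using elim(2) X0 ln_mono[of "exp (2 * real k)" X] by (simp add: L_def)
    have L2: "L \<ge> 2" using L2k k0 by linarith
    have X2': "X \<ge> 2" using X2 exp_ge_add_one_self[of 2] by linarith
    define z where "z = X powr (1 / k)"
    have lnz: "ln z = L / k" using X0 by (simp add: z_def L_def ln_powr)
    have z0: "z > 0" using X0 by (simp add: z_def)
    have zexp: "exp 2 \<le> z"
    proof -
      have "2 \<le> ln z" unfolding lnz using L2k k0 by (simp add: field_simps)
      hence "exp 2 \<le> exp (ln z)" by simp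
      thus ?thesis using z0 by simp
    qed
    have zX: "z \<le> X"
    proof -
      have "z \<le> X powr 1" unfolding z_def using X2' k0 by (intro powr_mono) auto
      thus ?thesis using X0 by simp
    qed
    define \<sigma>1 where "\<sigma>1 = 1 + 1 / ln X"
    define \<sigma>2 where "\<sigma>2 = 1 + 1 / ln z"
    have s2: "\<sigma>2 = 1 + k / L" using k0 by (simp add: \<sigma>2_def lnz)
    have \<sigma>: "1 < \<sigma>1" "\<sigma>1 < \<sigma>2" "\<sigma>2 \<le> 2"
      using L2 L2k k0 by (auto simp: \<sigma>1_def s2 L_def[symmetric] divide_strict_right_mono)
    show ?case
    proof (intro allI impI)
      fix t assume t: "2 \<le> \<bar>t\<bar>" "\<bar>t\<bar> \<le> X\<^sup>2"
      define c where "c p = cos (t * ln (real p))" for p :: nat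
      define Pc where "Pc \<sigma> = prime_suminf (\<lambda>p. c p * real p powr (- \<sigma>))" for \<sigma>
      have kern: "\<bar>(\<Sum>p\<in>primes_le X. c p / real p) - Pc \<sigma>1\<bar> \<le> prime_kernel_const"
        unfolding Pc_def \<sigma>1_def by (rule prime_kernel(1)[OF X2]) (simp add: c_def)
      have kernz: "\<bar>(\<Sum>p\<in>primes_le z. c p / real p) - Pc \<sigma>2\<bar> \<le> prime_kernel_const"
        unfolding Pc_def \<sigma>2_def by (rule prime_kernel(1)[OF zexp]) (simp add: c_def)
      have split: "(\<Sum>p\<in>primes_le X. c p / real p) = (\<Sum>p\<in>primes_le z. c p / real p)
          + (\<Sum>p | prime p \<and> z < real p \<and> real p \<le> X. c p / real p)"
        by (rule sum_primes_le_split[OF zX])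
      have e1: "\<bar>ln (norm (zeta_cont (Complex \<sigma>1 t))) - Pc \<sigma>1\<bar> \<le> 2"
        unfolding Pc_def c_def by (rule ln_norm_zeta_cont) (use \<sigma> in auto)
      have e2: "\<bar>ln (norm (zeta_cont (Complex \<sigma>2 t))) - Pc \<sigma>2\<bar> \<le> 2"
        unfolding Pc_def c_def by (rule ln_norm_zeta_cont) (use \<sigma> in auto)
      obtain \<xi> where xi: "\<sigma>1 < \<xi>" "\<xi> < \<sigma>2" and mv: "ln (norm (zeta_cont (Complex \<sigma>2 t))) - ln (norm (zeta_cont (Complex \<sigma>1 t)))
          = (\<sigma>2 - \<sigma>1) * Re (deriv zeta_cont (Complex \<xi> t) / zeta_cont (Complex \<xi> t))"
        using ln_norm_zeta_cont_mean_value[OF \<sigma>(1,2), of t] by blast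
      define w where "w = Complex \<xi> t"
      \<comment> \<open>The discs reach heights up to X^3. The exponent 3 r / k, times the factor 8
        / r of the derivative bound, becomes 24 / k.\<close>
      define B where "B = C * (1 + 3 * L) * X powr (3 * (r / k))"
      have B0: "B > 0" using C L2 X0 by (simp add: B_def)
      have deriv_ge: "Re (deriv zeta_cont w / zeta_cont w) \<ge> - (4 / (r / 2) * (ln (2 * B) - ln (norm (zeta_cont w))))"
      proof (rule Re_log_deriv_ge[OF _ _ _ B0])
        \<comment> \<open>|t| \<ge> 2 keeps the disc away from the pole.\<close>
        have inb: "1 - r \<le> Re s \<and> Re s \<le> 4 \<and> 1 \<le> \<bar>Im s\<bar> \<and> \<bar>Im s\<bar> \<le> X ^ 3" if s: "norm (s - w) \<le> r" for s
        proof -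
          have "\<bar>Re (s - w)\<bar> \<le> r" "\<bar>Im (s - w)\<bar> \<le> r"
            using s abs_Re_le_cmod[of "s - w"] abs_Im_le_cmod[of "s - w"] by linarith+
          hence "\<bar>Re s - \<xi>\<bar> \<le> r" "\<bar>Im s - t\<bar> \<le> r" by (auto simp: w_def)
          moreover have "X\<^sup>2 + 1 \<le> X ^ 3"
          proof -
            have "X\<^sup>2 * 2 \<le> X\<^sup>2 * X" using X2' by (intro mult_left_mono) auto
            moreover have "1 \<le> X\<^sup>2" using X2' by (simp add: one_le_power)
            ultimately show ?thesis by (simp add: power3_eq_cube power2_eq_square)
          qed
          ultimately show ?thesis using xi \<sigma> r t by linarith
        qed
        show "zeta_cont holomorphic_on ball w r"
        proof (rule holomorphic_on_subset[OF holomorphic_zeta_cont], rule subsetI)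
          fix s assume "s \<in> ball w r"
          hence "norm (s - w) \<le> r" by (simp add: dist_norm norm_minus_commute)
          from inb[OF this] show "s \<in> {s. 1 / 4 < Re s} - {1}" using r by auto
        qed
        show "norm (zeta_cont s) \<le> B" if "norm (s - w) \<le> r / 2" for s
        proof -
          have s: "1 - r \<le> Re s \<and> Re s \<le> 4 \<and> 1 \<le> \<bar>Im s\<bar> \<and> \<bar>Im s\<bar> \<le> X ^ 3"
            using inb[of s] that r by simp
          have "norm (zeta_cont s) \<le> C * (1 + ln \<bar>Im s\<bar>) * \<bar>Im s\<bar> powr (r / k)" using s by (intro growth) auto
          also have "\<dots> \<le> C * (1 + 3 * L) * (X ^ 3) powr (r / k)"
          proof (intro mult_mono)
            have "ln \<bar>Im s\<bar> \<le> ln (X ^ 3)" using s by (intro ln_mono) auto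
            thus "1 + ln \<bar>Im s\<bar> \<le> 1 + 3 * L" using X0 by (simp add: L_def ln_realpow)
            show "\<bar>Im s\<bar> powr (r / k) \<le> (X ^ 3) powr (r / k)" using s r by (intro powr_mono2) auto
          qed (use C s L2 in auto)
          also have "(X ^ 3) powr (r / k) = X powr (3 * (r / k))"
            using X0 powr_powr[of X 3 "r / k"] by simp
          finally show ?thesis by (simp add: B_def)
        qed
        show "zeta_cont s \<noteq> 0" if "Re w \<le> Re s" for s
          using that xi \<sigma> by (intro zeta_cont_nonzero) (simp add: w_def)
      qed (use r in auto)
      have lnB: "ln (2 * B) = ln (2 * C) + ln (1 + 3 * L) + 3 * (r / k) * L"
      proof -
        have "2 * B = (2 * C) * (1 + 3 * L) * X powr (3 * (r / k))" by (simp add: B_def)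
        thus ?thesis using C L2 X0 by (simp add: ln_mult ln_powr L_def)
      qed
      have lnz_ge: "- ln (norm (zeta_cont w)) \<le> ln L + prime_zeta_const + 2"
      proof -
        have "ln (1 / (\<xi> - 1)) \<le> ln L"
        proof (rule ln_mono)
          have "\<xi> - 1 \<ge> 1 / L" using xi by (simp add: \<sigma>1_def L_def)
          thus "1 / (\<xi> - 1) \<le> L" using L2 xi \<sigma> by (simp add: field_simps)
        qed (use xi \<sigma> in auto)
        thus ?thesis using ln_norm_zeta_cont_ge[of \<xi> t] xi \<sigma> unfolding w_def by linarith
      qed
      define G where "G = D + ln (1 + 3 * L) + ln L"
      have "ln (2 * B) - ln (norm (zeta_cont w)) \<le> G + 3 * (r / k) * L"
        using lnB lnz_ge unfolding G_def D_def by linarith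
      hence "4 / (r / 2) * (ln (2 * B) - ln (norm (zeta_cont w))) \<le> 4 / (r / 2) * (G + 3 * (r / k) * L)"
        using r by (intro mult_left_mono) auto
      hence "- Re (deriv zeta_cont w / zeta_cont w) \<le> 4 / (r / 2) * (G + 3 * (r / k) * L)"
        using deriv_ge by linarith
      also have "4 / (r / 2) * (G + 3 * (r / k) * L) = 8 / r * G + 24 * L / k"
        using r k0 by (simp add: field_simps)
      finally have dbound: "- Re (deriv zeta_cont w / zeta_cont w) \<le> 8 / r * G + 24 * L / k" .
      have "ln (norm (zeta_cont (Complex \<sigma>1 t))) - ln (norm (zeta_cont (Complex \<sigma>2 t)))
          = (\<sigma>2 - \<sigma>1) * (- Re (deriv zeta_cont w / zeta_cont w))"
        using mv unfolding w_def by (simp add: algebra_simps)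
      also have "\<dots> \<le> (\<sigma>2 - \<sigma>1) * (8 / r * G + 24 * L / k)"
        using dbound \<sigma> by (intro mult_left_mono) auto
      also have "\<dots> \<le> (k / L) * (8 / r * G + 24 * L / k)"
      proof (rule mult_right_mono)
        show "\<sigma>2 - \<sigma>1 \<le> k / L" using L2 by (simp add: s2 \<sigma>1_def L_def)
        have "D \<ge> 0" using C zeta_const_nonneg by (simp add: D_def prime_zeta_const_def)
        hence "G \<ge> 0" using L2 by (simp add: G_def)
        thus "0 \<le> 8 / r * G + 24 * L / k" using r L2 k0 by simp
      qed
      also have "\<dots> = (8 * real k / (r * L)) * G + 24" using L2 k0 r by (simp add: field_simps)
      also have "\<dots> \<le> 25" using elim(1) by (simp add: G_def L_def)
      finally have "ln (norm (zeta_cont (Complex \<sigma>1 t))) - ln (norm (zeta_cont (Complex \<sigma>2 t))) \<le> 25" .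
      \<comment> \<open>25 from log |zeta|, 2 + 2 from comparing it with prime sums at both
        abscissas, and two kernel errors.\<close>
      hence "(\<Sum>p | prime p \<and> z < real p \<and> real p \<le> X. c p / real p) \<le> 2 * mertens_const + 29"
        using kern kernz split e1 e2 mertens_const_ge by linarith
      thus "(\<Sum>p | prime p \<and> X powr (1 / k) < real p \<and> real p \<le> X. cos (t * ln (real p)) / real p) \<le> 2 * mertens_const + 29"
        by (simp add: z_def c_def)
    qed
  qed
qed



section \<open>Distances to Dirichlet characters\<close>

text \<open>The prime sum of the aperiodicity conditions for \<open>lambda_on P\<close>, with its
  sign at primes written out; \<open>g\<close> stands for the character times p^(it).\<close>

definition twist :: "nat set \<Rightarrow> (nat \<Rightarrow> complex) \<Rightarrow> real \<Rightarrow> real" where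
  "twist P g X = (\<Sum>p\<in>primes_le X. (1 - (if p \<in> P then -1 else 1) * Re (g p)) / real p)"

lemma twist_term_nonneg:
  assumes "norm (g p) \<le> 1"
  shows "(1 - (if p \<in> P then -1 else 1) * Re (g p)) / real p \<ge> 0"
  using assms abs_Re_le_cmod[of "g p"] by (auto simp: abs_le_iff)

lemma twist_term_ge:
  assumes "norm (g p) \<le> 1"
  shows "(1 - Re (g p)) / real p - (if p \<in> P then 2 / real p else 0)
    \<le> (1 - (if p \<in> P then -1 else 1) * Re (g p)) / real p"
proof (cases "p \<in> P")
  case True
  have "(1 - Re (g p)) / real p - 2 / real p = (1 - Re (g p) - 2) / real p"
    by (simp only: diff_divide_distrib)
  also have "\<dots> \<le> (1 + Re (g p)) / real p"
    using assms abs_Re_le_cmod[of "g p"] by (intro divide_right_mono) auto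
  finally show ?thesis using True by simp
qed simp

text \<open>Undoing the sign on \<open>P\<close> costs at most 2 / p at each of its primes.\<close>

lemma twist_ge_untwisted:
  assumes g: "\<And>p. prime p \<Longrightarrow> norm (g p) \<le> 1" and P: "P \<subseteq> {p. prime p}"
  shows "twist P g X \<ge> (\<Sum>p\<in>primes_le X. (1 - Re (g p)) / real p) - 2 * recip_sum P 0 X"
proof -
  have "(\<Sum>p\<in>primes_le X. (1 - Re (g p)) / real p - (if p \<in> P then 2 / real p else 0)) \<le> twist P g X"
    unfolding twist_def
  proof (rule sum_mono)
    fix p assume p: "p \<in> primes_le X"
    show "(1 - Re (g p)) / real p - (if p \<in> P then 2 / real p else 0) \<le> (1 - (if p \<in> P then -1 else 1) * Re (g p)) / real p"
      using p by (intro twist_term_ge g) simp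
  qed
  thus ?thesis by (simp add: sum_subtractf sum_two_over_primes_le[OF P])
qed

text \<open>Below \<open>y\<close> all terms are nonnegative and only those in \<open>P\<close> are
  kept, where the sign turns 1 - Re g into 1 + Re g; above \<open>y\<close> the sign is undone at
  the cost of 2 / p. This suits a \<open>g\<close> that is close to 1 below
  \<open>y\<close>.\<close>

lemma twist_ge_range:
  assumes g: "\<And>p. prime p \<Longrightarrow> norm (g p) \<le> 1" and y: "0 \<le> y" "y \<le> X" and P: "P \<subseteq> {p. prime p}"
  shows "twist P g X \<ge> (\<Sum>p | p \<in> P \<and> 0 < real p \<and> real p \<le> y. (1 + Re (g p)) / real p)
     + (\<Sum>p | prime p \<and> y < real p \<and> real p \<le> X. (1 - Re (g p)) / real p) - 2 * recip_sum P y X"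
proof -
  define A where "A = {p. p \<in> P \<and> 0 < real p \<and> real p \<le> y}"
  define B where "B = {p. prime p \<and> y < real p \<and> real p \<le> X}"
  define h where "h p = (1 - (if p \<in> P then -1 else 1) * Re (g p)) / real p" for p
  have fin: "finite A" "finite B"
    using finite_real_le[of P 0 y] finite_real_le[of "{p. prime p}" y X] by (auto simp: A_def B_def)
  have h0: "h p \<ge> 0" if "prime p" for p unfolding h_def by (rule twist_term_nonneg) (rule g[OF that])
  have "(\<Sum>p\<in>A \<union> B. h p) \<le> twist P g X"
    unfolding twist_def h_def[symmetric] using P y
    by (intro sum_mono2) (auto simp: A_def B_def intro: h0)
  moreover have "(\<Sum>p\<in>A \<union> B. h p) = (\<Sum>p\<in>A. h p) + (\<Sum>p\<in>B. h p)"
    by (intro sum.union_disjoint fin) (auto simp: A_def B_def)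
  moreover have "(\<Sum>p\<in>A. h p) = (\<Sum>p\<in>A. (1 + Re (g p)) / real p)"
    by (rule sum.cong) (auto simp: A_def h_def)
  moreover have "(\<Sum>p\<in>B. (1 - Re (g p)) / real p) - 2 * recip_sum P y X \<le> (\<Sum>p\<in>B. h p)"
  proof -
    have "(\<Sum>p\<in>B. (1 - Re (g p)) / real p - (if p \<in> P then 2 / real p else 0)) \<le> (\<Sum>p\<in>B. h p)"
    proof (rule sum_mono)
      fix p assume p: "p \<in> B"
      show "(1 - Re (g p)) / real p - (if p \<in> P then 2 / real p else 0) \<le> h p"
        unfolding h_def using p by (intro twist_term_ge g) (simp add: B_def)
    qed
    thus ?thesis unfolding B_def by (simp add: sum_subtractf sum_two_over_primes[OF P])
  qed
  ultimately show ?thesis unfolding A_def B_def by linarith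
qed

section \<open>Nonprincipal characters at bounded height\<close>

lemma norm_dirichlet_character_le:
  assumes "dirichlet_character q chi"
  shows "norm (chi n) \<le> 1"
proof (cases "coprime n q")
  case True
  have q: "totient q > 0" using assms by (simp add: dirichlet_character_def)
  have "norm (chi n) ^ totient q = 1"
    using dirichlet_character_root_of_unity[OF assms True] by (metis norm_one norm_power)
  hence "norm (chi n) = 1" 
    using q power_eq_imp_eq_base[of "norm (chi n)" "totient q" 1] by simp
  thus ?thesis by simp
next
  case False
  hence "chi n = 0" using assms by (auto simp: dirichlet_character_def)
  thus ?thesis by simp
qed

text \<open>Multiplication by \<open>a\<close> permutes the residues modulo \<open>q\<close> and
  multiplies the complete sum by \<open>chi a\<close>, so the complete sum vanishes and at most one
  incomplete period remains.\<close>

lemma sum_nonprincipal_character: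
  assumes chi: "dirichlet_character q chi" and a: "coprime a q" "chi a \<noteq> 1"
  shows "norm (\<Sum>n<M. chi n) \<le> real q"
proof -
  have q: "q > 0" and mult: "\<And>m n. chi (m * n) = chi m * chi n" and per: "\<And>n. chi (n mod q) = chi n"
    using chi dirichlet_character_mod[OF chi] by (auto simp: dirichlet_character_def)
  have inj: "inj_on (\<lambda>n. a * n mod q) {..<q}"
  proof (rule inj_onI)
    fix m n assume mn: "m \<in> {..<q}" "n \<in> {..<q}" "a * m mod q = a * n mod q"
    hence "[m = n] (mod q)" using a(1) cong_mult_lcancel_nat[of a q m n] by (simp add: cong_def)
    thus "m = n" using mn by (simp add: cong_def)
  qed
  moreover have "(\<lambda>n. a * n mod q) ` {..<q} \<subseteq> {..<q}" using q by auto
  ultimately have bij: "bij_betw (\<lambda>n. a * n mod q) {..<q} {..<q}"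
    by (simp add: bij_betw_def endo_inj_surj)
  have "(\<Sum>n<q. chi n) = (\<Sum>n<q. chi (a * n mod q))" by (rule sum.reindex_bij_betw[OF bij, symmetric])
  also have "\<dots> = chi a * (\<Sum>n<q. chi n)" by (simp add: per mult sum_distrib_left)
  finally have "(1 - chi a) * (\<Sum>n<q. chi n) = 0" by (simp add: algebra_simps)
  hence period: "(\<Sum>n<q. chi n) = 0" using a(2) by simp
  have "(\<Sum>n<q * j + r. chi n) = (\<Sum>n<r. chi n)" if "r < q" for j r
  proof (induction j)
    case (Suc j)
    have eq: "{..<q * Suc j + r} = {..<q} \<union> {q..<q + (q * j + r)}" by auto
    have "(\<Sum>n<q * Suc j + r. chi n) = (\<Sum>n<q. chi n) + (\<Sum>n\<in>{q..<q + (q * j + r)}. chi n)"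
      unfolding eq by (rule sum.union_disjoint) auto
    also have "(\<Sum>n\<in>{q..<q + (q * j + r)}. chi n) = (\<Sum>n<q * j + r. chi (q + n))"
      by (rule sum.reindex_bij_witness[of _ "\<lambda>n. q + n" "\<lambda>n. n - q"]) auto
    also have "(\<Sum>n<q * j + r. chi (q + n)) = (\<Sum>n<q * j + r. chi n)"
      by (intro sum.cong refl) (metis per mod_add_self1)
    finally show ?case using Suc period by simp
  qed simp
  from this[of "M mod q" "M div q"] have "(\<Sum>n<M. chi n) = (\<Sum>n<M mod q. chi n)" using q by simp
  also have "norm \<dots> \<le> (\<Sum>n<M mod q. 1)" by (intro sum_norm_le norm_dirichlet_character_le[OF chi])
  also have "\<dots> \<le> real q" using mod_less_divisor[OF q, of M] by simp
  finally show ?thesis .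
qed

text \<open>Partial summation with bounded character sums: the increments of n^(-s) are at most 4
  n^(-5/4), uniformly as \<open>\<sigma>\<close> approaches 1.\<close>

lemma norm_L_function_le:
  assumes chi: "dirichlet_character q chi" and a: "coprime a q" "chi a \<noteq> 1"
    and \<sigma>: "1 < \<sigma>" "\<sigma> \<le> 2" and t: "\<bar>t\<bar> \<le> 2"
  shows "norm (dirichlet_sum (\<lambda>n. chi n * cis (t * ln (real n))) \<sigma>) \<le> (real q + 1) * (1 + 4 * powr_const)"
proof -
  define s where "s = Complex \<sigma> (- t)"
  define b where "b n = of_nat n powr (- s)" for n
  define S where "S m = (\<Sum>n=1..m. chi n)" for m
  define w where "w n = chi n * cis (t * ln (real n)) * of_real (real n powr (- \<sigma>))" for n
  have wb: "w n = chi n * b n" if "n > 0" for n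
  proof -
    have "- s = Complex (- \<sigma>) t" by (simp add: s_def complex_eq_iff)
    thus ?thesis using nat_powr_complex[of n "- \<sigma>" t] that by (simp add: w_def b_def)
  qed
  have ns: "norm s \<le> 4" using cmod_le[of s] \<sigma> t by (simp add: s_def)
  \<comment> \<open>\<open>S\<close> starts at 1, the sums of
    \<open>sum_nonprincipal_character\<close> at 0; the term \<open>chi 0\<close> accounts for the +
    1.\<close>
  have S: "norm (S m) \<le> real q + 1" for m
  proof -
    have "(\<Sum>n<Suc m. chi n) = chi 0 + S m"
      unfolding S_def by (subst lessThan_Suc_atMost, subst atMost_atLeast0, subst sum.atLeast_Suc_atMost) auto
    hence "S m = (\<Sum>n<Suc m. chi n) - chi 0" by simp
    hence "norm (S m) \<le> norm (\<Sum>n<Suc m. chi n) + norm (chi 0)" by (metis norm_triangle_ineq4)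
    thus ?thesis using sum_nonprincipal_character[OF chi a, of "Suc m"] norm_dirichlet_character_le[OF chi, of 0] by linarith
  qed
  have abel: "(\<Sum>n=1..M. chi n * b n) = S M * b (Suc M) + (\<Sum>n=1..M. S n * (b n - b (Suc n)))" for M
  proof (induction M)
    case 0 show ?case by (simp add: S_def)
  next
    case (Suc M)
    have "S (Suc M) = S M + chi (Suc M)" by (simp add: S_def)
    thus ?case using Suc by (simp add: algebra_simps)
  qed
  have nb: "norm (b (Suc M)) \<le> 1" for M
  proof -
    have "norm (b (Suc M)) = real (Suc M) powr (- \<sigma>)"
      using norm_nat_powr[of "Suc M" "- s"] by (simp add: b_def s_def)
    also have "\<dots> \<le> real (Suc M) powr 0" using \<sigma> by (intro powr_mono) auto
    finally show ?thesis by simp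
  qed
  have db: "norm (b (Suc n) - b (Suc (Suc n))) \<le> 4 * real (Suc n) powr (- (5 / 4))" for n
  proof -
    have "norm (b (Suc n) - b (Suc (Suc n))) \<le> norm s * real (Suc n) powr (- Re s - 1)"
      using norm_powr_diff_le[of s "Suc n" "real (Suc (Suc n))"] \<sigma> unfolding b_def s_def by simp
    also have "\<dots> \<le> 4 * real (Suc n) powr (- (5 / 4))"
      using ns \<sigma> by (intro mult_mono powr_mono) (auto simp: s_def)
    finally show ?thesis .
  qed
  have bound: "norm (\<Sum>n=1..M. chi n * b n) \<le> (real q + 1) * (1 + 4 * powr_const)" for M
  proof -
    have "norm (\<Sum>n=1..M. S n * (b n - b (Suc n))) \<le> (\<Sum>n=1..M. (real q + 1) * norm (b n - b (Suc n)))"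
      by (intro sum_norm_le) (simp add: norm_mult mult_right_mono S)
    also have "\<dots> = (\<Sum>n<M. (real q + 1) * norm (b (Suc n) - b (Suc (Suc n))))"
      by (rule sum.reindex_bij_witness[of _ Suc "\<lambda>n. n - 1"]) auto
    also have "\<dots> \<le> (\<Sum>n<M. (real q + 1) * (4 * real (Suc n) powr (- (5 / 4))))"
      by (intro sum_mono mult_left_mono db) auto
    also have "\<dots> = (real q + 1) * 4 * (\<Sum>n<M. real (Suc n) powr (- (5 / 4)))"
      unfolding sum_distrib_left by (simp only: mult.assoc)
    also have "(\<Sum>n<M. real (Suc n) powr (- (5 / 4))) \<le> powr_const"
      unfolding powr_const_def by (rule sum_le_suminf[OF summable_powr_const]) auto
    finally have 1: "norm (\<Sum>n=1..M. S n * (b n - b (Suc n))) \<le> (real q + 1) * 4 * powr_const"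
      by (simp add: mult_left_mono)
    have "norm (S M * b (Suc M)) \<le> (real q + 1) * 1"
      unfolding norm_mult using S nb by (intro mult_mono) auto
    thus ?thesis unfolding abel using 1 norm_triangle_ineq[of "S M * b (Suc M)" "\<Sum>n=1..M. S n * (b n - b (Suc n))"]
      by (simp add: algebra_simps)
  qed
  have "summable (\<lambda>n. norm (w n))"
    unfolding w_def by (rule summable_dirichlet) (use \<sigma> norm_dirichlet_character_le[OF chi] in \<open>auto simp: norm_mult\<close>)
  hence "(\<lambda>M. \<Sum>n\<le>M. w n) \<longlonglongrightarrow> suminf w" by (rule summable_LIMSEQ'[OF summable_norm_cancel])
  moreover have "norm (\<Sum>n\<le>M. w n) \<le> (real q + 1) * (1 + 4 * powr_const)" for M
  proof -
    have "(\<Sum>n\<le>M. w n) = (\<Sum>n=1..M. chi n * b n)"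
    proof (rule sum.mono_neutral_cong_right)
      show "\<forall>i\<in>{..M} - {1..M}. w i = 0" by (auto simp: w_def)
    qed (auto simp: wb)
    thus ?thesis using bound by simp
  qed
  ultimately have "norm (suminf w) \<le> (real q + 1) * (1 + 4 * powr_const)"
    using LIMSEQ_le_const2[OF tendsto_norm] by blast
  thus ?thesis by (simp add: dirichlet_sum_def w_def[abs_def])
qed

lemma completely_mult_character:
  assumes "dirichlet_character q chi"
  shows "completely_mult (\<lambda>n. chi n * cis (t * ln (real n)))"
  using completely_mult_cis[of t] assms dirichlet_character_1[OF assms] norm_dirichlet_character_le[OF assms]
  unfolding completely_mult_def by (auto simp: norm_mult dirichlet_character_def)

text \<open>The L-function is bounded, so the untwisted distance is at least ln ln X minus a
  constant, and \<open>P\<close> takes at most half of ln ln X.\<close>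

lemma twist_nonprincipal_large:
  assumes P: "P \<subseteq> {p. prime p}" and dens: "zero_relative_density P"
  shows "\<forall>\<^sub>F X in at_top. \<forall>q chi t. real q \<le> Q \<longrightarrow> dirichlet_character q chi \<longrightarrow> (\<exists>a. coprime a q \<and> chi a \<noteq> 1) \<longrightarrow>
     \<bar>t\<bar> \<le> 2 \<longrightarrow> twist P (\<lambda>p. chi p * cis (t * ln (real p))) X \<ge> K"
proof -
  define B where "B = (\<bar>Q\<bar> + 1) * (1 + 4 * powr_const)"
  have ev1: "\<forall>\<^sub>F X in at_top. recip_sum P 0 X \<le> 1 / 4 * ln (ln X)"
    by (rule sparse_recip_sum_small[OF P dens]) simp
  have ev2: "\<forall>\<^sub>F X in at_top. 2 * K + 2 * ln B + 4 * mertens_const \<le> ln (ln X)" by (rule eventually_ln_ln_ge)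
  show ?thesis using ev1 ev2 eventually_ge_at_top[of "exp 2"]
  proof eventually_elim
    case (elim X)
    show ?case
    proof (intro allI impI)
      fix q :: nat and chi :: "nat \<Rightarrow> complex" and t :: real assume q: "real q \<le> Q" and chi: "dirichlet_character q chi" and ex: "\<exists>a. coprime a q \<and> chi a \<noteq> 1" and t: "\<bar>t\<bar> \<le> 2"
      from ex obtain a where a: "coprime a q" "chi a \<noteq> 1" by blast
      define g where "g p = chi p * cis (t * ln (real p))" for p
      have cm: "completely_mult g" unfolding g_def by (rule completely_mult_character[OF chi])
      have lX: "ln X \<ge> 2" using elim by (intro ln_ge_2)
      define \<sigma> where "\<sigma> = 1 + 1 / ln X"
      have \<sigma>: "1 < \<sigma>" "\<sigma> \<le> 2" using lX by (auto simp: \<sigma>_def)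
      have "norm (dirichlet_sum g \<sigma>) \<le> (real q + 1) * (1 + 4 * powr_const)"
        unfolding g_def by (rule norm_L_function_le[OF chi a \<sigma> t])
      also have "\<dots> \<le> B" unfolding B_def using q powr_const_nonneg by (intro mult_right_mono) auto
      finally have "ln (norm (dirichlet_sum g \<sigma>)) \<le> ln B"
        using ln_norm_dirichlet_sum(1)[OF cm \<sigma>(1)] by (intro ln_mono) auto
      moreover have "(\<Sum>p\<in>primes_le X. (1 - Re (g p)) / real p) \<ge> ln (ln X) - ln (norm (dirichlet_sum g \<sigma>)) - 2 * mertens_const"
        unfolding \<sigma>_def by (rule distance_lower_bound[OF elim(3) cm])
      moreover have "twist P g X \<ge> (\<Sum>p\<in>primes_le X. (1 - Re (g p)) / real p) - 2 * recip_sum P 0 X"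
        using cm prime_gt_0_nat P by (intro twist_ge_untwisted) (auto simp: completely_mult_def)
      ultimately have "twist P g X \<ge> K" using elim(1,2) by linarith
      thus "twist P (\<lambda>p. chi p * cis (t * ln (real p))) X \<ge> K" by (simp add: g_def[abs_def])
    qed
  qed
qed



section \<open>Principal characters at bounded height\<close>

lemma one_minus_cos_le: "1 - cos x \<le> x\<^sup>2 / (2::real)"
proof -
  have "1 - cos x = 2 * (sin (x / 2))\<^sup>2" using cos_double_sin[of "x / 2"] by simp
  also have "(sin (x / 2))\<^sup>2 \<le> (x / 2)\<^sup>2" using abs_sin_x_le_abs_x[of "x / 2"] by (simp only: abs_le_square_iff)
  finally show ?thesis by (simp add: power2_eq_square)
qed

text \<open>1 - cos x is at most x^2 / 2, and the second moment of ln p is O((ln y)^2) by the kernel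
  estimate.\<close>

lemma sum_one_minus_cos_small:
  assumes y: "exp 2 \<le> y" and t: "\<bar>t\<bar> * ln y \<le> 1"
  shows "(\<Sum>p\<in>primes_le y. (1 - cos (t * ln (real p))) / real p) \<le> mertens_const"
proof -
  have ly: "ln y \<ge> 2" by (rule ln_ge_2[OF y])
  have "(\<Sum>p\<in>primes_le y. (1 - cos (t * ln (real p))) / real p) \<le> (\<Sum>p\<in>primes_le y. t\<^sup>2 / 2 * ((ln (real p))\<^sup>2 / real p))"
  proof (rule sum_mono)
    fix p
    have "(1 - cos (t * ln (real p))) / real p \<le> ((t * ln (real p))\<^sup>2 / 2) / real p"
      by (intro divide_right_mono one_minus_cos_le) auto
    thus "(1 - cos (t * ln (real p))) / real p \<le> t\<^sup>2 / 2 * ((ln (real p))\<^sup>2 / real p)"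
      by (simp add: power_mult_distrib)
  qed
  also have "\<dots> = t\<^sup>2 / 2 * (\<Sum>p\<in>primes_le y. (ln (real p))\<^sup>2 / real p)" by (rule sum_distrib_left[symmetric])
  also have "\<dots> \<le> t\<^sup>2 / 2 * (prime_kernel_const * (ln y)\<^sup>2)"
    by (intro mult_left_mono prime_kernel(2)[OF y]) auto
  also have "\<dots> = prime_kernel_const / 2 * (\<bar>t\<bar> * ln y)\<^sup>2" by (simp add: power_mult_distrib)
  also have "\<dots> \<le> prime_kernel_const / 2 * 1"
    using t ly mertens_const_ge(3) by (intro mult_left_mono) (auto simp: power_le_one)
  finally show ?thesis using mertens_const_ge by linarith
qed

text \<open>The pole contributes at most 1 / |t| to zeta at height \<open>t\<close>, and the rest is
  bounded; the distance is thus about ln (|t| ln X) at least.\<close>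

lemma sum_one_minus_cos_large:
  assumes X: "exp 2 \<le> X" and t: "t \<noteq> 0" "\<bar>t\<bar> \<le> 2"
  shows "(\<Sum>p\<in>primes_le X. (1 - cos (t * ln (real p))) / real p)
    \<ge> ln (ln X) + ln \<bar>t\<bar> - ln (1 + 10 * powr_const) - 2 * mertens_const"
proof -
  define g where "g n = cis (t * ln (real n))" for n :: nat
  have lX: "ln X \<ge> 2" by (rule ln_ge_2[OF X])
  define \<sigma> where "\<sigma> = 1 + 1 / ln X"
  have \<sigma>: "1 < \<sigma>" "\<sigma> \<le> 2" using lX by (auto simp: \<sigma>_def)
  define s where "s = Complex \<sigma> (- t)"
  have cm: "completely_mult g" unfolding g_def by (rule completely_mult_cis)
  have Z: "dirichlet_sum g \<sigma> = zeta_cont s"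
    using zeta_cont_eq_dirichlet_sum[OF \<sigma>(1), of "- t"] by (simp add: g_def[abs_def] s_def)
  have ns: "norm s \<le> 4" using cmod_le[of s] \<sigma> t by (simp add: s_def)
  have s1: "s \<noteq> 1" using t by (auto simp: s_def complex_eq_iff)
  have "norm (zeta_cont s - 1 / (s - 1)) \<le> norm s * powr_const"
    using \<sigma> s1 by (intro norm_zeta_cont_minus_pole) (auto simp: s_def)
  also have "\<dots> \<le> 5 * powr_const" using ns powr_const_nonneg by (intro mult_right_mono) auto
  finally have 1: "norm (zeta_cont s - 1 / (s - 1)) \<le> 5 * powr_const" .
  have "\<bar>t\<bar> \<le> norm (s - 1)" using abs_Im_le_cmod[of "s - 1"] by (simp add: s_def)
  hence 2: "norm (1 / (s - 1)) \<le> 1 / \<bar>t\<bar>" using t s1 by (simp add: norm_divide frac_le)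
  have "norm (zeta_cont s) \<le> norm (zeta_cont s - 1 / (s - 1)) + norm (1 / (s - 1))"
    using norm_triangle_ineq[of "zeta_cont s - 1 / (s - 1)" "1 / (s - 1)"] by simp
  hence "norm (zeta_cont s) \<le> 1 / \<bar>t\<bar> + 5 * powr_const * 1" using 1 2 by linarith
  also have "\<dots> \<le> 1 / \<bar>t\<bar> + 5 * powr_const * (2 / \<bar>t\<bar>)"
    using t powr_const_nonneg by (intro add_left_mono mult_left_mono) auto
  also have "\<dots> = (1 + 10 * powr_const) / \<bar>t\<bar>" using t by (simp add: field_simps)
  finally have "ln (norm (zeta_cont s)) \<le> ln ((1 + 10 * powr_const) / \<bar>t\<bar>)"
    using ln_norm_dirichlet_sum(1)[OF cm \<sigma>(1)] Z by (intro ln_mono) auto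
  also have "\<dots> = ln (1 + 10 * powr_const) - ln \<bar>t\<bar>"
    using t powr_const_nonneg by (simp add: ln_div)
  finally have "ln (norm (dirichlet_sum g \<sigma>)) \<le> ln (1 + 10 * powr_const) - ln \<bar>t\<bar>" unfolding Z .
  moreover have "(\<Sum>p\<in>primes_le X. (1 - Re (g p)) / real p) \<ge> ln (ln X) - ln (norm (dirichlet_sum g \<sigma>)) - 2 * mertens_const"
    unfolding \<sigma>_def by (rule distance_lower_bound[OF X cm])
  ultimately show ?thesis by (simp add: g_def)
qed

text \<open>Let y = exp (1 / |t|). Below y the primes of \<open>P\<close> give at least their
  reciprocal sum; above y the sum is at least half of ln (ln X / ln y), up to a constant. Either y
  is large and the first part suffices, or y is bounded and the second does. For y below
  \<open>y0\<close>, where the sparseness bound does not apply, |t| is bounded below and the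
  untwisted sum decides.\<close>

lemma twist_small_frequency_large:
  assumes P: "P \<subseteq> {p. prime p}" and dens: "zero_relative_density P"
    and div: "\<And>K. \<exists>X0. \<forall>X\<ge>X0. recip_sum P 0 X \<ge> K"
  shows "\<forall>\<^sub>F X in at_top. \<forall>t. \<bar>t\<bar> \<le> 2 \<longrightarrow> twist P (\<lambda>p. cis (t * ln (real p))) X \<ge> K"
proof -
  obtain y0 where y0: "y0 \<ge> exp 2" and sparse: "\<And>y X. y \<ge> y0 \<Longrightarrow> X \<ge> y \<Longrightarrow>
      recip_sum P y X \<le> ln (ln X / ln y) / 4 + mertens_const / 2 + 1 / 4"
    using sparse_recip_sum_ln[OF P dens, of "1 / 4"] by (auto simp: field_simps)
  define C1 where "C1 = ln (1 + 10 * powr_const) + 4 * mertens_const + 1"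
  have lC: "ln (1 + 10 * powr_const) \<ge> 0" using powr_const_nonneg by simp
  obtain Y where Y: "\<And>X. X \<ge> Y \<Longrightarrow> recip_sum P 0 X \<ge> K + C1" using div[of "K + C1"] by blast
  define Y1 where "Y1 = max Y y0"
  have Y1: "Y1 \<ge> Y" "Y1 \<ge> y0" by (auto simp: Y1_def)
  have y0p: "y0 > 0" using y0 exp_gt_zero[of "2::real"] by linarith
  have ly0: "ln y0 \<ge> 2" by (rule ln_ge_2[OF y0])
  have lY1: "ln Y1 \<ge> 2" using Y1 y0 by (intro ln_ge_2) linarith
  have ev1: "\<forall>\<^sub>F X in at_top. recip_sum P 0 X \<le> 1 / 4 * ln (ln X)"
    by (rule sparse_recip_sum_small[OF P dens]) simp
  have ev2: "\<forall>\<^sub>F X in at_top. 2 * \<bar>K\<bar> + 2 * C1 + 2 * ln (ln Y1) \<le> ln (ln X)" by (rule eventually_ln_ln_ge)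
  show ?thesis using ev1 ev2 eventually_ge_at_top[of Y1]
  proof eventually_elim
    case (elim X)
    have X: "exp 2 \<le> X" using elim(3) Y1 y0 by linarith
    have lX: "ln X \<ge> 2" by (rule ln_ge_2[OF X])
    have X0: "X > 0" using X exp_gt_zero[of 2] by linarith
    have llY1: "ln (ln Y1) \<ge> 0" using lY1 by simp
    have C1: "C1 \<ge> 0" using lC mertens_const_ge by (simp add: C1_def)
    show ?case
    proof (intro allI impI)
      fix t :: real assume t: "\<bar>t\<bar> \<le> 2"
      define g where "g p = cis (t * ln (real p))" for p :: nat
      have g: "norm (g p) \<le> 1" for p by (simp add: g_def)
      have near: "(\<Sum>p | p \<in> P \<and> 0 < real p \<and> real p \<le> y. (1 + Re (g p)) / real p) \<ge> recip_sum P 0 y"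
        if "\<bar>t\<bar> * ln y \<le> 1" "y \<le> X" for y
        unfolding recip_sum_def
      proof (rule sum_mono)
        fix p assume p: "p \<in> {p. p \<in> P \<and> 0 < real p \<and> real p \<le> y}"
        have p1: "real p \<ge> 1" using p by auto
        have "\<bar>t * ln (real p)\<bar> = \<bar>t\<bar> * ln (real p)" using p1 by (simp add: abs_mult)
        also have "\<dots> \<le> \<bar>t\<bar> * ln y" using p p1 by (intro mult_left_mono ln_mono) auto
        finally have "\<bar>t * ln (real p)\<bar> \<le> 1" using that by linarith
        hence "(t * ln (real p))\<^sup>2 \<le> 1" by (simp add: abs_square_le_1)
        hence "cos (t * ln (real p)) \<ge> 0" using one_minus_cos_le[of "t * ln (real p)"] by linarith
        thus "1 / real p \<le> (1 + Re (g p)) / real p" by (intro divide_right_mono) (auto simp: g_def)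
      qed
      have "twist P g X \<ge> K"
      proof (cases "\<bar>t\<bar> * ln X \<le> 1")
        case True
        \<comment> \<open>Here exp (1 / |t|) is at least X, so the range splits at X itself and its
          upper part is empty.\<close>
        have "twist P g X \<ge> (\<Sum>p | p \<in> P \<and> 0 < real p \<and> real p \<le> X. (1 + Re (g p)) / real p)
           + (\<Sum>p | prime p \<and> X < real p \<and> real p \<le> X. (1 - Re (g p)) / real p) - 2 * recip_sum P X X"
          by (rule twist_ge_range) (use g X0 P in auto)
        moreover have "{p. prime p \<and> X < real p \<and> real p \<le> X} = {}" "{p. p \<in> P \<and> X < real p \<and> real p \<le> X} = {}" by auto
        ultimately have "twist P g X \<ge> recip_sum P 0 X" using near[of X] True by (simp add: recip_sum_def)
        thus ?thesis using Y[of X] elim(3) Y1 C1 by linarith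
      next
        case False
        have t0: "t \<noteq> 0" using False by auto
        have big: "(\<Sum>p\<in>primes_le X. (1 - cos (t * ln (real p))) / real p)
            \<ge> ln (ln X) + ln \<bar>t\<bar> - ln (1 + 10 * powr_const) - 2 * mertens_const"
          by (rule sum_one_minus_cos_large[OF X t0 t])
        show ?thesis
        proof (cases "\<bar>t\<bar> * ln y0 \<le> 1")
          case True
          define y where "y = exp (1 / \<bar>t\<bar>)"
          have ly: "ln y = 1 / \<bar>t\<bar>" by (simp add: y_def)
          have tly: "\<bar>t\<bar> * ln y \<le> 1" using t0 by (simp add: ly)
          have y0y: "y0 \<le> y"
          proof -
            have "ln y0 \<le> ln y" using True t0 by (simp add: ly field_simps)
            thus ?thesis using y0p by (subst (asm) ln_le_cancel_iff) (auto simp: y_def)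
          qed
          have yX: "y \<le> X"
          proof -
            have "ln y \<le> ln X" using False t0 by (simp add: ly field_simps)
            thus ?thesis using X0 by (subst (asm) ln_le_cancel_iff) (auto simp: y_def)
          qed
          have y2: "exp 2 \<le> y" using y0 y0y by linarith
          have lny: "ln (ln X / ln y) = ln (ln X) + ln \<bar>t\<bar>"
            using lX t0 by (simp add: ly ln_mult)
          have "twist P g X \<ge> (\<Sum>p | p \<in> P \<and> 0 < real p \<and> real p \<le> y. (1 + Re (g p)) / real p)
             + (\<Sum>p | prime p \<and> y < real p \<and> real p \<le> X. (1 - Re (g p)) / real p) - 2 * recip_sum P y X"
            by (rule twist_ge_range) (use g P yX in \<open>auto simp: y_def\<close>)
          moreover have "(\<Sum>p\<in>primes_le X. (1 - Re (g p)) / real p) = (\<Sum>p\<in>primes_le y. (1 - Re (g p)) / real p)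
              + (\<Sum>p | prime p \<and> y < real p \<and> real p \<le> X. (1 - Re (g p)) / real p)"
            by (rule sum_primes_le_split[OF yX])
          moreover have "(\<Sum>p\<in>primes_le y. (1 - Re (g p)) / real p) \<le> mertens_const"
            using sum_one_minus_cos_small[OF y2 tly] by (simp add: g_def)
          moreover have "(\<Sum>p\<in>primes_le X. (1 - Re (g p)) / real p) \<ge> ln (ln X / ln y) - ln (1 + 10 * powr_const) - 2 * mertens_const"
            using big by (simp add: g_def lny)
          moreover have "recip_sum P y X \<le> ln (ln X / ln y) / 4 + mertens_const / 2 + 1 / 4"
            by (rule sparse[OF y0y yX])
          ultimately have main: "twist P g X \<ge> recip_sum P 0 y + 1 / 2 * ln (ln X / ln y) - C1"
            using near[OF tly yX] mertens_const_ge(1) unfolding C1_def by linarith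
          show ?thesis
          proof (cases "y \<ge> Y1")
            case True
            have "ln X / ln y = \<bar>t\<bar> * ln X" by (simp add: ly)
            hence "ln X / ln y \<ge> 1" using False by linarith
            hence "ln (ln X / ln y) \<ge> 0" by simp
            thus ?thesis using main Y[of y] True Y1 by linarith
          next
            case yY1: False
            have "ln y \<ge> 2" using y2 by (rule ln_ge_2)
            moreover have "ln y \<le> ln Y1" using yY1 by (intro ln_mono) (auto simp: y_def)
            ultimately have "ln (ln y) \<le> ln (ln Y1)"
              using ln_mono[of "ln y" "ln Y1"] by linarith
            moreover have "ln (ln X / ln y) = ln (ln X) - ln (ln y)"
              using lX \<open>ln y \<ge> 2\<close> by (simp add: ln_div)
            ultimately show ?thesis using main elim(2) recip_sum_nonneg[of P 0 y] llY1 C1 by linarith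
          qed
        next
          case far: False
          have "1 / ln y0 \<le> \<bar>t\<bar>" using far ly0 by (simp add: field_simps)
          hence "ln (1 / ln y0) \<le> ln \<bar>t\<bar>" using ly0 by (intro ln_mono) auto
          moreover have "ln (1 / ln y0) = - ln (ln y0)" using ly0 by (simp add: ln_div)
          moreover have "ln (ln y0) \<le> ln (ln Y1)"
            using ly0 Y1 y0 exp_gt_zero[of 2] by (intro ln_mono) (linarith+)
          moreover have "twist P g X \<ge> (\<Sum>p\<in>primes_le X. (1 - Re (g p)) / real p) - 2 * recip_sum P 0 X"
            by (rule twist_ge_untwisted[OF g P])
          moreover have "(\<Sum>p\<in>primes_le X. (1 - Re (g p)) / real p)
            \<ge> ln (ln X) + ln \<bar>t\<bar> - ln (1 + 10 * powr_const) - 2 * mertens_const" using big by (simp add: g_def)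
          moreover have "ln (1 + 10 * powr_const) + 2 * mertens_const \<le> C1" using mertens_const_ge by (simp add: C1_def)
          ultimately show ?thesis using elim(1,2) by linarith
        qed
      qed
      thus "twist P (\<lambda>p. cis (t * ln (real p))) X \<ge> K" by (simp add: g_def[abs_def])
    qed
  qed
qed

text \<open>A principal character differs from 1 only at the primes dividing \<open>q\<close>, at
  most \<open>q\<close> in number, and each of them costs at most 2.\<close>

lemma twist_principal_large:
  assumes P: "P \<subseteq> {p. prime p}" and dens: "zero_relative_density P"
    and div: "\<And>K. \<exists>X0. \<forall>X\<ge>X0. recip_sum P 0 X \<ge> K"
  shows "\<forall>\<^sub>F X in at_top. \<forall>q chi t. real q \<le> Q \<longrightarrow> dirichlet_character q chi \<longrightarrow> (\<forall>a. coprime a q \<longrightarrow> chi a = 1) \<longrightarrow>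
     \<bar>t\<bar> \<le> 2 \<longrightarrow> twist P (\<lambda>p. chi p * cis (t * ln (real p))) X \<ge> K"
  using twist_small_frequency_large[OF P dens div, of "K + 2 * \<bar>Q\<bar>"]
proof eventually_elim
  case (elim X)
  show ?case
  proof (intro allI impI)
    fix q :: nat and chi :: "nat \<Rightarrow> complex" and t :: real assume q: "real q \<le> Q" and chi: "dirichlet_character q chi"
      and prin: "\<forall>a. coprime a q \<longrightarrow> chi a = 1" and t: "\<bar>t\<bar> \<le> 2"
    define e where "e p = (if p \<in> P then -1 else 1 :: real)" for p
    define D where "D = {p \<in> primes_le X. p dvd q}"
    have q0: "q > 0" using chi by (simp add: dirichlet_character_def)
    have D: "D \<subseteq> {1..q}" using q0 by (auto simp: D_def dvd_imp_le prime_ge_1_nat)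
    have "twist P (\<lambda>p. cis (t * ln (real p))) X - (\<Sum>p\<in>primes_le X. if p dvd q then 2 else 0)
        \<le> twist P (\<lambda>p. chi p * cis (t * ln (real p))) X"
      unfolding twist_def sum_subtractf[symmetric] e_def[symmetric]
    proof (rule sum_mono)
      fix p assume p: "p \<in> primes_le X"
      show "(1 - e p * Re (cis (t * ln (real p)))) / real p - (if p dvd q then 2 else 0)
          \<le> (1 - e p * Re (chi p * cis (t * ln (real p)))) / real p"
      proof (cases "p dvd q")
        case True
        have "\<not> coprime p q" using True p by (metis coprime_absorb_left mem_Collect_eq not_prime_unit)
        hence chi0: "chi p = 0" using chi by (auto simp: dirichlet_character_def)
        have "(1 - e p * Re (cis (t * ln (real p)))) / real p \<le> 2"
        proof -
          have "\<bar>e p * Re (cis (t * ln (real p)))\<bar> \<le> 1" by (simp add: e_def)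
          hence "1 - e p * Re (cis (t * ln (real p))) \<le> 2 * 1" by linarith
          also have "\<dots> \<le> 2 * real p" using p prime_ge_1_nat[of p] by (intro mult_left_mono) auto
          finally show ?thesis using p prime_gt_0_nat[of p] by (simp add: divide_le_eq)
        qed
        hence "(1 - e p * Re (cis (t * ln (real p)))) / real p - 2 \<le> 0" by simp
        also have "0 \<le> 1 / real p" by simp
        finally have "(1 - e p * Re (cis (t * ln (real p)))) / real p - 2 \<le> 1 / real p" .
        thus ?thesis using True chi0 by simp
      next
        case False
        hence "coprime p q" using p by (simp add: prime_imp_coprime)
        thus ?thesis using prin False by simp
      qed
    qed
    moreover have "(\<Sum>p\<in>primes_le X. if p dvd q then 2 else 0) \<le> 2 * \<bar>Q\<bar>"
    proof -
      have "(\<Sum>p\<in>primes_le X. if p dvd q then 2 else 0) = (\<Sum>p\<in>D. 2 :: real)"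
        unfolding D_def by (rule sum.inter_filter[symmetric]) simp
      also have "\<dots> = 2 * real (card D)" by simp
      also have "card D \<le> q" using card_mono[OF _ D] by simp
      finally show ?thesis using q by simp
    qed
    ultimately show "twist P (\<lambda>p. chi p * cis (t * ln (real p))) X \<ge> K"
      using elim t by force
  qed
qed

section \<open>All characters at large height\<close>

lemma one_minus_Re_power_le:
  fixes z :: complex
  assumes "norm z = 1"
  shows "1 - Re (z ^ m) \<le> (real m)\<^sup>2 * (1 - Re z)"
proof -
  have sq: "(norm (w - 1))\<^sup>2 = 2 * (1 - Re w)" if "norm w = 1" for w :: complex
  proof -
    have "(Re w)\<^sup>2 + (Im w)\<^sup>2 = 1" using that by (metis cmod_power2 one_power2)
    thus ?thesis unfolding cmod_power2 by (simp add: power2_eq_square algebra_simps)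
  qed
  \<comment> \<open>Since |w - 1|^2 = 2 (1 - Re w) on the unit circle, squaring this Lipschitz bound
    gives the factor m^2.\<close>
  have "norm (z ^ m - 1 ^ m) \<le> real m * norm (z - 1)" by (rule norm_power_diff) (use assms in auto)
  hence "(norm (z ^ m - 1))\<^sup>2 \<le> (real m * norm (z - 1))\<^sup>2" by (intro power_mono) auto
  hence "2 * (1 - Re (z ^ m)) \<le> 2 * ((real m)\<^sup>2 * (1 - Re z))"
    using sq[of z] sq[of "z ^ m"] assms by (simp add: norm_power power_mult_distrib algebra_simps)
  thus ?thesis by simp
qed

text \<open>Passing to the power m = totient q replaces the values of \<open>g\<close> by p^(imt)
  and costs the factor m^2 \<le> Q^2. On the range up from X^(1/k) the main term is ln k, the
  cosines are bounded and \<open>P\<close> takes at most (ln k) / 2 + O(1), so k is chosen with (ln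
  k) / 2 above Q^2 |K| plus these constants.\<close>

lemma twist_large_frequency_large:
  assumes P: "P \<subseteq> {p. prime p}" and dens: "zero_relative_density P" and Q: "Q \<ge> 1"
  shows "\<forall>\<^sub>F X in at_top. \<forall>q chi t. real q \<le> Q \<longrightarrow> dirichlet_character q chi \<longrightarrow>
     2 \<le> \<bar>t\<bar> \<longrightarrow> \<bar>t\<bar> \<le> X \<longrightarrow> twist P (\<lambda>p. chi p * cis (t * ln (real p))) X \<ge> K"
proof -
  obtain y0 where y0: "y0 \<ge> exp 2" and sparse: "\<And>y X. y \<ge> y0 \<Longrightarrow> X \<ge> y \<Longrightarrow>
      recip_sum P y X \<le> ln (ln X / ln y) / 4 + mertens_const / 2 + 1 / 4"
    using sparse_recip_sum_ln[OF P dens, of "1 / 4"] by (auto simp: field_simps)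
  \<comment> \<open>2 + 2 + 1 Mertens constants from the main term, the cosines and
    \<open>P\<close>; 29 + 1/2 is rounded up.\<close>
  define C1 where "C1 = 5 * mertens_const + 30"
  have "\<forall>\<^sub>F x in at_top. 2 * (Q\<^sup>2 * \<bar>K\<bar>) + 2 * C1 \<le> ln (x::real)" using ln_at_top by (simp add: filterlim_at_top)
  then obtain x0 where x0: "\<And>x. x \<ge> x0 \<Longrightarrow> 2 * (Q\<^sup>2 * \<bar>K\<bar>) + 2 * C1 \<le> ln (x::real)" by (auto simp: eventually_at_top_linorder)
  define k where "k = max 2 (nat \<lceil>x0\<rceil>)"
  have k: "k \<ge> 2" "real k \<ge> x0" by (auto simp: k_def) linarith
  have lnk: "2 * (Q\<^sup>2 * \<bar>K\<bar>) + 2 * C1 \<le> ln (real k)" by (rule x0) (rule k)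
  \<comment> \<open>Primes above \<open>Q\<close> cannot divide \<open>q\<close>; above
    \<open>y0\<close> the sparseness bound is available.\<close>
  define Z where "Z = max y0 Q"
  show ?thesis using prime_cos_sum_le[OF k(1)] eventually_ge_at_top[of "Z ^ k"] eventually_ge_at_top[of Q]
      eventually_ge_at_top[of 1]
  proof eventually_elim
    case (elim X)
    have Z0: "Z \<ge> exp 2" "Z \<ge> y0" "Z \<ge> Q" using y0 by (auto simp: Z_def)
    have Zp: "Z > 0" using Z0(1) exp_gt_zero[of 2] by linarith
    define z where "z = X powr (1 / k)"
    have zZ: "z \<ge> Z"
    proof -
      have "(Z ^ k) powr (1 / k) \<le> z" unfolding z_def using elim(2) Zp by (intro powr_mono2) auto
      moreover have "(Z ^ k) powr (1 / k) = Z"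
        using Zp k by (simp add: powr_realpow[symmetric] powr_powr)
      ultimately show ?thesis by simp
    qed
    have zX: "z \<le> X"
    proof -
      have "z \<le> X powr 1" unfolding z_def using elim(4) k by (intro powr_mono) auto
      thus ?thesis using elim(4) by simp
    qed
    have z2: "exp 2 \<le> z" using zZ Z0 by linarith
    have lz: "ln z \<ge> 2" by (rule ln_ge_2[OF z2])
    have lnXz: "ln X / ln z = k"
    proof -
      have "ln X = k * ln z" using elim(4) k by (simp add: z_def ln_powr)
      thus ?thesis using lz by simp
    qed
    show ?case
    proof (intro allI impI)
      fix q :: nat and chi :: "nat \<Rightarrow> complex" and t :: real assume q: "real q \<le> Q" and chi: "dirichlet_character q chi" and t: "2 \<le> \<bar>t\<bar>" "\<bar>t\<bar> \<le> X"
      define m where "m = totient q"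
      have q0: "q > 0" using chi by (simp add: dirichlet_character_def)
      have m: "m \<ge> 1" "m \<le> q" using q0 totient_le[of q] by (auto simp: m_def Suc_le_eq)
      have mQ: "real m \<le> Q" using m q by linarith
      define g where "g p = chi p * cis (t * ln (real p))" for p
      have g: "norm (g p) \<le> 1" for p
        using norm_dirichlet_character_le[OF chi] by (simp add: g_def norm_mult)
      define R where "R = {p. prime p \<and> z < real p \<and> real p \<le> X}"
      define c where "c p = cos (real m * t * ln (real p))" for p :: nat
      define e where "e p = (if p \<in> P then 2 / real p else 0)" for p
      have each: "((1 - c p) / real p - e p) / (real m)\<^sup>2 \<le> (1 - (if p \<in> P then -1 else 1) * Re (g p)) / real p"
        if p: "p \<in> R" for p
      proof (cases "p \<in> P")
        case True
        \<comment> \<open>On \<open>P\<close> the loss 2 / p makes the left-hand side nonpositive,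
          while the term of the twist is nonnegative.\<close>
        have "(1 - c p) / real p - 2 / real p = (- 1 - c p) / real p" by (simp only: diff_divide_distrib[symmetric]) simp
        also have "\<dots> \<le> 0" by (intro divide_nonpos_nonneg) (auto simp: c_def)
        finally have "((1 - c p) / real p - e p) / (real m)\<^sup>2 \<le> 0"
          using True by (simp add: e_def divide_nonpos_nonneg)
        also have "0 \<le> (1 - (if p \<in> P then -1 else 1) * Re (g p)) / real p" by (rule twist_term_nonneg) (rule g)
        finally show ?thesis .
      next
        case False
        have pp: "prime p" "real p > real q" using p q zZ Z0 by (auto simp: R_def)
        have "\<not> p dvd q" using pp q0 by (auto dest: dvd_imp_le)
        hence cop: "coprime p q" using pp by (simp add: prime_imp_coprime)
        have chim: "chi p ^ m = 1" unfolding m_def by (rule dirichlet_character_root_of_unity[OF chi cop])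
        have "norm (chi p) ^ m = 1" using chim by (metis norm_one norm_power)
        hence "norm (chi p) = 1" using m power_eq_imp_eq_base[of "norm (chi p)" m 1] by simp
        hence ng: "norm (g p) = 1" by (simp add: g_def norm_mult)
        have "Re (g p ^ m) = c p" by (simp add: g_def power_mult_distrib chim Complex.DeMoivre c_def mult.assoc)
        hence "1 - c p \<le> (real m)\<^sup>2 * (1 - Re (g p))" using one_minus_Re_power_le[OF ng, of m] by simp
        hence "(1 - c p) / (real m)\<^sup>2 \<le> 1 - Re (g p)" using m by (simp add: divide_le_eq mult.commute)
        hence "(1 - c p) / (real m)\<^sup>2 / real p \<le> (1 - Re (g p)) / real p" by (intro divide_right_mono) auto
        thus ?thesis using False by (simp add: e_def mult.commute)
      qed
      have "(\<Sum>p\<in>R. ((1 - c p) / real p - e p) / (real m)\<^sup>2) \<le> (\<Sum>p\<in>R. (1 - (if p \<in> P then -1 else 1) * Re (g p)) / real p)"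
        by (intro sum_mono each)
      also have "\<dots> \<le> twist P g X"
        unfolding twist_def using g by (intro sum_mono2 twist_term_nonneg) (auto simp: R_def)
      finally have 1: "(\<Sum>p\<in>R. (1 - c p) / real p - e p) / (real m)\<^sup>2 \<le> twist P g X"
        by (simp add: sum_divide_distrib)
      have "(\<Sum>p\<in>R. (1 - c p) / real p - e p) = (\<Sum>p\<in>R. 1 / real p) - (\<Sum>p\<in>R. c p / real p) - (\<Sum>p\<in>R. e p)"
        by (simp add: diff_divide_distrib sum_subtractf)
      moreover have "(\<Sum>p\<in>R. 1 / real p) \<ge> ln (real k) - 2 * mertens_const"
        using recip_sum_primes_le[OF z2 zX] unfolding lnXz recip_sum_def R_def by simp
      moreover have "(\<Sum>p\<in>R. c p / real p) \<le> 2 * mertens_const + 29"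
      proof -
        have "2 \<le> \<bar>real m * t\<bar>"
          using m t mult_mono[of 1 "real m" 2 "\<bar>t\<bar>"] by (simp add: abs_mult)
        \<comment> \<open>The power multiplies the height by \<open>m\<close>, which is at most Q
          \<le> X; hence cosine sums up to height X^2.\<close>
        moreover have "\<bar>real m * t\<bar> \<le> X\<^sup>2"
          using mQ t elim(3) mult_mono[of "real m" X "\<bar>t\<bar>" X] by (simp add: abs_mult power2_eq_square)
        ultimately show ?thesis using elim(1) unfolding R_def c_def z_def by blast
      qed
      moreover have "(\<Sum>p\<in>R. e p) \<le> ln (real k) / 2 + mertens_const + 1 / 2"
      proof -
        have "(\<Sum>p\<in>R. e p) = 2 * recip_sum P z X"
          unfolding R_def e_def by (rule sum_two_over_primes[OF P])
        also have "\<dots> \<le> 2 * (ln (ln X / ln z) / 4 + mertens_const / 2 + 1 / 4)"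
          using zZ Z0 zX by (intro mult_left_mono sparse) auto
        finally show ?thesis unfolding lnXz by simp
      qed
      ultimately have "(\<Sum>p\<in>R. (1 - c p) / real p - e p) \<ge> 1 / 2 * ln (real k) - C1"
        unfolding C1_def by linarith
      hence "(\<Sum>p\<in>R. (1 - c p) / real p - e p) \<ge> Q\<^sup>2 * \<bar>K\<bar>" using lnk by linarith
      moreover have "(real m)\<^sup>2 * \<bar>K\<bar> \<le> Q\<^sup>2 * \<bar>K\<bar>" using mQ by (intro mult_right_mono power_mono) auto
      ultimately have "\<bar>K\<bar> \<le> (\<Sum>p\<in>R. (1 - c p) / real p - e p) / (real m)\<^sup>2"
        using m by (simp add: le_divide_eq mult.commute)
      hence "twist P g X \<ge> K" using 1 by linarith
      thus "twist P (\<lambda>p. chi p * cis (t * ln (real p))) X \<ge> K" by (simp add: g_def[abs_def])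
    qed
  qed
qed



section \<open>Divisor sums over sparse sets of primes\<close>

lemma prod_primes_dvd:
  fixes A :: "nat set"
  assumes "finite A" "\<And>p. p \<in> A \<Longrightarrow> prime p" "\<And>p. p \<in> A \<Longrightarrow> p dvd n"
  shows "\<Prod>A dvd n"
  using assms
proof (induction A rule: finite_induct)
  case (insert p A)
  have "coprime p (\<Prod>A)"
    by (rule prod_coprime_right) (use insert in \<open>metis insert_iff primes_coprime\<close>)
  thus ?case using insert by (simp add: divides_mult)
qed simp

text \<open>Erdos's argument: for n = 2 m + 1 the primes in (m + 1, n] divide the binomial
  coefficient n over m, which is at most 4^m because it occurs twice in a row of sum 2^n. The primes
  up to m + 1 are left to the induction.\<close>

lemma primorial_le: "(\<Prod>p | prime p \<and> p \<le> n. p) \<le> (4::nat) ^ n"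
proof (induction n rule: less_induct)
  case (less n)
  consider "n \<le> 2" | "n > 2" "even n" | "n > 2" "odd n" by linarith
  thus ?case
  proof cases
    case 1
    have "{p::nat. prime p \<and> p \<le> n} = (if n = 2 then {2} else {})"
      using 1 by (auto dest: prime_ge_2_nat)
    thus ?thesis by simp
  next
    case 2
    have "{p::nat. prime p \<and> p \<le> n} = {p. prime p \<and> p \<le> n - 1}"
    proof -
      have "\<not> prime n" using 2 primes_dvd_imp_eq[of 2 n] by auto
      hence "p \<le> n - 1" if "prime p" "p \<le> n" for p using that 2 by (cases "p = n") auto
      thus ?thesis by auto
    qed
    moreover have "(4::nat) ^ (n - 1) \<le> 4 ^ n" by (rule power_increasing) auto
    ultimately show ?thesis using less[of "n - 1"] 2 by (auto intro: order_trans)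
  next
    case 3
    then obtain m where m: "n = 2 * m + 1" by (auto elim: oddE)
    have m1: "m \<ge> 1" using 3 m by simp
    define B where "B = {p::nat. prime p \<and> m + 1 < p \<and> p \<le> n}"
    have finB: "finite B" by (auto simp: B_def)
    have "\<Prod>B dvd (n choose m)"
    proof (rule prod_primes_dvd[OF finB])
      fix p assume p: "p \<in> B"
      have "fact n = fact m * fact (n - m) * (n choose m)"
        using binomial_fact_lemma[of m n] m by simp
      moreover have "p dvd fact n" using p by (auto simp: B_def prime_dvd_fact_iff)
      moreover have "\<not> p dvd fact m" "\<not> p dvd fact (n - m)" 
        using p m prime_dvd_fact_iff[of p m] prime_dvd_fact_iff[of p "n - m"] by (simp_all add: B_def del: fact_Suc)
      ultimately show "p dvd (n choose m)" using p by (auto simp: B_def prime_dvd_mult_iff)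
    qed (auto simp: B_def)
    hence "\<Prod>B \<le> (n choose m)" by (rule dvd_imp_le) (use m in simp)
    also have "\<dots> \<le> 4 ^ m"
    proof -
      have ne: "m \<noteq> n - m" using m by simp
      have "n choose m = n choose (n - m)" by (rule binomial_symmetric) (use m in simp)
      hence "2 * (n choose m) = (n choose m) + (n choose (n - m))" by linarith
      also have "\<dots> = (\<Sum>k\<in>{m, n - m}. n choose k)" using ne by simp
      also have "\<dots> \<le> (\<Sum>k\<le>n. n choose k)" by (rule sum_mono2) (use m in auto)
      also have "\<dots> = 2 ^ n" by (rule choose_row_sum)
      also have "\<dots> = 2 * 4 ^ m" by (simp add: m power_mult)
      finally show ?thesis by simp
    qed
    finally have B: "\<Prod>B \<le> 4 ^ m" .
    have "{p::nat. prime p \<and> p \<le> n} = {p. prime p \<and> p \<le> m + 1} \<union> B" using m by (auto simp: B_def)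
    hence "(\<Prod>p | prime p \<and> p \<le> n. p) = (\<Prod>p\<in>{p. prime p \<and> p \<le> m + 1} \<union> B. p)" by (rule arg_cong)
    also have "\<dots> = (\<Prod>p | prime p \<and> p \<le> m + 1. p) * \<Prod>B"
      by (rule prod.union_disjoint) (use finB in \<open>auto simp: B_def\<close>)
    also have "\<dots> \<le> 4 ^ (m + 1) * 4 ^ m" using less[of "m + 1"] B m m1 by (intro mult_mono) auto
    also have "\<dots> = 4 ^ n" by (simp add: m power_add[symmetric] mult_2)
    finally show ?thesis .
  qed
qed

lemma theta_le:
  assumes "P \<subseteq> {p. prime p}"
  shows "(\<Sum>p | p \<in> P \<and> p \<le> n. ln (real p)) \<le> real n * ln 4"
proof -
  have "(\<Sum>p | p \<in> P \<and> p \<le> n. ln (real p)) \<le> (\<Sum>p | prime p \<and> p \<le> n. ln (real p))"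
    using assms by (intro sum_mono2) (auto dest: prime_ge_1_nat)
  also have "\<dots> = ln (\<Prod>p | prime p \<and> p \<le> n. real p)"
    by (subst ln_prod) (auto dest: prime_gt_0_nat)
  also have "(\<Prod>p | prime p \<and> p \<le> n. real p) = real (\<Prod>p | prime p \<and> p \<le> n. p)" by simp
  also have "ln \<dots> \<le> ln (real (4 ^ n))"
  proof (rule ln_mono)
    show "real (\<Prod>p | prime p \<and> p \<le> n. p) \<le> real (4 ^ n)" using primorial_le[of n] by (simp only: of_nat_le_iff)
    show "0 < real (\<Prod>p | prime p \<and> p \<le> n. p)" by (auto intro!: prod_pos dest: prime_gt_0_nat)
  qed
  also have "\<dots> = real n * ln 4" by (simp add: ln_realpow)
  finally show ?thesis .
qed

text \<open>
  Squarefree integers composed of primes of \<open>P\<close> are encoded by their sets of prime factors. On them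
  \<open>lambda_on P\<close> is the Dirichlet convolution of 1 with \<open>(-2) ^ card A\<close>.
\<close>

definition bounded_prime_sets :: "nat set \<Rightarrow> nat \<Rightarrow> nat set set" where
  "bounded_prime_sets P N = {A. A \<subseteq> P \<and> finite A \<and> \<Prod>A \<le> N}"

definition abs_divisor_sum :: "nat set \<Rightarrow> nat \<Rightarrow> real" where
  "abs_divisor_sum P N = (\<Sum>A\<in>bounded_prime_sets P N. 2 ^ card A)"

definition divisor_mean :: "nat set \<Rightarrow> nat \<Rightarrow> real" where
  "divisor_mean P N = (\<Sum>A\<in>bounded_prime_sets P N. (-2) ^ card A / real (\<Prod>A))"

text \<open>The consequence of zero density that the mean value estimates use; it passes to subsets
  by monotonicity, so primes can be taken out of \<open>P\<close>.\<close>

definition sparse_primes :: "nat set \<Rightarrow> bool" where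
  "sparse_primes P \<longleftrightarrow> P \<subseteq> {p. prime p} \<and> (\<forall>\<epsilon>>0. \<forall>\<^sub>F X in at_top. recip_sum P 0 X \<le> \<epsilon> * ln (ln X))"

lemma sparse_primesD:
  "sparse_primes P \<Longrightarrow> \<epsilon> > 0 \<Longrightarrow> \<forall>\<^sub>F X in at_top. recip_sum P 0 X \<le> \<epsilon> * ln (ln X)"
  by (simp add: sparse_primes_def)

lemma sparse_primes_subset:
  assumes "sparse_primes P" "Q \<subseteq> P"
  shows "sparse_primes Q"
  unfolding sparse_primes_def
proof (intro conjI allI impI)
  show "Q \<subseteq> {p. prime p}" using assms by (auto simp: sparse_primes_def)
  fix \<epsilon> :: real assume "\<epsilon> > 0"
  hence "\<forall>\<^sub>F X in at_top. recip_sum P 0 X \<le> \<epsilon> * ln (ln X)" using assms by (simp add: sparse_primes_def)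
  thus "\<forall>\<^sub>F X in at_top. recip_sum Q 0 X \<le> \<epsilon> * ln (ln X)"
    by eventually_elim (rule order_trans[OF recip_sum_mono_set[OF assms(2)]])
qed

lemma prime_prod_pos:
  assumes "P \<subseteq> {p. prime p}" "A \<subseteq> P"
  shows "\<Prod>A > (0::nat)"
  using assms by (intro prod_pos) (auto dest: prime_gt_0_nat)

lemma bounded_prime_sets_subset:
  assumes P: "P \<subseteq> {p. prime p}"
  shows "bounded_prime_sets P N \<subseteq> Pow {p \<in> P. p \<le> N}"
proof
  fix A assume "A \<in> bounded_prime_sets P N"
  hence A: "A \<subseteq> P" "finite A" "\<Prod>A \<le> N" by (auto simp: bounded_prime_sets_def)
  have "p \<le> N" if "p \<in> A" for p
  proof -
    have "p dvd \<Prod>A" using that A by (intro dvd_prodI)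
    hence "p \<le> \<Prod>A" using prime_prod_pos[OF P A(1)] by (rule dvd_imp_le)
    thus ?thesis using A by simp
  qed
  thus "A \<in> Pow {p \<in> P. p \<le> N}" using A by auto
qed

lemma finite_bounded_prime_sets: "P \<subseteq> {p. prime p} \<Longrightarrow> finite (bounded_prime_sets P N)"
  by (rule finite_subset[OF bounded_prime_sets_subset]) auto

lemma abs_divisor_sum_nonneg: "abs_divisor_sum P N \<ge> 0"
  unfolding abs_divisor_sum_def by (intro sum_nonneg) auto

text \<open>The sum is part of the expansion of the product of 1 + 2 / p over the primes of
  \<open>P\<close> up to \<open>N\<close>.\<close>

lemma weighted_reciprocal_sum_le:
  assumes P: "P \<subseteq> {p. prime p}"
  shows "(\<Sum>A\<in>bounded_prime_sets P N. 2 ^ card A / real (\<Prod>A)) \<le> exp (2 * recip_sum P 0 (real N))"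
proof -
  define F where "F = {p \<in> P. p \<le> N}"
  have finF: "finite F" by (simp add: F_def)
  have "(\<Sum>A\<in>bounded_prime_sets P N. 2 ^ card A / real (\<Prod>A)) \<le> (\<Sum>A\<in>Pow F. 2 ^ card A / real (\<Prod>A))"
  proof (rule sum_mono2)
    show "finite (Pow F)" using finF by simp
    show "bounded_prime_sets P N \<subseteq> Pow F" unfolding F_def by (rule bounded_prime_sets_subset[OF P])
    show "0 \<le> 2 ^ card A / real (\<Prod>A)" for A
      by (rule divide_nonneg_nonneg[OF _ of_nat_0_le_iff]) simp
  qed
  also have "\<dots> = (\<Sum>A\<in>Pow F. (\<Prod>p\<in>A. 2 / real p) * (\<Prod>p\<in>F - A. 1))"
    by (intro sum.cong) (auto simp: prod_dividef)
  also have "\<dots> = (\<Prod>p\<in>F. 2 / real p + 1)" by (rule prod_add[OF finF, symmetric])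
  also have "\<dots> \<le> (\<Prod>p\<in>F. exp (2 / real p))"
    by (intro prod_mono) (auto simp: add.commute)
  also have "\<dots> = exp (\<Sum>p\<in>F. 2 / real p)" by (rule exp_sum[OF finF, symmetric])
  also have "(\<Sum>p\<in>F. 2 / real p) = 2 * recip_sum P 0 (real N)"
  proof -
    have "F = {p. p \<in> P \<and> 0 < real p \<and> real p \<le> real N}" using P by (auto simp: F_def dest: prime_gt_0_nat)
    thus ?thesis by (simp add: recip_sum_def sum_distrib_left)
  qed
  finally show ?thesis .
qed

text \<open>Write ln d as the sum of ln p over the primes p of d, put d = p e, and sum over p \<le>
  N / e first: Chebyshev's bound gives at most (ln 4) N / e.\<close>

lemma weighted_log_sum_le:
  assumes P: "P \<subseteq> {p. prime p}"
  shows "(\<Sum>A\<in>bounded_prime_sets P N. 2 ^ card A * ln (real (\<Prod>A))) \<le> 2 * ln 4 * real N * (\<Sum>A\<in>bounded_prime_sets P N. 2 ^ card A / real (\<Prod>A))"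
proof -
  have fin: "finite (bounded_prime_sets P N)" by (rule finite_bounded_prime_sets[OF P])
  \<comment> \<open>\<open>T\<close> strips one prime from a set and records it;
    \<open>\<phi>\<close> is the summand in the new variables, its factor 2 standing for the
    stripped prime.\<close>
  define T where "T = (\<lambda>(A, p::nat). (A - {p}, p))"
  define \<phi> where "\<phi> = (\<lambda>(B::nat set, p::nat). 2 * 2 ^ card B * ln (real p))"
  define S where "S = Sigma (bounded_prime_sets P N) (\<lambda>A. A)"
  define S' where "S' = Sigma (bounded_prime_sets P N) (\<lambda>B. {p. p \<in> P \<and> p \<le> N div \<Prod>B})"
  have A: "A \<subseteq> P" "finite A" "\<Prod>A \<le> N" if "A \<in> bounded_prime_sets P N" for A using that by (auto simp: bounded_prime_sets_def)
  have "(\<Sum>A\<in>bounded_prime_sets P N. 2 ^ card A * ln (real (\<Prod>A))) = (\<Sum>A\<in>bounded_prime_sets P N. \<Sum>p\<in>A. 2 ^ card A * ln (real p))"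
  proof (rule sum.cong[OF refl])
    fix B assume B: "B \<in> bounded_prime_sets P N"
    have "ln (\<Prod>p\<in>B. real p) = (\<Sum>p\<in>B. ln (real p))"
      using A[OF B] P by (intro ln_prod) (auto dest: prime_gt_0_nat)
    thus "2 ^ card B * ln (real (\<Prod>B)) = (\<Sum>p\<in>B. 2 ^ card B * ln (real p))"
      by (simp add: sum_distrib_left)
  qed
  also have "\<dots> = (\<Sum>(A, p)\<in>S. 2 ^ card A * ln (real p))"
    unfolding S_def by (rule sum.Sigma) (use fin A in auto)
  also have "\<dots> = (\<Sum>x\<in>S. \<phi> (T x))"
  proof (rule sum.cong[OF refl])
    fix x assume "x \<in> S"
    then obtain B p where x: "x = (B, p)" "B \<in> bounded_prime_sets P N" "p \<in> B" by (auto simp: S_def)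
    have "card B = Suc (card (B - {p}))" by (rule card.remove[OF A(2)[OF x(2)] x(3)])
    hence "2 ^ card B = 2 * (2 :: real) ^ card (B - {p})" by (metis power_Suc)
    thus "(case x of (A, p) \<Rightarrow> 2 ^ card A * ln (real p)) = \<phi> (T x)"
      by (simp only: x \<phi>_def T_def prod.case)
  qed
  also have "\<dots> = (\<Sum>x\<in>T ` S. \<phi> x)"
  proof (rule sum.reindex_cong[symmetric, of T])
    show "inj_on T S" by (auto simp: inj_on_def T_def S_def)
  qed auto
  also have "\<dots> \<le> (\<Sum>x\<in>S'. \<phi> x)"
  proof (rule sum_mono2)
    show "finite S'" unfolding S'_def by (intro finite_SigmaI fin) auto
    show "T ` S \<subseteq> S'"
    proof
      fix y assume "y \<in> T ` S"
      then obtain B p where y: "y = (B - {p}, p)" "B \<in> bounded_prime_sets P N" "p \<in> B" by (auto simp: S_def T_def)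
      have eq: "\<Prod>B = p * \<Prod>(B - {p})" using prod.remove[OF A(2)[OF y(2)] y(3), of "\<lambda>x. x"] by simp
      have pos: "\<Prod>(B - {p}) > 0" using A(1)[OF y(2)] by (intro prime_prod_pos[OF P]) auto
      have p0: "p > 0" using y A(1)[OF y(2)] P by (auto dest: prime_gt_0_nat)
      have "p * \<Prod>(B - {p}) \<le> N" using A(3)[OF y(2)] eq by simp
      hence "p \<le> N div \<Prod>(B - {p})" using pos by (simp add: less_eq_div_iff_mult_less_eq)
      moreover have "\<Prod>(B - {p}) \<le> N"
      proof -
        have "1 * \<Prod>(B - {p}) \<le> p * \<Prod>(B - {p})" using p0 by (intro mult_right_mono) auto
        also have "\<dots> \<le> N" using A(3)[OF y(2)] unfolding eq .
        finally show ?thesis by simp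
      qed
      ultimately show "y \<in> S'" using y A[OF y(2)] by (auto simp: S'_def bounded_prime_sets_def)
    qed
    show "0 \<le> \<phi> b" if "b \<in> S' - T ` S" for b
    proof -
      have "b \<in> S'" using that by simp
      then obtain B p where b: "b = (B, p)" "p \<in> P" by (auto simp: S'_def)
      hence "real p \<ge> 1" using P prime_ge_1_nat[of p] by auto
      thus ?thesis by (simp add: b \<phi>_def)
    qed
  qed
  also have "(\<Sum>x\<in>S'. \<phi> x) = (\<Sum>B\<in>bounded_prime_sets P N. \<Sum>p | p \<in> P \<and> p \<le> N div \<Prod>B. 2 * 2 ^ card B * ln (real p))"
    unfolding S'_def \<phi>_def by (rule sum.Sigma[symmetric]) (use fin in auto)
  also have "\<dots> \<le> (\<Sum>B\<in>bounded_prime_sets P N. 2 * ln 4 * real N * (2 ^ card B / real (\<Prod>B)))"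
  proof (rule sum_mono)
    fix B assume B: "B \<in> bounded_prime_sets P N"
    have pos: "\<Prod>B > 0" using A(1)[OF B] by (rule prime_prod_pos[OF P])
    have "(\<Sum>p | p \<in> P \<and> p \<le> N div \<Prod>B. 2 * 2 ^ card B * ln (real p)) = 2 * 2 ^ card B * (\<Sum>p | p \<in> P \<and> p \<le> N div \<Prod>B. ln (real p))"
      by (rule sum_distrib_left[symmetric])
    also have "\<dots> \<le> 2 * 2 ^ card B * (real (N div \<Prod>B) * ln 4)"
      by (intro mult_left_mono theta_le[OF P]) auto
    also have "\<dots> \<le> 2 * 2 ^ card B * (real N / real (\<Prod>B) * ln 4)"
      using of_nat_div_le_of_nat[of N "\<Prod>B", where 'a = real] by (intro mult_left_mono mult_right_mono) auto
    finally show "(\<Sum>p | p \<in> P \<and> p \<le> N div \<Prod>B. 2 * 2 ^ card B * ln (real p)) \<le> 2 * ln 4 * real N * (2 ^ card B / real (\<Prod>B))"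
      by (simp add: mult_ac)
  qed
  also have "\<dots> = 2 * ln 4 * real N * (\<Sum>A\<in>bounded_prime_sets P N. 2 ^ card A / real (\<Prod>A))" by (rule sum_distrib_left[symmetric])
  finally show ?thesis .
qed

text \<open>The weight 1 is at most sqrt N / d for d \<le> sqrt N and at most 2 ln d / ln N beyond.
  The logarithmic sum then gains a factor ln N over the trivial bound, \<open>N\<close> times the
  weighted reciprocal sum.\<close>

lemma abs_divisor_sum_le:
  assumes P: "P \<subseteq> {p. prime p}" and N: "N \<ge> 2"
  shows "abs_divisor_sum P N \<le> exp (2 * recip_sum P 0 (real N)) * (sqrt (real N) + 4 * ln 4 * real N / ln (real N))"
proof -
  define E where "E = (\<Sum>A\<in>bounded_prime_sets P N. 2 ^ card A / real (\<Prod>A))"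
  have lN: "ln (real N) > 0" using N by simp
  have pos: "real (\<Prod>A) > 0" "real (\<Prod>A) \<ge> 1" if "A \<in> bounded_prime_sets P N" for A
  proof -
    have "\<Prod>A > 0" using that by (intro prime_prod_pos[OF P]) (auto simp: bounded_prime_sets_def)
    thus "real (\<Prod>A) > 0" "real (\<Prod>A) \<ge> 1" by linarith+
  qed
  have "abs_divisor_sum P N \<le> (\<Sum>A\<in>bounded_prime_sets P N. sqrt (real N) * (2 ^ card A / real (\<Prod>A)) + 2 / ln (real N) * (2 ^ card A * ln (real (\<Prod>A))))"
    unfolding abs_divisor_sum_def
  proof (rule sum_mono)
    fix A assume A: "A \<in> bounded_prime_sets P N"
    define d where "d = real (\<Prod>A)"
    have d: "d \<ge> 1" using pos[OF A] by (simp add: d_def)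
    have "1 \<le> sqrt (real N) / d + 2 / ln (real N) * ln d"
    proof (cases "d \<le> sqrt (real N)")
      case True
      hence "1 \<le> sqrt (real N) / d" using d by simp
      moreover have "0 \<le> 2 / ln (real N) * ln d" using d lN by simp
      ultimately show ?thesis by linarith
    next
      case False
      have "ln (sqrt (real N)) \<le> ln d" using False N by (intro ln_mono) auto
      hence "ln (real N) \<le> 2 * ln d" using N by (simp add: ln_sqrt)
      hence "1 \<le> 2 / ln (real N) * ln d" using lN by (simp add: field_simps)
      moreover have "0 \<le> sqrt (real N) / d" using d by simp
      ultimately show ?thesis by linarith
    qed
    hence "2 ^ card A * 1 \<le> 2 ^ card A * (sqrt (real N) / d + 2 / ln (real N) * ln d)" by (intro mult_left_mono) auto
    also have "\<dots> = sqrt (real N) * (2 ^ card A / d) + 2 / ln (real N) * (2 ^ card A * ln d)" by (simp add: field_simps)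
    finally show "2 ^ card A \<le> sqrt (real N) * (2 ^ card A / real (\<Prod>A)) + 2 / ln (real N) * (2 ^ card A * ln (real (\<Prod>A)))"
      by (simp add: d_def)
  qed
  also have "\<dots> = sqrt (real N) * E + 2 / ln (real N) * (\<Sum>A\<in>bounded_prime_sets P N. 2 ^ card A * ln (real (\<Prod>A)))"
    by (simp add: sum.distrib sum_distrib_left E_def)
  also have "\<dots> \<le> sqrt (real N) * E + 2 / ln (real N) * (2 * ln 4 * real N * E)"
    using weighted_log_sum_le[OF P, of N] lN unfolding E_def by (intro add_left_mono mult_left_mono) auto
  also have "\<dots> = E * (sqrt (real N) + 4 * ln 4 * real N / ln (real N))" by (simp add: field_simps)
  also have "\<dots> \<le> exp (2 * recip_sum P 0 (real N)) * (sqrt (real N) + 4 * ln 4 * real N / ln (real N))"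
    using weighted_reciprocal_sum_le[OF P, of N] lN unfolding E_def by (intro mult_right_mono) auto
  finally show ?thesis .
qed

text \<open>Sparseness keeps the exponential factor below sqrt (ln N), less than the ln N
  gained.\<close>

lemma abs_divisor_sum_little_o:
  assumes "sparse_primes P"
  shows "(\<lambda>N. abs_divisor_sum P N / real N) \<longlonglongrightarrow> 0"
proof -
  have P: "P \<subseteq> {p. prime p}" using assms by (simp add: sparse_primes_def)
  define u where "u x = exp (1 / 2 * ln (ln x)) * (1 / sqrt x + 4 * ln 4 / ln x)" for x :: real
  have "(u \<longlongrightarrow> 0) at_top" unfolding u_def by real_asymp
  hence lim: "(\<lambda>N. u (real N)) \<longlonglongrightarrow> 0" by (rule filterlim_compose) (rule filterlim_real_sequentially)
  have "\<forall>\<^sub>F X in at_top. recip_sum P 0 X \<le> 1 / 4 * ln (ln X)" by (rule sparse_primesD[OF assms]) simp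
  hence ev: "\<forall>\<^sub>F N in sequentially. recip_sum P 0 (real N) \<le> 1 / 4 * ln (ln (real N))"
    using filterlim_real_sequentially by (rule eventually_compose_filterlim)
  have "\<forall>\<^sub>F N in sequentially. norm (abs_divisor_sum P N / real N) \<le> u (real N)"
    using ev eventually_ge_at_top[of 2]
  proof eventually_elim
    case (elim N)
    have lN: "ln (real N) > 0" using elim(2) by simp
    have "abs_divisor_sum P N \<le> exp (2 * recip_sum P 0 (real N)) * (sqrt (real N) + 4 * ln 4 * real N / ln (real N))"
      by (rule abs_divisor_sum_le[OF P elim(2)])
    also have "\<dots> \<le> exp (1 / 2 * ln (ln (real N))) * (sqrt (real N) + 4 * ln 4 * real N / ln (real N))"
      using elim(1) lN by (intro mult_right_mono) auto
    also have "\<dots> = u (real N) * real N"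
    proof -
      have "sqrt (real N) = 1 / sqrt (real N) * real N" using real_div_sqrt[of "real N"] by simp
      hence "sqrt (real N) + 4 * ln 4 * real N / ln (real N) = (1 / sqrt (real N) + 4 * ln 4 / ln (real N)) * real N"
        by (simp add: distrib_right)
      thus ?thesis by (simp add: u_def)
    qed
    finally show ?case using elim(2) abs_divisor_sum_nonneg[of P N] by (simp add: divide_le_eq)
  qed
  thus ?thesis using lim by (rule Lim_null_comparison)
qed



section \<open>Means along arithmetic progressions\<close>

text \<open>As \<open>d\<close> is coprime to \<open>a\<close>, the values a n + b for
  \<open>d\<close> consecutive \<open>n\<close> meet every residue modulo \<open>d\<close>
  once.\<close>

lemma finite_sol_block:
  fixes a b d m :: nat
  assumes "coprime d a" "d > 0"
  shows "card {n \<in> {m..<m + d}. d dvd a * n + b} = 1"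
    "r \<le> d \<Longrightarrow> card {n \<in> {m..<m + r}. d dvd a * n + b} \<le> 1"
proof -
  let ?h = "\<lambda>n. (a * n + b) mod d"
  have inj: "inj_on ?h {m..<m + d}"
  proof (rule inj_onI)
    fix x y assume x: "x \<in> {m..<m + d}" and y: "y \<in> {m..<m + d}" and eq: "?h x = ?h y"
    have "[a * x + b = a * y + b] (mod d)" using eq by (simp add: cong_def)
    hence "[a * x = a * y] (mod d)" by (simp add: cong_add_rcancel_nat)
    hence c: "[x = y] (mod d)" using assms(1) cong_mult_lcancel_nat[of a d x y] by (simp add: coprime_commute)
    show "x = y"
    proof (rule ccontr)
      assume "x \<noteq> y"
      then consider "x < y" | "y < x" by linarith
      thus False
      proof cases
        case 1
        have "d dvd y - x" using cong_altdef_nat[of x y d] c 1 by (simp add: cong_sym_eq cong_altdef_nat)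
        thus False using x y 1 by (auto dest!: dvd_imp_le)
      next
        case 2
        have "d dvd x - y" using cong_altdef_nat[of y x d] c 2 by (simp add: cong_altdef_nat)
        thus False using x y 2 by (auto dest!: dvd_imp_le)
      qed
    qed
  qed
  have "?h ` {m..<m + d} \<subseteq> {..<d}" using assms(2) by auto
  moreover have "card (?h ` {m..<m + d}) = d" using card_image[OF inj] by simp
  ultimately have im: "?h ` {m..<m + d} = {..<d}" using card_subset_eq[of "{..<d}"] by simp
  have "0 \<in> ?h ` {m..<m + d}" unfolding im using assms(2) by simp
  then obtain x where x: "x \<in> {m..<m + d}" "?h x = 0" by (elim imageE) simp
  have "{n \<in> {m..<m + d}. d dvd a * n + b} = {x}"
  proof (intro equalityI subsetI)
    fix y assume y: "y \<in> {n \<in> {m..<m + d}. d dvd a * n + b}"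
    hence h: "?h y = ?h x" and ym: "y \<in> {m..<m + d}" using x(2) by (simp_all add: dvd_eq_mod_eq_0)
    have "y = x" by (rule inj_onD[OF inj h ym x(1)])
    thus "y \<in> {x}" by simp
  qed (use x in \<open>auto simp: dvd_eq_mod_eq_0\<close>)
  thus "card {n \<in> {m..<m + d}. d dvd a * n + b} = 1" by simp
  assume r: "r \<le> d"
  have "card {n \<in> {m..<m + r}. d dvd a * n + b} \<le> card {n \<in> {m..<m + d}. d dvd a * n + b}"
    using r by (intro card_mono) auto
  thus "card {n \<in> {m..<m + r}. d dvd a * n + b} \<le> 1"
    using \<open>card {n \<in> {m..<m + d}. d dvd a * n + b} = 1\<close> by simp
qed

lemma card_progression_multiples:
  fixes a b d N :: nat
  assumes "coprime d a" "d > 0"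
  shows "\<bar>real (card {n \<in> {1..N}. d dvd a * n + b}) - real N / real d\<bar> \<le> 1"
proof -
  define c where "c k = card {n \<in> {1..<1 + k}. d dvd a * n + b}" for k
  have step: "c (q * d) = q" for q
  proof (induction q)
    case (Suc q)
    have eq: "{n \<in> {1..<1 + Suc q * d}. d dvd a * n + b} = {n \<in> {1..<1 + q * d}. d dvd a * n + b} \<union> {n \<in> {1 + q * d..<1 + q * d + d}. d dvd a * n + b}"
      by auto
    have "c (Suc q * d) = c (q * d) + card {n \<in> {1 + q * d..<1 + q * d + d}. d dvd a * n + b}"
      unfolding c_def eq by (rule card_Un_disjoint) auto
    thus ?case using Suc finite_sol_block(1)[OF assms, of "1 + q * d" b] by simp
  qed (simp add: c_def)
  define q where "q = N div d"
  define r where "r = N mod d"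
  have N: "N = q * d + r" by (simp add: q_def r_def)
  have r: "r < d" using assms by (simp add: r_def)
  have eq: "{n \<in> {1..<1 + N}. d dvd a * n + b} = {n \<in> {1..<1 + q * d}. d dvd a * n + b} \<union> {n \<in> {1 + q * d..<1 + q * d + r}. d dvd a * n + b}"
    by (auto simp: N)
  have "c N = c (q * d) + card {n \<in> {1 + q * d..<1 + q * d + r}. d dvd a * n + b}"
    unfolding c_def eq by (rule card_Un_disjoint) auto
  hence "q \<le> c N" "c N \<le> q + 1" using step[of q] finite_sol_block(2)[OF assms, of r "1 + q * d" b] r by auto
  hence "real q \<le> real (c N)" "real (c N) \<le> real q + 1" by linarith+
  moreover have "card {n \<in> {1..N}. d dvd a * n + b} = c N"
    unfolding c_def by (rule arg_cong[where f = card]) auto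
  moreover have "real N / real d = real q + real r / real d" using assms by (simp add: N add_divide_distrib)
  moreover have "0 \<le> real r / real d" "real r / real d \<le> 1" using r by (auto simp: divide_le_eq)
  ultimately show ?thesis by linarith
qed

definition lambda_real :: "nat set \<Rightarrow> nat \<Rightarrow> real" where "lambda_real P n = (-1) ^ omega_on P n"

text \<open>The expansion of (1 - 2)^(card F) over subsets.\<close>

lemma sum_Pow_minus_two: "finite F \<Longrightarrow> (\<Sum>A\<in>Pow F. (-2) ^ card A) = ((-1) ^ card F :: real)"
proof -
  assume F: "finite F"
  have "(\<Sum>A\<in>Pow F. (-2) ^ card A) = (\<Sum>A\<in>Pow F. (\<Prod>p\<in>A. -2) * (\<Prod>p\<in>F - A. 1 :: real))"
    by (intro sum.cong) auto
  also have "\<dots> = (\<Prod>p\<in>F. - 2 + 1)" by (rule prod_add[OF F, symmetric])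
  finally show ?thesis by simp
qed

lemma lambda_real_expansion:
  assumes P: "P \<subseteq> {p. prime p}" and n: "0 < n" "n \<le> M"
  shows "lambda_real P n = (\<Sum>A\<in>bounded_prime_sets P M. if \<Prod>A dvd n then (-2) ^ card A else 0)"
proof -
  define F where "F = {p \<in> P. prime p \<and> p dvd n}"
  have finF: "finite F" using n by (auto simp: F_def intro: finite_subset[of _ "{..n}"] dvd_imp_le)
  have "{A \<in> bounded_prime_sets P M. \<Prod>A dvd n} = Pow F"
  proof
    show "{A \<in> bounded_prime_sets P M. \<Prod>A dvd n} \<subseteq> Pow F"
    proof
      fix A assume "A \<in> {A \<in> bounded_prime_sets P M. \<Prod>A dvd n}"
      hence A: "A \<subseteq> P" "finite A" "\<Prod>A dvd n" by (auto simp: bounded_prime_sets_def)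
      have "p dvd n" if "p \<in> A" for p
      proof -
        have "p dvd \<Prod>A" using that A by (intro dvd_prodI)
        thus ?thesis using A(3) by (rule dvd_trans)
      qed
      thus "A \<in> Pow F" using A P by (auto simp: F_def)
    qed
    show "Pow F \<subseteq> {A \<in> bounded_prime_sets P M. \<Prod>A dvd n}"
    proof
      fix A assume "A \<in> Pow F"
      hence A: "A \<subseteq> F" "finite A" using finF finite_subset by auto
      have "\<Prod>A dvd n" by (rule prod_primes_dvd[OF A(2)]) (use A in \<open>auto simp: F_def\<close>)
      moreover from this have "\<Prod>A \<le> M" using n dvd_imp_le[of "\<Prod>A" n] by simp
      ultimately show "A \<in> {A \<in> bounded_prime_sets P M. \<Prod>A dvd n}" using A by (auto simp: bounded_prime_sets_def F_def)
    qed
  qed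
  hence "(\<Sum>A\<in>bounded_prime_sets P M. if \<Prod>A dvd n then (-2) ^ card A else 0) = (\<Sum>A\<in>Pow F. (-2) ^ card A :: real)"
    by (subst sum.inter_filter[symmetric, OF finite_bounded_prime_sets[OF P]]) simp
  also have "\<dots> = lambda_real P n" unfolding sum_Pow_minus_two[OF finF] by (simp add: lambda_real_def omega_on_def F_def)
  finally show ?thesis by simp
qed

text \<open>Each d divides N / d + O(1) of the terms, and the errors carry the weights |h(d)|. As no
  prime of \<open>P\<close> divides \<open>a\<close>, every d is coprime to the modulus.\<close>

lemma sum_lambda_real_progression:
  fixes a b N :: nat
  assumes P: "P \<subseteq> {p. prime p}" and a: "a > 0" "\<And>p. p \<in> P \<Longrightarrow> \<not> p dvd a"
  shows "\<bar>(\<Sum>n=1..N. lambda_real P (a * n + b)) - real N * divisor_mean P (a * N + b)\<bar> \<le> abs_divisor_sum P (a * N + b)"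
proof -
  define M where "M = a * N + b"
  define c where "c A = real (card {n \<in> {1..N}. \<Prod>A dvd a * n + b})" for A
  have "(\<Sum>n=1..N. lambda_real P (a * n + b)) = (\<Sum>n=1..N. \<Sum>A\<in>bounded_prime_sets P M. if \<Prod>A dvd a * n + b then (-2) ^ card A else 0)"
    by (intro sum.cong refl lambda_real_expansion[OF P]) (use a in \<open>auto simp: M_def\<close>)
  also have "\<dots> = (\<Sum>A\<in>bounded_prime_sets P M. \<Sum>n=1..N. if \<Prod>A dvd a * n + b then (-2) ^ card A else 0)" by (rule sum.swap)
  also have "\<dots> = (\<Sum>A\<in>bounded_prime_sets P M. (-2) ^ card A * c A)"
    by (intro sum.cong refl) (simp add: sum.inter_filter[symmetric] c_def)
  finally have "(\<Sum>n=1..N. lambda_real P (a * n + b)) - real N * divisor_mean P M = (\<Sum>A\<in>bounded_prime_sets P M. (-2) ^ card A * (c A - real N / real (\<Prod>A)))"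
    by (simp add: divisor_mean_def sum_distrib_left sum_subtractf right_diff_distrib mult_ac)
  also have "\<bar>\<dots>\<bar> \<le> (\<Sum>A\<in>bounded_prime_sets P M. 2 ^ card A)"
  proof (rule order_trans[OF sum_abs], rule sum_mono)
    fix A assume "A \<in> bounded_prime_sets P M"
    hence A: "A \<subseteq> P" "finite A" by (auto simp: bounded_prime_sets_def)
    have "coprime (\<Prod>A) a"
      by (rule prod_coprime_left) (use A a P in \<open>auto intro!: prime_imp_coprime\<close>)
    hence "\<bar>c A - real N / real (\<Prod>A)\<bar> \<le> 1"
      unfolding c_def using prime_prod_pos[OF P A(1)] by (intro card_progression_multiples)
    hence "2 ^ card A * \<bar>c A - real N / real (\<Prod>A)\<bar> \<le> 2 ^ card A * 1" by (intro mult_left_mono) auto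
    thus "\<bar>(-2) ^ card A * (c A - real N / real (\<Prod>A))\<bar> \<le> 2 ^ card A"
      by (simp add: abs_mult power_abs)
  qed
  finally show ?thesis by (simp add: M_def abs_divisor_sum_def)
qed

text \<open>The expansion is read backwards on the integers up to \<open>N\<close>, where the mean
  of \<open>lambda_real P\<close> is at most 1 in modulus. Termwise estimation would only give the
  exponential of twice the reciprocal sum.\<close>

lemma divisor_mean_bound:
  assumes P: "P \<subseteq> {p. prime p}" and N: "N > 0"
  shows "\<bar>divisor_mean P N\<bar> \<le> 1 + abs_divisor_sum P N / real N"
proof -
  have "\<bar>(\<Sum>n=1..N. lambda_real P (1 * n + 0)) - real N * divisor_mean P (1 * N + 0)\<bar> \<le> abs_divisor_sum P (1 * N + 0)"
    by (rule sum_lambda_real_progression[OF P]) (use P in \<open>auto simp: not_prime_1\<close>)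
  moreover have "\<bar>\<Sum>n=1..N. lambda_real P (1 * n + 0)\<bar> \<le> (\<Sum>n=1..N. 1)"
    by (rule order_trans[OF sum_abs]) (simp add: lambda_real_def power_abs)
  moreover have "\<bar>real N * divisor_mean P N\<bar> = real N * \<bar>divisor_mean P N\<bar>" by (simp add: abs_mult)
  ultimately have "real N * \<bar>divisor_mean P N\<bar> \<le> real N + abs_divisor_sum P N" by simp
  thus ?thesis using N by (simp add: field_simps)
qed

text \<open>The terms that differ have d > N div p, hence 1 / d \<le> p / N. For sparse
  \<open>P\<close> and fixed \<open>p\<close> this bound tends to 0.\<close>

lemma divisor_mean_div_diff:
  assumes P: "P \<subseteq> {p. prime p}" and N: "N > 0" and p: "p > 0"
  shows "\<bar>divisor_mean P N - divisor_mean P (N div p)\<bar> \<le> real p * (abs_divisor_sum P N / real N)"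
proof -
  have fin: "finite (bounded_prime_sets P N)" by (rule finite_bounded_prime_sets[OF P])
  have sub: "bounded_prime_sets P (N div p) \<subseteq> bounded_prime_sets P N"
    using div_le_dividend[of N p] by (auto simp: bounded_prime_sets_def intro: order_trans)
  have "divisor_mean P N - divisor_mean P (N div p) = (\<Sum>A\<in>bounded_prime_sets P N - bounded_prime_sets P (N div p). (-2) ^ card A / real (\<Prod>A))"
    unfolding divisor_mean_def by (rule sum_diff[OF fin sub, symmetric])
  also have "\<bar>\<dots>\<bar> \<le> (\<Sum>A\<in>bounded_prime_sets P N - bounded_prime_sets P (N div p). real p / real N * 2 ^ card A)"
  proof (rule order_trans[OF sum_abs], rule sum_mono)
    fix A assume A: "A \<in> bounded_prime_sets P N - bounded_prime_sets P (N div p)"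
    hence "N div p < \<Prod>A" by (auto simp: bounded_prime_sets_def)
    hence "N < \<Prod>A * p" using p by (simp add: div_less_iff_less_mult)
    hence "real N \<le> real (\<Prod>A) * real p" by (metis less_imp_le of_nat_le_iff of_nat_mult)
    moreover have "\<Prod>A > 0" using A by (intro prime_prod_pos[OF P]) (auto simp: bounded_prime_sets_def)
    ultimately have "1 / real (\<Prod>A) \<le> real p / real N" using N by (simp add: field_simps del: of_nat_prod)
    hence "2 ^ card A * (1 / real (\<Prod>A)) \<le> 2 ^ card A * (real p / real N)" by (intro mult_left_mono) auto
    moreover have "\<bar>(-2) ^ card A / real (\<Prod>A)\<bar> = 2 ^ card A * (1 / real (\<Prod>A))"
      by (simp add: power_abs abs_divide del: of_nat_prod)
    ultimately show "\<bar>(-2) ^ card A / real (\<Prod>A)\<bar> \<le> real p / real N * 2 ^ card A" by (simp add: mult.commute)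
  qed
  also have "\<dots> \<le> (\<Sum>A\<in>bounded_prime_sets P N. real p / real N * 2 ^ card A)"
    using fin by (intro sum_mono2) auto
  also have "\<dots> = real p * (abs_divisor_sum P N / real N)" 
    unfolding abs_divisor_sum_def sum_distrib_left[symmetric] by simp
  finally show ?thesis .
qed

text \<open>The sets are split by whether they contain \<open>p\<close>; removing it lowers the
  bound on the product to \<open>N div p\<close>.\<close>

lemma divisor_mean_insert:
  assumes P: "insert p P \<subseteq> {p. prime p}" and p: "p \<notin> P"
  shows "divisor_mean (insert p P) N = divisor_mean P N - 2 / real p * divisor_mean P (N div p)"
proof -
  have p0: "p > 0" using P prime_gt_0_nat by auto
  have finP: "finite (bounded_prime_sets P N)" "finite (bounded_prime_sets P (N div p))" using P by (auto intro!: finite_bounded_prime_sets)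
  have eq: "bounded_prime_sets (insert p P) N = bounded_prime_sets P N \<union> insert p ` bounded_prime_sets P (N div p)"
  proof
    show "bounded_prime_sets (insert p P) N \<subseteq> bounded_prime_sets P N \<union> insert p ` bounded_prime_sets P (N div p)"
    proof
      fix A assume "A \<in> bounded_prime_sets (insert p P) N"
      hence A: "A \<subseteq> insert p P" "finite A" "\<Prod>A \<le> N" by (auto simp: bounded_prime_sets_def)
      show "A \<in> bounded_prime_sets P N \<union> insert p ` bounded_prime_sets P (N div p)"
      proof (cases "p \<in> A")
        case True
        have "p * \<Prod>(A - {p}) \<le> N" using prod.remove[OF A(2) True, of "\<lambda>x. x"] A(3) by simp
        hence "\<Prod>(A - {p}) \<le> N div p" using p0 by (simp add: less_eq_div_iff_mult_less_eq mult.commute)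
        hence "A - {p} \<in> bounded_prime_sets P (N div p)" using A by (auto simp: bounded_prime_sets_def)
        thus ?thesis using True by (auto simp: insert_absorb image_iff intro!: bexI[of _ "A - {p}"])
      qed (use A in \<open>auto simp: bounded_prime_sets_def\<close>)
    qed
    show "bounded_prime_sets P N \<union> insert p ` bounded_prime_sets P (N div p) \<subseteq> bounded_prime_sets (insert p P) N"
    proof
      fix A assume "A \<in> bounded_prime_sets P N \<union> insert p ` bounded_prime_sets P (N div p)"
      thus "A \<in> bounded_prime_sets (insert p P) N"
      proof
        assume "A \<in> insert p ` bounded_prime_sets P (N div p)"
        then obtain B where B: "A = insert p B" "B \<subseteq> P" "finite B" "\<Prod>B \<le> N div p" by (auto simp: bounded_prime_sets_def)
        have "p \<notin> B" using B p by auto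
        hence "\<Prod>A = p * \<Prod>B" using B by simp
        also have "\<dots> \<le> N" using B(4) p0 by (simp add: less_eq_div_iff_mult_less_eq mult.commute)
        finally show ?thesis using B by (auto simp: bounded_prime_sets_def)
      qed (auto simp: bounded_prime_sets_def)
    qed
  qed
  have notin: "p \<notin> A" if "A \<in> bounded_prime_sets P M" for A M using that p by (auto simp: bounded_prime_sets_def)
  have "divisor_mean (insert p P) N = divisor_mean P N + (\<Sum>A\<in>insert p ` bounded_prime_sets P (N div p). (-2) ^ card A / real (\<Prod>A))"
    unfolding divisor_mean_def eq using finP notin by (intro sum.union_disjoint) auto
  also have "(\<Sum>A\<in>insert p ` bounded_prime_sets P (N div p). (-2) ^ card A / real (\<Prod>A)) = (\<Sum>B\<in>bounded_prime_sets P (N div p). (-2) ^ card (insert p B) / real (\<Prod>(insert p B)))"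
  proof (rule sum.reindex_cong[OF _ refl refl])
    show "inj_on (insert p) (bounded_prime_sets P (N div p))"
      using notin by (auto simp: inj_on_def insert_ident)
  qed
  also have "\<dots> = (\<Sum>B\<in>bounded_prime_sets P (N div p). - (2 / real p) * ((-2) ^ card B / real (\<Prod>B)))"
  proof (rule sum.cong[OF refl])
    fix B assume B: "B \<in> bounded_prime_sets P (N div p)"
    have "finite B" "p \<notin> B" using B notin[OF B] by (auto simp: bounded_prime_sets_def)
    thus "(-2) ^ card (insert p B) / real (\<Prod>(insert p B)) = - (2 / real p) * ((-2) ^ card B / real (\<Prod>B))" by simp
  qed
  also have "\<dots> = - (2 / real p) * divisor_mean P (N div p)" unfolding divisor_mean_def by (rule sum_distrib_left[symmetric])
  finally show ?thesis by simp
qed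

text \<open>By slow variation the recursion for a new prime multiplies by 1 - 2 / p up to o(1), a
  factor in [0, 1]. \<open>W\<close> is finite, so the errors can be kept below
  \<open>\<eta>\<close>; the start is the bound 1 + o(1).\<close>

lemma divisor_mean_eventually_le:
  assumes "finite W" "W \<inter> P = {}" "sparse_primes (W \<union> P)" "\<eta> > 0"
  shows "\<forall>\<^sub>F N in sequentially. \<bar>divisor_mean (W \<union> P) N\<bar> \<le> (\<Prod>p\<in>W. 1 - 2 / real p) + \<eta>"
  using assms
proof (induction W arbitrary: \<eta> rule: finite_induct)
  case empty
  have sp: "sparse_primes P" using empty by simp
  hence P: "P \<subseteq> {p. prime p}" by (simp add: sparse_primes_def)
  have "\<forall>\<^sub>F N in sequentially. abs_divisor_sum P N / real N < \<eta>"
    using abs_divisor_sum_little_o[OF sp] empty(3) by (rule order_tendstoD)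
  thus ?case using eventually_gt_at_top[of 0]
  proof eventually_elim
    case (elim N)
    thus ?case using divisor_mean_bound[OF P elim(2)] by simp
  qed
next
  case (insert p W)
  define R where "R = W \<union> P"
  have spR: "sparse_primes R" by (rule sparse_primes_subset[OF insert.prems(2)]) (auto simp: R_def)
  have prs: "insert p R \<subseteq> {p. prime p}" using insert.prems(2) by (auto simp: sparse_primes_def R_def)
  have pR: "p \<notin> R" using insert by (auto simp: R_def)
  have p2: "real p \<ge> 2" using prs prime_ge_2_nat[of p] by auto
  have "\<forall>\<^sub>F N in sequentially. \<bar>divisor_mean R N\<bar> \<le> (\<Prod>p\<in>W. 1 - 2 / real p) + \<eta> / 2"
    unfolding R_def by (rule insert.IH) (use insert.prems spR in \<open>auto simp: R_def\<close>)
  moreover have "\<forall>\<^sub>F N in sequentially. abs_divisor_sum R N / real N < \<eta> / 4"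
    using abs_divisor_sum_little_o[OF spR] by (rule order_tendstoD) (use insert.prems in simp)
  ultimately show ?case using eventually_gt_at_top[of 0]
  proof eventually_elim
    case (elim N)
    define e where "e = 2 / real p"
    have e: "0 \<le> e" "e \<le> 1" using p2 by (auto simp: e_def)
    define Pw where "Pw = (\<Prod>p\<in>W. 1 - 2 / real p)"
    have "divisor_mean (insert p R) N = (1 - e) * divisor_mean R N + e * (divisor_mean R N - divisor_mean R (N div p))"
      unfolding divisor_mean_insert[OF prs pR] e_def[symmetric] by (simp add: algebra_simps)
    hence "\<bar>divisor_mean (insert p R) N\<bar> \<le> \<bar>(1 - e) * divisor_mean R N\<bar> + \<bar>e * (divisor_mean R N - divisor_mean R (N div p))\<bar>" by linarith
    also have "\<bar>(1 - e) * divisor_mean R N\<bar> = (1 - e) * \<bar>divisor_mean R N\<bar>" using e by (simp add: abs_mult)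
    also have "\<dots> \<le> (1 - e) * (Pw + \<eta> / 2)" using e elim(1) by (intro mult_left_mono) (auto simp: Pw_def)
    also have "\<bar>e * (divisor_mean R N - divisor_mean R (N div p))\<bar> = e * \<bar>divisor_mean R N - divisor_mean R (N div p)\<bar>" using e by (simp add: abs_mult)
    also have "\<dots> \<le> e * (real p * (abs_divisor_sum R N / real N))"
      using divisor_mean_div_diff[of R N p] prs elim(3) p2 e by (intro mult_left_mono) auto
    also have "\<dots> = 2 * (abs_divisor_sum R N / real N)" using p2 by (simp add: e_def)
    also have "\<dots> \<le> \<eta> / 2" using elim(2) by linarith
    finally have "\<bar>divisor_mean (insert p R) N\<bar> \<le> (1 - e) * (Pw + \<eta> / 2) + \<eta> / 2" by simp
    moreover have "(1 - e) * (\<eta> / 2) \<le> \<eta> / 2" using e insert.prems(3) by (intro mult_left_le_one_le) auto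
    ultimately have "\<bar>divisor_mean (insert p R) N\<bar> \<le> (1 - e) * Pw + \<eta>" by (simp add: distrib_left)
    thus ?case using insert.hyps by (simp add: R_def e_def Pw_def)
  qed
qed

lemma divisor_mean_tendsto_0:
  assumes sp: "sparse_primes P" and div: "\<And>K. \<exists>X0. \<forall>X\<ge>X0. recip_sum P 0 X \<ge> K"
  shows "(\<lambda>N. divisor_mean P N) \<longlonglongrightarrow> 0"
proof (rule LIMSEQ_I)
  fix r :: real assume r: "r > 0"
  have P: "P \<subseteq> {p. prime p}" using sp by (simp add: sparse_primes_def)
  \<comment> \<open>Chosen so that the product over the primes up to \<open>Y\<close>, at most the
    exponential of minus twice this sum, is at most r / 4.\<close>
  obtain Y where Y: "recip_sum P 0 Y \<ge> ln (4 / r) / 2" using div[of "ln (4 / r) / 2"] by blast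
  define W where "W = {p. p \<in> P \<and> 0 < real p \<and> real p \<le> Y}"
  have "finite W" unfolding W_def by (rule finite_real_le)
  hence W: "finite W" "W \<inter> (P - W) = {}" "W \<union> (P - W) = P" by (auto simp: W_def)
  have "\<forall>\<^sub>F N in sequentially. \<bar>divisor_mean (W \<union> (P - W)) N\<bar> \<le> (\<Prod>p\<in>W. 1 - 2 / real p) + r / 2"
    by (rule divisor_mean_eventually_le[OF W(1,2)]) (use W sp r in auto)
  hence ev: "\<forall>\<^sub>F N in sequentially. \<bar>divisor_mean P N\<bar> \<le> (\<Prod>p\<in>W. 1 - 2 / real p) + r / 2" by (simp only: W(3))
  have "(\<Prod>p\<in>W. 1 - 2 / real p) \<le> (\<Prod>p\<in>W. exp (- (2 / real p)))"
  proof (rule prod_mono)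
    fix p assume "p \<in> W"
    hence "real p \<ge> 2" using P prime_ge_2_nat[of p] by (auto simp: W_def)
    thus "0 \<le> 1 - 2 / real p \<and> 1 - 2 / real p \<le> exp (- (2 / real p))"
      using exp_ge_add_one_self[of "- (2 / real p)"] by simp
  qed
  also have "\<dots> = exp (\<Sum>p\<in>W. - (2 / real p))" by (rule exp_sum[OF W(1), symmetric])
  also have "(\<Sum>p\<in>W. - (2 / real p)) = - 2 * recip_sum P 0 Y"
    by (simp add: recip_sum_def W_def sum_distrib_left sum_negf)
  also have "exp (- 2 * recip_sum P 0 Y) \<le> exp (- ln (4 / r))" using Y by simp
  also have "\<dots> = r / 4" using r by (simp add: exp_minus)
  finally have "(\<Prod>p\<in>W. 1 - 2 / real p) \<le> r / 4" .
  hence "\<forall>\<^sub>F N in sequentially. norm (divisor_mean P N - 0) < r"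
    using ev r by (auto elim!: eventually_mono)
  thus "\<exists>no. \<forall>n\<ge>no. norm (divisor_mean P n - 0) < r" by (simp add: eventually_at_top_linorder)
qed

lemma lambda_real_mean_tendsto_0:
  fixes a b :: nat
  assumes sp: "sparse_primes P" and div: "\<And>K. \<exists>X0. \<forall>X\<ge>X0. recip_sum P 0 X \<ge> K"
    and a: "a > 0" "\<And>p. p \<in> P \<Longrightarrow> \<not> p dvd a"
  shows "(\<lambda>N. (\<Sum>n=1..N. lambda_real P (a * n + b)) / real N) \<longlonglongrightarrow> 0"
proof -
  have P: "P \<subseteq> {p. prime p}" using sp by (simp add: sparse_primes_def)
  have fl: "filterlim (\<lambda>N. a * N + b) sequentially sequentially"
  proof (rule filterlim_at_top_mono[OF filterlim_ident])
    have "N \<le> a * N + b" for N using a by (cases a) auto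
    thus "\<forall>\<^sub>F N in sequentially. N \<le> a * N + b" by simp
  qed
  have D: "(\<lambda>N. divisor_mean P (a * N + b)) \<longlonglongrightarrow> 0" by (rule filterlim_compose[OF divisor_mean_tendsto_0[OF sp div] fl])
  have H: "(\<lambda>N. abs_divisor_sum P (a * N + b) / real (a * N + b)) \<longlonglongrightarrow> 0" by (rule filterlim_compose[OF abs_divisor_sum_little_o[OF sp] fl])
  have "(\<lambda>N. \<bar>divisor_mean P (a * N + b)\<bar> + real (a + b) * (abs_divisor_sum P (a * N + b) / real (a * N + b))) \<longlonglongrightarrow> \<bar>0\<bar> + real (a + b) * 0"
    by (intro tendsto_intros D H)
  hence lim: "(\<lambda>N. \<bar>divisor_mean P (a * N + b)\<bar> + real (a + b) * (abs_divisor_sum P (a * N + b) / real (a * N + b))) \<longlonglongrightarrow> 0" by simp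
  show ?thesis
  proof (rule Lim_null_comparison[OF _ lim])
    show "\<forall>\<^sub>F N in sequentially. norm ((\<Sum>n=1..N. lambda_real P (a * n + b)) / real N)
        \<le> \<bar>divisor_mean P (a * N + b)\<bar> + real (a + b) * (abs_divisor_sum P (a * N + b) / real (a * N + b))"
      using eventually_gt_at_top[of 0]
    proof eventually_elim
      case (elim N)
      define M where "M = a * N + b"
      have M: "real M > 0" "real M \<le> real (a + b) * real N"
      proof -
        have "a * N > 0" using a elim by simp
        hence "M > 0" by (simp add: M_def)
        thus "real M > 0" by simp
        have "M \<le> (a + b) * N" using elim by (simp add: M_def add_mult_distrib)
        thus "real M \<le> real (a + b) * real N" by (metis of_nat_le_iff of_nat_mult)
      qed
      define S where "S = (\<Sum>n=1..N. lambda_real P (a * n + b))"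
      have "\<bar>S - real N * divisor_mean P M\<bar> \<le> abs_divisor_sum P M"
        unfolding S_def M_def by (rule sum_lambda_real_progression[OF P a])
      moreover have "\<bar>real N * divisor_mean P M\<bar> = real N * \<bar>divisor_mean P M\<bar>" by (simp add: abs_mult)
      ultimately have "\<bar>S\<bar> \<le> real N * \<bar>divisor_mean P M\<bar> + abs_divisor_sum P M" by linarith
      also have "abs_divisor_sum P M = real M * (abs_divisor_sum P M / real M)" using M by simp
      also have "\<dots> \<le> (real (a + b) * real N) * (abs_divisor_sum P M / real M)"
        using M abs_divisor_sum_nonneg[of P M] by (intro mult_right_mono) auto
      finally have "\<bar>S\<bar> \<le> real N * (\<bar>divisor_mean P M\<bar> + real (a + b) * (abs_divisor_sum P M / real M))"
        by (simp only: distrib_left mult_ac)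
      thus ?case using elim by (simp add: S_def M_def divide_le_eq mult.commute)
    qed
  qed
qed

lemma recip_sum_remove_finite_at_top:
  assumes div: "\<And>K. \<exists>X0. \<forall>X\<ge>X0. recip_sum P 0 X \<ge> K" and fin: "finite (P - P')"
  shows "\<exists>X0. \<forall>X\<ge>X0. recip_sum P' 0 X \<ge> K"
proof -
  define C where "C = (\<Sum>p\<in>P - P'. 1 / real p)"
  obtain X0 where X0: "\<And>X. X \<ge> X0 \<Longrightarrow> recip_sum P 0 X \<ge> K + C" using div[of "K + C"] by blast
  have "recip_sum P' 0 X \<ge> K" if "X \<ge> X0" for X
  proof -
    have "recip_sum P 0 X \<le> (\<Sum>p\<in>(P - P') \<union> {p. p \<in> P' \<and> 0 < real p \<and> real p \<le> X}. 1 / real p)"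
      unfolding recip_sum_def using fin finite_real_le[of P' 0 X] by (intro sum_mono2) auto
    also have "\<dots> = C + recip_sum P' 0 X"
      unfolding C_def recip_sum_def using fin finite_real_le[of P' 0 X] by (intro sum.union_disjoint) auto
    finally show ?thesis using X0[OF that] by linarith
  qed
  thus ?thesis by blast
qed

text \<open>A prime of \<open>P\<close> dividing \<open>a\<close> divides a n + b exactly when it
  divides \<open>b\<close>. These finitely many primes contribute the constant sign (-1)^w, and
  dropping them from \<open>P\<close> preserves the divergence.\<close>

lemma aperiodic_lambda_on:
  assumes sp: "sparse_primes P" and div: "\<And>K. \<exists>X0. \<forall>X\<ge>X0. recip_sum P 0 X \<ge> K"
    and f: "\<And>n. n > 0 \<Longrightarrow> f n = lambda_on P n"
  shows "aperiodic f"
  unfolding aperiodic_def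
proof (intro allI impI)
  fix a b :: nat assume a: "a > 0"
  define P' where "P' = {p \<in> P. \<not> p dvd a}"
  define w where "w = card {p \<in> P. prime p \<and> p dvd a \<and> p dvd b}"
  have finA: "finite {p. p dvd a}" using a by simp
  have sp': "sparse_primes P'" by (rule sparse_primes_subset[OF sp]) (auto simp: P'_def)
  have div': "\<exists>X0. \<forall>X\<ge>X0. recip_sum P' 0 X \<ge> K" for K
    by (rule recip_sum_remove_finite_at_top[OF div]) (auto simp: P'_def intro: finite_subset[OF _ finA])
  have om: "omega_on P (a * n + b) = w + omega_on P' (a * n + b)" if "n > 0" for n
  proof -
    have fin: "finite {p \<in> P. prime p \<and> p dvd a * n + b}"
      by (rule finite_subset[of _ "{..a * n + b}"]) (use that a in \<open>auto intro: dvd_imp_le\<close>)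
    have "{p \<in> P. prime p \<and> p dvd a * n + b} = {p \<in> P. prime p \<and> p dvd a \<and> p dvd b} \<union> {p \<in> P'. prime p \<and> p dvd a * n + b}"
      by (auto simp: P'_def dvd_add_right_iff)
    moreover have "card ({p \<in> P. prime p \<and> p dvd a \<and> p dvd b} \<union> {p \<in> P'. prime p \<and> p dvd a * n + b})
        = w + omega_on P' (a * n + b)"
      unfolding w_def omega_on_def
      by (rule card_Un_disjoint) (use fin in \<open>auto simp: P'_def intro: finite_subset[OF _ fin] finite_subset[OF _ finA]\<close>)
    ultimately show ?thesis by (simp add: omega_on_def)
  qed
  have fn: "f (a * n + b) = of_real ((-1) ^ w * lambda_real P' (a * n + b))" if "n > 0" for n
    using f[of "a * n + b"] a that by (simp add: lambda_on_def om[OF that] lambda_real_def power_add)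
  have "(\<lambda>N. (-1) ^ w * ((\<Sum>n=1..N. lambda_real P' (a * n + b)) / real N)) \<longlonglongrightarrow> (-1) ^ w * 0"
    by (intro tendsto_intros lambda_real_mean_tendsto_0[OF sp' div' a]) (auto simp: P'_def)
  hence "(\<lambda>N. complex_of_real ((-1) ^ w * ((\<Sum>n=1..N. lambda_real P' (a * n + b)) / real N))) \<longlonglongrightarrow> of_real 0"
    by (intro tendsto_of_real) simp
  moreover have "complex_of_real ((-1) ^ w * ((\<Sum>n=1..N. lambda_real P' (a * n + b)) / real N)) = (\<Sum>n=1..N. f (a * n + b)) / of_nat N" for N
  proof -
    have "(\<Sum>n=1..N. f (a * n + b)) = (\<Sum>n=1..N. complex_of_real ((-1) ^ w * lambda_real P' (a * n + b)))"
      by (intro sum.cong fn) auto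
    also have "\<dots> = of_real ((-1) ^ w * (\<Sum>n=1..N. lambda_real P' (a * n + b)))" by (simp add: sum_distrib_left)
    finally show ?thesis by simp
  qed
  ultimately show "(\<lambda>N. (\<Sum>n=1..N. f (a * n + b)) / of_nat N) \<longlonglongrightarrow> 0" by (simp only: of_real_0)
qed



section \<open>Aperiodicity\<close>

lemma lambda_on_prime:
  assumes "prime p"
  shows "lambda_on P p = (if p \<in> P then -1 else 1)"
proof -
  have "{r \<in> P. prime r \<and> r dvd p} = (if p \<in> P then {p} else {})"
    using assms primes_dvd_imp_eq by auto
  thus ?thesis by (simp add: lambda_on_def omega_on_def)
qed

lemma nat_powr_ii:
  assumes "n > (0::nat)"
  shows "of_nat n powr (\<i> * of_real t) = cis (t * ln (real n))"
proof -
  have "\<i> * of_real t = Complex 0 t" by (simp add: complex_eq_iff)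
  thus ?thesis using nat_powr_complex[OF assms, of 0 t] assms by simp
qed

lemma twisted_prime_sum_eq_twist:
  assumes "\<And>n. n > 0 \<Longrightarrow> f n = lambda_on P n"
  shows "twisted_prime_sum f chi t X = twist P (\<lambda>p. chi p * cis (t * ln (real p))) X"
  unfolding twisted_prime_sum_def twist_def
proof (rule sum.cong[OF refl])
  fix p assume p: "p \<in> primes_le X"
  hence p0: "p > 0" by (auto intro: prime_gt_0_nat)
  have "f p = (if p \<in> P then -1 else 1)" using assms[OF p0] lambda_on_prime[of p P] p by simp
  thus "1 / real p * (1 - Re (f p * chi p * of_nat p powr (\<i> * of_real t)))
      = (1 - (if p \<in> P then -1 else 1) * Re (chi p * cis (t * ln (real p)))) / real p"
    unfolding nat_powr_ii[OF p0] by simp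
qed

lemma min_twisted_sum_ge:
  assumes "T \<ge> 0" "Q \<ge> 1"
    and "\<And>t chi. \<bar>t\<bar> \<le> T \<Longrightarrow> chi \<in> characters_upto Q \<Longrightarrow> K \<le> twisted_prime_sum f chi t X"
  shows "K \<le> min_twisted_sum f T Q X"
  unfolding min_twisted_sum_def
proof (rule cINF_greatest)
  show "{t. \<bar>t\<bar> \<le> T} \<noteq> {}" using assms(1) by (auto intro: exI[of _ 0])
  fix t assume "t \<in> {t. \<bar>t\<bar> \<le> T}"
  thus "K \<le> Min ((\<lambda>chi. twisted_prime_sum f chi t X) ` characters_upto Q)"
    using assms(2,3) finite_characters_upto characters_upto_nonempty by (subst Min_ge_iff) auto
qed

text \<open>\<open>lower\<close> makes the family bounded below, which is what puts a real
  \<open>INF\<close> below its members.\<close>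

lemma min_twisted_sum_le:
  assumes "\<bar>t\<bar> \<le> T" "chi \<in> characters_upto Q"
    and lower: "\<And>t chi. \<bar>t\<bar> \<le> T \<Longrightarrow> chi \<in> characters_upto Q \<Longrightarrow> K \<le> twisted_prime_sum f chi t X"
  shows "min_twisted_sum f T Q X \<le> twisted_prime_sum f chi t X"
proof -
  have "min_twisted_sum f T Q X \<le> Min ((\<lambda>chi. twisted_prime_sum f chi t X) ` characters_upto Q)"
    unfolding min_twisted_sum_def
  proof (rule cINF_lower)
    show "bdd_below ((\<lambda>t. Min ((\<lambda>chi. twisted_prime_sum f chi t X) ` characters_upto Q)) ` {t. \<bar>t\<bar> \<le> T})"
      using lower assms(2) finite_characters_upto
      by (intro bdd_belowI2[of _ K]) (subst Min_ge_iff; auto)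
  qed (use assms in simp)
  also have "\<dots> \<le> twisted_prime_sum f chi t X"
    using assms(2) finite_characters_upto by (intro Min_le) auto
  finally show ?thesis .
qed

lemma twisted_prime_sum_nonneg:
  assumes "\<And>n. n > 0 \<Longrightarrow> f n = lambda_on P n" "chi \<in> characters_upto Q"
  shows "0 \<le> twisted_prime_sum f chi t X"
proof -
  obtain q where chi: "dirichlet_character q chi" using assms(2) by (auto simp: characters_upto_def)
  have eq: "twisted_prime_sum f chi t X = twist P (\<lambda>p. chi p * cis (t * ln (real p))) X"
    by (rule twisted_prime_sum_eq_twist) (rule assms(1))
  show ?thesis
    unfolding eq twist_def
    by (intro sum_nonneg twist_term_nonneg) (simp add: norm_mult norm_dirichlet_character_le[OF chi])
qed

lemma strongly_aperiodic_lambda_on: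
  assumes P: "P \<subseteq> {p. prime p}" and dens: "zero_relative_density P"
    and div: "\<And>K. \<exists>X0. \<forall>X\<ge>X0. recip_sum P 0 X \<ge> K"
    and f: "\<And>n. n > 0 \<Longrightarrow> f n = lambda_on P n"
  shows "strongly_aperiodic f"
  unfolding strongly_aperiodic_def filterlim_at_top
proof (intro allI impI)
  fix Q K :: real assume Q: "Q \<ge> 1"
  show "\<forall>\<^sub>F X in at_top. K \<le> min_twisted_sum f X Q X"
    using twist_nonprincipal_large[OF P dens, of Q K] twist_principal_large[OF P dens div, of Q K]
      twist_large_frequency_large[OF P dens Q, of K] eventually_ge_at_top[of 0]
  proof eventually_elim
    case (elim X)
    show ?case
    proof (rule min_twisted_sum_ge[OF elim(4) Q])
      fix t chi assume t: "\<bar>t\<bar> \<le> X" and "chi \<in> characters_upto Q"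
      then obtain q where q: "real q \<le> Q" "dirichlet_character q chi" by (auto simp: characters_upto_def)
      have eq: "twisted_prime_sum f chi t X = twist P (\<lambda>p. chi p * cis (t * ln (real p))) X"
        by (rule twisted_prime_sum_eq_twist) (rule f)
      show "K \<le> twisted_prime_sum f chi t X"
        unfolding eq
      proof (cases "2 \<le> \<bar>t\<bar>")
        case True
        thus "K \<le> twist P (\<lambda>p. chi p * cis (t * ln (real p))) X" using elim(3) q t by blast
      next
        case False
        hence "\<bar>t\<bar> \<le> 2" by simp
        thus "K \<le> twist P (\<lambda>p. chi p * cis (t * ln (real p))) X" using elim(1,2) q by blast
      qed
    qed
  qed
qed

text \<open>The infimum lies between 0 and the value at t = 0 and the constant character 1, which is
  twice the reciprocal sum of \<open>P\<close>. This pair belongs to the family for every exponent,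
  so \<open>A\<close> = 1 serves.\<close>

lemma moderately_aperiodic_lambda_on:
  assumes sp: "sparse_primes P" and div: "\<And>K. \<exists>X0. \<forall>X\<ge>X0. recip_sum P 0 X \<ge> K"
    and f: "\<And>n. n > 0 \<Longrightarrow> f n = lambda_on P n"
  shows "moderately_aperiodic f"
  unfolding moderately_aperiodic_def
proof (intro conjI exI[of _ "1::real"])
  show "aperiodic f" by (rule aperiodic_lambda_on[OF sp div f])
  have P: "P \<subseteq> {p. prime p}" using sp by (simp add: sparse_primes_def)
  define m where "m X = min_twisted_sum f (X powr 1) (ln X powr 1) X" for X
  have bounds: "0 \<le> m X \<and> m X \<le> 2 * recip_sum P 0 X" if X: "exp 1 \<le> X" for X
  proof -
    have X0: "X > 0" using X exp_gt_zero[of 1] by linarith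
    have lX: "ln X \<ge> 1" using X X0 by (simp add: ln_ge_iff)
    have Q: "ln X powr 1 \<ge> 1" using lX by simp
    have triv: "(\<lambda>_. 1) \<in> characters_upto (ln X powr 1)"
      unfolding characters_upto_def using Q by (intro CollectI exI[of _ 1]) (simp add: dirichlet_character_def)
    have "0 \<le> m X"
      unfolding m_def using Q twisted_prime_sum_nonneg[OF f] by (intro min_twisted_sum_ge) auto
    moreover have "m X \<le> twisted_prime_sum f (\<lambda>_. 1) 0 X"
      unfolding m_def
      by (rule min_twisted_sum_le[OF _ triv, where K = 0]) (use twisted_prime_sum_nonneg[OF f] in auto)
    moreover have "twisted_prime_sum f (\<lambda>_. 1) 0 X = 2 * recip_sum P 0 X"
    proof -
      have "twisted_prime_sum f (\<lambda>_. 1) 0 X = twist P (\<lambda>p. 1 * cis (0 * ln (real p))) X"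
        by (rule twisted_prime_sum_eq_twist) (rule f)
      also have "\<dots> = (\<Sum>p\<in>primes_le X. if p \<in> P then 2 / real p else 0)"
        unfolding twist_def by (intro sum.cong) auto
      also have "\<dots> = 2 * recip_sum P 0 X" by (rule sum_two_over_primes_le[OF P])
      finally show ?thesis .
    qed
    ultimately show ?thesis by simp
  qed
  have "((\<lambda>X. 1 / ln (ln X) * m X) \<longlongrightarrow> 0) at_top"
  proof (rule tendstoI)
    fix e :: real assume e: "e > 0"
    have "\<forall>\<^sub>F X in at_top. recip_sum P 0 X \<le> e / 4 * ln (ln X)"
      by (rule sparse_primesD[OF sp]) (use e in simp)
    thus "\<forall>\<^sub>F X in at_top. dist (1 / ln (ln X) * m X) 0 < e"
      using eventually_ge_at_top[of "exp 1"] eventually_ln_ln_ge[of 1]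
    proof eventually_elim
      case (elim X)
      have m: "0 \<le> m X" "m X \<le> 2 * recip_sum P 0 X" using bounds[OF elim(2)] by auto
      have "m X \<le> e / 2 * ln (ln X)" using m(2) elim(1) by simp
      also have "\<dots> < e * ln (ln X)" using e elim(3) by (intro mult_strict_right_mono) auto
      finally have "m X / ln (ln X) < e" using elim(3) by (simp add: divide_less_eq)
      thus ?case using m(1) elim(3) by simp
    qed
  qed
  thus "((\<lambda>X. 1 / ln (ln X) * min_twisted_sum f (X powr 1) (ln X powr 1) X) \<longlongrightarrow> 0) at_top"
    by (simp only: m_def)
qed simp

theorem proposition4p1:
  fixes f :: "nat \<Rightarrow> complex"
  assumes "f \<in> mult_unit_disc" and "liouville_like f"
  shows "moderately_aperiodic f \<and> strongly_aperiodic f"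
proof -
  obtain P where P: "P \<subseteq> {p. prime p}" and dens: "zero_relative_density P"
    and fl: "filterlim (\<lambda>N::nat. \<Sum>p\<in>{p \<in> P. p \<le> N}. 1 / real p) at_top sequentially"
    and f: "\<And>n. n > 0 \<Longrightarrow> f n = lambda_on P n"
    using assms(2) unfolding liouville_like_def by blast
  have div: "\<exists>X0. \<forall>X\<ge>X0. recip_sum P 0 X \<ge> K" for K by (rule recip_sum_at_top[OF fl P])
  have sp: "sparse_primes P"
    unfolding sparse_primes_def using P sparse_recip_sum_small[OF P dens] by blast
  show ?thesis
    using moderately_aperiodic_lambda_on[OF sp div f] strongly_aperiodic_lambda_on[OF P dens div f] by blast
qed

end
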